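(* Let $\delta>0$. The function $v^\delta:\mathbf N_0^n\to\mathbf R$, $v^\delta(\mathbf m)=\sup_{\pi\in\Pi^\delta_{g^\delta(\mathbf m)}}V_\pi(g^\delta(\mathbf m))$, is well defined (finite) and is a solution of the discrete HJB equation: $T(v^\delta)(\mathbf m)=v^\delta(\mathbf m)$ for all $\mathbf m\in\mathbf N_0^n$. Moreover, for every initial surplus $g^\delta(\mathbf m_0)\in\mathcal G^\delta$ there exists a strategy $\pi^\delta_{g^\delta(\mathbf m_0)}\in\Pi^\delta_{g^\delta(\mathbf m_0)}$ such that $$v^\delta(\mathbf m_0)=V_{\pi^\delta_{g^\delta(\mathbf m_0)}}(g^\delta(\mathbf m_0)),$$ and this strategy is stationary in the sense that each control action $s_k$ in its sequence $(s_k)_{k=1,\dots,\tilde k}$ depends only on the current surplus $g^\delta(\mathbf m^k)\in\mathcal G^\delta$ at which $s_k$ is applied.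
   Context: **Notation.** $\mathbf{R}_+^n=[0,\infty)^n$, $\mathbf{N}_0=\{0,1,2,\dots\}$, $\le$ on $\mathbf R^n$ is componentwise, $\mathbf 1=(1,\dots,1)$, $(\mathbf e_i)$ is the standard basis of $\mathbf R^n$. **Model.** Fix $n\ge1$, $\mathbf p=(p_1,\dots,p_n)$ with $p_i>0$, $\mathbf a=(a_1,\dots,a_n)$ with $a_i>0$, $c>0$, $\lambda>0$. Let $(\tau_k)_{k\ge1}$ be the jump times of a Poisson process $N_t$ of intensity $\lambda$, and $(\mathbf U_k)_{k\ge1}$ i.i.d. random vectors in $\mathbf R_+^n$, independent of $N$, with distribution function $F$, $\mathbb E\|\mathbf U_k\|<\infty$, $F(\mathbf 0)=0$. $\Omega$ is the space of sequences $(\tau_k,\mathbf U_k)_{k\ge1}$ and $\mathcal F_t$ is generated by $\{(\tau_k,\mathbf U_k):\tau_k\le t\}$. For initial surplus $\mathbf x\in\mathbf R_+^n$, $\mathbf X_t=\mathbf x+\mathbf p t-\sum_{k=1}^{N_t}\mathbf U_k$. An admissible dividend strategy is a process $\mathbf L_t\in\mathbf R_+^n$, componentwise non-decreasing, càdlàg, adapted, with $\mathbf L_0\ge 0$ (and $\mathbf L_{0^-}=\mathbf 0$), $\mathbf L_t\le\mathbf X_t$ for $0\le t<\tau^{\mathbf L}$, where $\tau^{\mathbf L}:=\inf\{\tau_k:\mathbf X_{\tau_k}-\mathbf L_{\tau_k^-}\notin\mathbf R_+^n\}$, and $\mathbf L_t=\mathbf L_{\tau^{\mathbf L -}}$ for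 $t\ge\tau^{\mathbf L}$. The controlled surplus is $\mathbf X^{\mathbf L}_t=\mathbf X_t-\mathbf L_t$. $\Pi_{\mathbf x}$ is the set of pairs $\pi=(\mathbf L,\overline\tau)$ with $\mathbf L$ admissible and $\overline\tau$ a switch time (a $[0,\infty]$-valued stopping time). Let $B=\{(\mathbf x,\boldsymbol\alpha)\in\mathbf R_+^n\times\mathbf R_+^n:\mathbf x-\boldsymbol\alpha\notin\mathbf R_+^n\}$. The penalty $\upsilon:B\to\mathbf R$ is non-increasing in $\mathbf x$, non-decreasing in $\boldsymbol\alpha$, and $\mathbb E|\upsilon(\mathbf 0,\mathbf U_1)|<\infty$. The switch-value function $f:\mathbf R_+^n\to\mathbf R$ is either right continuous and non-decreasing, or continuous. With $\int_{0^-}^t e^{-cs}\mathbf a\cdot d\mathbf L_s=\mathbf a\cdot\mathbf L_0+\int_0^te^{-cs}\mathbf a\cdot d\mathbf L_s$, define $$V_\pi(\mathbf x)=\mathbb E_{\mathbf x}\Big(\int_{0^-}^{\overline\tau\wedge\tau^{\mathbf L}}e^{-cs}\mathbf a\cdot d\mathbf L_s+I_{\{\overline\tau<\tau^{\mathbf L}\}}e^{-c\overline\tau}f(\mathbf X^{\mathbf L}_{\overline\tau})\Big)-\mathbb E_{\mathbf x}\Big(I_{\{\overline\tau\ge\tau^{\mathbf L}\}}e^{-c\tau^{\mathbf L}}\upsilon(\mathbf X^{\mathbf L}_{\tau^{\mathbf L-}},\mathbf X^{\mathbf L}_{\tau^{\mathbf L-}}-\mathbf X^{\mathbf L}_{\tau^{\mathbf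 L}})\Big)$$ (terms with $e^{-c\cdot\infty}$ are $0$). **Standing assumptions.** A function $h:\mathbf R_+^n\to\mathbf R$ satisfies the growth condition GC if $h/h_0$ is bounded above on $\mathbf R_+^n$, where $h_0(\mathbf x)=e^{\frac{c}{2n}\sum_{i=1}^n x_i/p_i}$. The functions $f$ and $S(\mathbf x):=\sup_{\{\boldsymbol\alpha:(\mathbf x,\boldsymbol\alpha)\in B\}}(-\upsilon(\mathbf x,\boldsymbol\alpha))$ satisfy GC, and $\mathcal R(\mathbf x):=\lambda\int_{\mathbf x-\boldsymbol\alpha\notin\mathbf R_+^n}\upsilon(\mathbf x,\boldsymbol\alpha)\,dF(\boldsymbol\alpha)$ is continuous on $\mathbf R_+^n$. **Grid strategies.** For $\delta>0$ let $g^\delta(\mathbf m)=(p_1\delta m_1,\dots,p_n\delta m_n)$ for $\mathbf m\in\mathbf N_0^n$, $\mathcal G^\delta=g^\delta(\mathbf N_0^n)$, $\rho^\delta(\mathbf x)=([x_1/(\delta p_1)],\dots,[x_n/(\delta p_n)])$ (integer parts), and $\langle\mathbf x\rangle^\delta=g^\delta(\rho^\delta(\mathbf x))$. At surplus $g^\delta(\mathbf m)$, with $\tau$ the waiting time until the next jump and $\mathbf U$ its size, the control actions are: - $\mathbf E_0$: pay no dividends up to time $\delta\wedge\tau$. If $\tau>\delta$, the action ends after time $\delta$ at surplus $g^\delta(\mathbf m+\mathbf 1)$. If $\tau\le\delta$ and $\mathbf y:=g^\delta(\mathbf m)+\tau\mathbf p-\mathbf U\in\mathbf R_+^n$, then at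 time $\tau$ the dividend $\mathbf y-\langle\mathbf y\rangle^\delta$ is paid and the end surplus is $\langle\mathbf y\rangle^\delta$. If $\tau\le\delta$ and $\mathbf y\notin\mathbf R_+^n$, the process stops (ruin). - $\mathbf E_i$ ($1\le i\le n$, allowed only if $m_i>0$): company $i$ immediately pays $p_i\delta$; the end surplus is $g^\delta(\mathbf m-\mathbf e_i)$. - $\mathbf E_s$: switch immediately; the process stops. $\Pi^\delta_{g^\delta(\mathbf m)}\subset\Pi_{g^\delta(\mathbf m)}$ is the set of admissible strategies obtained by applying successively, starting at $g^\delta(\mathbf m)$, a finite or infinite sequence $(s_k)_{k=1,\dots,\tilde k}$ ($1\le\tilde k\le\infty$, depending on $\omega\in\Omega$) of control actions, each applied at the end surplus of the previous one (if $\tilde k<\infty$ the last action is $\mathbf E_s$, or $\mathbf E_0$ ending in ruin), non-anticipatively: if two elements of $\Omega$ have the same jump times and sizes up to time $t$, their sequences agree for all actions chosen at times $\le t$. $g^\delta(\mathbf m^k)$ denotes the grid point at which $s_k$ is applied. **Discrete HJB operators.** For $w:\mathbf N_0^n\to\mathbf R$, $$T_0(w)(\mathbf m)=w(\mathbf m+\mathbf 1)e^{-(c+\lambda)\delta}+\mathcal I^\delta(w)(\mathbf m)-\int_0^\delta e^{-(c+\lambda)t}\mathcal R(g^\delta(\mathbf m)+t\mathbf p)\,dt,$$ $$\mathcal I^\delta(w)(\mathbf m)=\int_0^\delta\!\!\int_{\mathbf 0\le\boldsymbol\alpha\le\mathbf z_t}\lambda e^{-(c+\lambda)t}\big[w(\rho^\delta(\mathbf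 z_t-\boldsymbol\alpha))+\mathbf a\cdot(\mathbf z_t-\boldsymbol\alpha-\langle\mathbf z_t-\boldsymbol\alpha\rangle^\delta)\big]dF(\boldsymbol\alpha)\,dt,\quad \mathbf z_t=g^\delta(\mathbf m)+t\mathbf p,$$ $T_i(w)(\mathbf m)=w(\mathbf m-\mathbf e_i)+\delta a_ip_i$ (only when $m_i>0$), $T_s(w)(\mathbf m)=f(g^\delta(\mathbf m))$, and $T=\max\{T_0,(T_i)_{i=1,\dots,n},T_s\}$ (at $\mathbf m$, only those $T_i$ with $m_i>0$ enter the maximum). The discrete HJB equation is $T(w)-w=0$ on $\mathbf N_0^n$. *)

theory Defs
  imports "HOL-Probability.Probability"
begin

text \<open>
  An insurance group of \<open>n = CARD('n)\<close> companies. The orthant \<open>[0,\<infinity>)\<^sup>n\<close> is \<open>{x :: real ^ 'n. 0 \<le> x}\<close>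
  for the componentwise order; the model functions below are only ever constrained and evaluated
  on the domains on which they are meant to be defined.
\<close>

record ('n :: finite) risk_model =
  premium :: "real ^ 'n"
  weight :: "real ^ 'n"
  discount :: real
  intensity :: real
  claim_law :: "(real ^ 'n) measure"
  penalty :: "real ^ 'n \<Rightarrow> real ^ 'n \<Rightarrow> real"
  switch_value :: "real ^ 'n \<Rightarrow> real"

definition ruin_pairs :: "((real ^ 'n) \<times> (real ^ 'n)) set" where
  "ruin_pairs = {(x, \<alpha>). 0 \<le> x \<and> 0 \<le> \<alpha> \<and> \<not> 0 \<le> x - \<alpha>}"

definition growth_weight :: "('n :: finite) risk_model \<Rightarrow> real ^ 'n \<Rightarrow> real" where
  "growth_weight M x =
     exp (discount M / (2 * real CARD('n)) * (\<Sum>i\<in>UNIV. x $ i / premium M $ i))"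

definition growth_condition :: "('n :: finite) risk_model \<Rightarrow> (real ^ 'n \<Rightarrow> real) \<Rightarrow> bool" where
  "growth_condition M h \<longleftrightarrow> bdd_above ((\<lambda>x. h x / growth_weight M x) ` {x. 0 \<le> x})"

definition expected_penalty :: "('n :: finite) risk_model \<Rightarrow> real ^ 'n \<Rightarrow> real" where
  "expected_penalty M x = intensity M *
     (LINT \<alpha>:{\<alpha>. (x, \<alpha>) \<in> ruin_pairs}|claim_law M. penalty M x \<alpha>)"

text \<open>
  The distribution function \<open>F\<close> of the claims is represented by the associated law; as claims
  are nonnegative, \<open>F(0) = 0\<close> says that the origin carries no mass. Borel measurability of the
  penalty is implicit in the expectations in which it occurs (monotonicity does not give it
  when \<open>n \<ge> 2\<close>). The assumption \<open>penalty_bdd\<close> says that the supremum in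
  \<open>penalty_growth\<close> is finite.
\<close>

locale dividend_model =
  fixes M :: "('n :: finite) risk_model"
  assumes premium_pos: "\<And>i. 0 < premium M $ i"
    and weight_pos: "\<And>i. 0 < weight M $ i"
    and discount_pos: "0 < discount M"
    and intensity_pos: "0 < intensity M"
    and claim_prob: "prob_space (claim_law M)"
    and claim_sets: "sets (claim_law M) = sets borel"
    and claim_nonneg: "AE u in claim_law M. 0 \<le> u"
    and claim_integrable: "integrable (claim_law M) norm"
    and claim_no_atom_0: "measure (claim_law M) {0} = 0"
    and penalty_measurable:
      "case_prod (penalty M) \<in> borel_measurable (restrict_space borel ruin_pairs)"
    and penalty_antimono: "\<And>x x' \<alpha>. \<lbrakk>(x, \<alpha>) \<in> ruin_pairs; (x', \<alpha>) \<in> ruin_pairs; x \<le> x'\<rbrakk>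
      \<Longrightarrow> penalty M x' \<alpha> \<le> penalty M x \<alpha>"
    and penalty_mono: "\<And>x \<alpha> \<alpha>'. \<lbrakk>(x, \<alpha>) \<in> ruin_pairs; (x, \<alpha>') \<in> ruin_pairs; \<alpha> \<le> \<alpha>'\<rbrakk>
      \<Longrightarrow> penalty M x \<alpha> \<le> penalty M x \<alpha>'"
    and penalty_integrable:
      "set_integrable (claim_law M) {\<alpha>. (0, \<alpha>) \<in> ruin_pairs} (penalty M 0)"
    and switch_regular:
      "(mono_on {x. 0 \<le> x} (switch_value M) \<and>
          (\<forall>x\<ge>0. continuous (at x within {y. x \<le> y}) (switch_value M)))
        \<or> continuous_on {x. 0 \<le> x} (switch_value M)"
    and switch_growth: "growth_condition M (switch_value M)"
    and penalty_bdd: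
      "\<And>x. 0 \<le> x \<Longrightarrow> bdd_above ((\<lambda>\<alpha>. - penalty M x \<alpha>) ` {\<alpha>. (x, \<alpha>) \<in> ruin_pairs})"
    and penalty_growth:
      "growth_condition M (\<lambda>x. SUP \<alpha>\<in>{\<alpha>. (x, \<alpha>) \<in> ruin_pairs}. - penalty M x \<alpha>)"
    and expected_penalty_continuous: "continuous_on {x. 0 \<le> x} (expected_penalty M)"

text \<open>
  A path is the sequence of jump times and jump sizes; jumps are numbered from \<open>0\<close>, so
  \<open>\<omega> k\<close> is the pair written \<open>(\<tau>\<^sub>k\<^sub>+\<^sub>1, U\<^sub>k\<^sub>+\<^sub>1)\<close> when counting from one.
\<close>

type_synonym 'n path = "nat \<Rightarrow> real \<times> (real ^ 'n)"

abbreviation jump_time :: "('n :: finite) path \<Rightarrow> nat \<Rightarrow> real" where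
  "jump_time \<omega> k \<equiv> fst (\<omega> k)"

abbreviation jump_size :: "('n :: finite) path \<Rightarrow> nat \<Rightarrow> real ^ 'n" where
  "jump_size \<omega> k \<equiv> snd (\<omega> k)"

definition paths :: "('n :: finite) path set" where
  "paths = {\<omega>. 0 < jump_time \<omega> 0 \<and> strict_mono (jump_time \<omega>) \<and>
     filterlim (jump_time \<omega>) at_top sequentially \<and> (\<forall>k. 0 \<le> jump_size \<omega> k)}"

text \<open>
  The Poisson process is given by its independent exponential waiting times: under the product
  measure, the \<open>k\<close>-th coordinate is the waiting time before jump \<open>k\<close> together with the size of
  that jump. The set \<^const>\<open>paths\<close> has full measure for the image measure.
\<close>

definition path_measure :: "('n :: finite) risk_model \<Rightarrow> 'n path measure" where
  "path_measure M = restrict_space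
     (distr (\<Pi>\<^sub>M k\<in>UNIV. density lborel (exponential_density (intensity M)) \<Otimes>\<^sub>M claim_law M)
        (\<Pi>\<^sub>M k\<in>UNIV. borel \<Otimes>\<^sub>M borel)
        (\<lambda>\<xi> k. (\<Sum>j\<le>k. fst (\<xi> j), snd (\<xi> k))))
     paths"

definition jump_filtration :: "ennreal \<Rightarrow> ('n :: finite) path measure" where
  "jump_filtration t = sigma paths
     {{\<omega> \<in> paths. ennreal (jump_time \<omega> k) \<le> t \<and> \<omega> k \<in> A} | k A. A \<in> sets borel}"

definition jump_count :: "('n :: finite) path \<Rightarrow> real \<Rightarrow> nat" where
  "jump_count \<omega> t = card {k. jump_time \<omega> k \<le> t}"

definition surplus :: "('n :: finite) risk_model \<Rightarrow> real ^ 'n \<Rightarrow> real \<Rightarrow> 'n path \<Rightarrow> real ^ 'n" where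
  "surplus M x t \<omega> = x + t *\<^sub>R premium M - (\<Sum>k<jump_count \<omega> t. jump_size \<omega> k)"

type_synonym 'n dividends = "real \<Rightarrow> 'n path \<Rightarrow> real ^ 'n"

text \<open>Only used at jump times, which are positive, so no convention for time \<open>0-\<close> is needed.\<close>

definition left_limit :: "(real \<Rightarrow> 'b :: t2_space) \<Rightarrow> real \<Rightarrow> 'b" where
  "left_limit Y t = Lim (at_left t) Y"

definition ruin_time ::
    "('n :: finite) risk_model \<Rightarrow> real ^ 'n \<Rightarrow> 'n dividends \<Rightarrow> 'n path \<Rightarrow> ennreal" where
  "ruin_time M x L \<omega> = Inf {ennreal (jump_time \<omega> k) | k.
     \<not> 0 \<le> surplus M x (jump_time \<omega> k) \<omega> - left_limit (\<lambda>s. L s \<omega>) (jump_time \<omega> k)}"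

definition controlled_surplus ::
    "('n :: finite) risk_model \<Rightarrow> real ^ 'n \<Rightarrow> 'n dividends \<Rightarrow> real \<Rightarrow> 'n path \<Rightarrow> real ^ 'n" where
  "controlled_surplus M x L t \<omega> = surplus M x t \<omega> - L t \<omega>"

definition admissible :: "('n :: finite) risk_model \<Rightarrow> real ^ 'n \<Rightarrow> 'n dividends \<Rightarrow> bool" where
  "admissible M x L \<longleftrightarrow>
     (\<forall>t\<ge>0. L t \<in> borel_measurable (jump_filtration (ennreal t))) \<and>
     (\<forall>\<omega>\<in>paths.
        (\<forall>t\<ge>0. 0 \<le> L t \<omega>) \<and>
        mono_on {0..} (\<lambda>t. L t \<omega>) \<and>
        (\<forall>t\<ge>0. continuous (at_right t) (\<lambda>s. L s \<omega>)) \<and>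
        (\<forall>t>0. \<exists>l. ((\<lambda>s. L s \<omega>) \<longlongrightarrow> l) (at_left t)) \<and>
        (\<forall>t\<ge>0. ennreal t < ruin_time M x L \<omega> \<longrightarrow> L t \<omega> \<le> surplus M x t \<omega>) \<and>
        (\<forall>t\<ge>0. ruin_time M x L \<omega> \<le> ennreal t \<longrightarrow>
           L t \<omega> = left_limit (\<lambda>s. L s \<omega>) (enn2real (ruin_time M x L \<omega>))))"

definition strategies ::
    "('n :: finite) risk_model \<Rightarrow> real ^ 'n \<Rightarrow> ('n dividends \<times> ('n path \<Rightarrow> ennreal)) set" where
  "strategies M x = {(L, T). admissible M x L \<and> stopping_time jump_filtration T}"

text \<open>
  The integral of \<open>e\<^sup>-\<^sup>c\<^sup>s\<close> against \<open>a \<bullet> dL\<^sub>s\<close> from \<open>0-\<close> up to and including \<open>T\<close>, as a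
  Lebesgue-Stieltjes integral. The path of \<open>L\<close> is extended by \<open>L\<^sub>0\<close> to negative times, so
  the initial payment is the separate first summand.
\<close>

definition discounted_dividends ::
    "('n :: finite) risk_model \<Rightarrow> 'n dividends \<Rightarrow> ennreal \<Rightarrow> 'n path \<Rightarrow> real" where
  "discounted_dividends M L T \<omega> = weight M \<bullet> L 0 \<omega> +
     (LINT s:{s. 0 < s \<and> ennreal s \<le> T}|interval_measure (\<lambda>s. weight M \<bullet> L (max 0 s) \<omega>).
        exp (- discount M * s))"

text \<open>
  Expectation with values in the extended reals. The growth condition bounds the
  switch-value function only from above, so the value of a strategy may be \<open>-\<infinity>\<close>
  (it is never \<open>\<infinity>\<close>), whereas the Bochner integral would then be \<open>0\<close>.
\<close>

definition extended_expectation :: "'a measure \<Rightarrow> ('a \<Rightarrow> real) \<Rightarrow> ereal" where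
  "extended_expectation P Z =
     enn2ereal (\<integral>\<^sup>+\<omega>. ennreal (Z \<omega>) \<partial>P) - enn2ereal (\<integral>\<^sup>+\<omega>. ennreal (- Z \<omega>) \<partial>P)"

definition strategy_value ::
    "('n :: finite) risk_model \<Rightarrow> real ^ 'n \<Rightarrow> 'n dividends \<times> ('n path \<Rightarrow> ennreal) \<Rightarrow> ereal" where
  "strategy_value M x = (\<lambda>(L, T).
     extended_expectation (path_measure M) (\<lambda>\<omega>.
       discounted_dividends M L (min (T \<omega>) (ruin_time M x L \<omega>)) \<omega> +
       (if T \<omega> < ruin_time M x L \<omega>
        then exp (- discount M * enn2real (T \<omega>)) *
             switch_value M (controlled_surplus M x L (enn2real (T \<omega>)) \<omega>)
        else 0))
     - extended_expectation (path_measure M) (\<lambda>\<omega>.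
       (if ruin_time M x L \<omega> \<le> T \<omega> \<and> ruin_time M x L \<omega> < \<infinity>
        then let r = enn2real (ruin_time M x L \<omega>);
                 z = left_limit (\<lambda>s. controlled_surplus M x L s \<omega>) r
             in exp (- discount M * r) * penalty M z (z - controlled_surplus M x L r \<omega>)
        else 0)))"

definition grid_point :: "('n :: finite) risk_model \<Rightarrow> real \<Rightarrow> nat ^ 'n \<Rightarrow> real ^ 'n" where
  "grid_point M \<delta> m = (\<chi> i. premium M $ i * \<delta> * real (m $ i))"

definition grid_index :: "('n :: finite) risk_model \<Rightarrow> real \<Rightarrow> real ^ 'n \<Rightarrow> nat ^ 'n" where
  "grid_index M \<delta> x = (\<chi> i. nat \<lfloor>x $ i / (\<delta> * premium M $ i)\<rfloor>)"

definition grid_floor :: "('n :: finite) risk_model \<Rightarrow> real \<Rightarrow> real ^ 'n \<Rightarrow> real ^ 'n" where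
  "grid_floor M \<delta> x = grid_point M \<delta> (grid_index M \<delta> x)"

text \<open>The control actions \<open>E\<^sub>0\<close>, \<open>E\<^sub>i\<close> and \<open>E\<^sub>s\<close>.\<close>

datatype 'n action = Wait | Pay 'n | Switch

text \<open>
  The effect of an action applied at time \<open>t\<close> at the grid point of index \<open>m\<close>: the time at which
  it ends, the index of the end surplus, and the dividend, which is always paid at the end time.
  The result is \<^const>\<open>None\<close> if the process stops (switch or ruin). All jumps up to
  time \<open>t\<close> having been processed, the next one has number \<open>jump_count \<omega> t\<close>.
\<close>

fun grid_step :: "('n :: finite) risk_model \<Rightarrow> real \<Rightarrow> 'n path \<Rightarrow> 'n action \<Rightarrow> real \<Rightarrow> nat ^ 'n \<Rightarrow>
    (real \<times> (nat ^ 'n) \<times> (real ^ 'n)) option" where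
  "grid_step M \<delta> \<omega> Wait t m =
     (let k = jump_count \<omega> t;
          r = jump_time \<omega> k - t;
          y = grid_point M \<delta> m + r *\<^sub>R premium M - jump_size \<omega> k
      in if \<delta> < r then Some (t + \<delta>, m + 1, 0)
         else if 0 \<le> y then Some (t + r, grid_index M \<delta> y, y - grid_floor M \<delta> y)
         else None)"
| "grid_step M \<delta> \<omega> (Pay i) t m = Some (t, m - axis i 1, axis i (premium M $ i * \<delta>))"
| "grid_step M \<delta> \<omega> Switch t m = None"

text \<open>
  A control assigns to every path a sequence of actions, numbered from \<open>0\<close>. The state in which
  action number \<open>k\<close> is applied is \<open>grid_run M \<delta> m s \<omega> k\<close>: the current time, the index of the
  current surplus and the dividend paid by the previous action. It is \<^const>\<open>None\<close> if the process
  has stopped before, in which case the value \<open>s \<omega> k\<close> is irrelevant; so the sequence proper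
  consists of the actions up to the one that stops the process, if any.
\<close>

type_synonym 'n control = "'n path \<Rightarrow> nat \<Rightarrow> 'n action"

primrec grid_run :: "('n :: finite) risk_model \<Rightarrow> real \<Rightarrow> nat ^ 'n \<Rightarrow> 'n control \<Rightarrow> 'n path \<Rightarrow> nat \<Rightarrow>
    (real \<times> (nat ^ 'n) \<times> (real ^ 'n)) option" where
  "grid_run M \<delta> m s \<omega> 0 = Some (0, m, 0)"
| "grid_run M \<delta> m s \<omega> (Suc k) =
     (case grid_run M \<delta> m s \<omega> k of
        None \<Rightarrow> None
      | Some (t, q, d) \<Rightarrow> grid_step M \<delta> \<omega> (s \<omega> k) t q)"

definition same_history :: "real \<Rightarrow> ('n :: finite) path \<Rightarrow> 'n path \<Rightarrow> bool" where
  "same_history t \<omega> \<omega>' \<longleftrightarrow>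
     (\<forall>k. jump_time \<omega> k \<le> t \<or> jump_time \<omega>' k \<le> t \<longrightarrow> \<omega> k = \<omega>' k)"

definition grid_control ::
    "('n :: finite) risk_model \<Rightarrow> real \<Rightarrow> nat ^ 'n \<Rightarrow> 'n control \<Rightarrow> bool" where
  "grid_control M \<delta> m s \<longleftrightarrow>
     (\<forall>\<omega>\<in>paths. \<forall>k t q d i.
        grid_run M \<delta> m s \<omega> k = Some (t, q, d) \<and> s \<omega> k = Pay i \<longrightarrow> 0 < q $ i) \<and>
     (\<forall>\<omega>\<in>paths. \<forall>\<omega>'\<in>paths. \<forall>t\<ge>0. same_history t \<omega> \<omega>' \<longrightarrow>
        (\<forall>k r q d. grid_run M \<delta> m s \<omega> k = Some (r, q, d) \<and> r \<le> t \<longrightarrow> s \<omega> k = s \<omega>' k))"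

text \<open>
  The pair of cumulative dividends and switch time obtained from a control. No dividends are
  paid after a switch, and the switch time is infinite if no switch occurs.
\<close>

definition grid_dividends ::
    "('n :: finite) risk_model \<Rightarrow> real \<Rightarrow> nat ^ 'n \<Rightarrow> 'n control \<Rightarrow> 'n dividends" where
  "grid_dividends M \<delta> m s t \<omega> =
     (\<Sum>k\<in>{k. \<exists>r q d. grid_run M \<delta> m s \<omega> k = Some (r, q, d) \<and> r \<le> t}.
        snd (snd (the (grid_run M \<delta> m s \<omega> k))))"

definition grid_switch_time ::
    "('n :: finite) risk_model \<Rightarrow> real \<Rightarrow> nat ^ 'n \<Rightarrow> 'n control \<Rightarrow> 'n path \<Rightarrow> ennreal" where
  "grid_switch_time M \<delta> m s \<omega> =
     Inf {ennreal t | t k q d. grid_run M \<delta> m s \<omega> k = Some (t, q, d) \<and> s \<omega> k = Switch}"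

definition grid_strategy :: "('n :: finite) risk_model \<Rightarrow> real \<Rightarrow> nat ^ 'n \<Rightarrow> 'n control \<Rightarrow>
    'n dividends \<times> ('n path \<Rightarrow> ennreal)" where
  "grid_strategy M \<delta> m s = (grid_dividends M \<delta> m s, grid_switch_time M \<delta> m s)"

definition grid_strategies :: "('n :: finite) risk_model \<Rightarrow> real \<Rightarrow> nat ^ 'n \<Rightarrow>
    ('n dividends \<times> ('n path \<Rightarrow> ennreal)) set" where
  "grid_strategies M \<delta> m =
     {grid_strategy M \<delta> m s | s. grid_control M \<delta> m s} \<inter> strategies M (grid_point M \<delta> m)"

definition stationary ::
    "('n :: finite) risk_model \<Rightarrow> real \<Rightarrow> nat ^ 'n \<Rightarrow> 'n control \<Rightarrow> bool" where
  "stationary M \<delta> m s \<longleftrightarrow>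
     (\<exists>\<sigma> :: nat ^ 'n \<Rightarrow> 'n action. \<forall>\<omega>\<in>paths. \<forall>k t q d.
        grid_run M \<delta> m s \<omega> k = Some (t, q, d) \<longrightarrow> s \<omega> k = \<sigma> q)"

definition grid_value :: "('n :: finite) risk_model \<Rightarrow> real \<Rightarrow> nat ^ 'n \<Rightarrow> ereal" where
  "grid_value M \<delta> m =
     (SUP \<pi>\<in>grid_strategies M \<delta> m. strategy_value M (grid_point M \<delta> m) \<pi>)"

definition claim_operator ::
    "('n :: finite) risk_model \<Rightarrow> real \<Rightarrow> (nat ^ 'n \<Rightarrow> real) \<Rightarrow> nat ^ 'n \<Rightarrow> real" where
  "claim_operator M \<delta> w m =
     (LINT t:{0..\<delta>}|lborel. let z = grid_point M \<delta> m + t *\<^sub>R premium M in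
        LINT \<alpha>:{\<alpha>. 0 \<le> \<alpha> \<and> \<alpha> \<le> z}|claim_law M.
          intensity M * exp (- (discount M + intensity M) * t) *
          (w (grid_index M \<delta> (z - \<alpha>)) + weight M \<bullet> (z - \<alpha> - grid_floor M \<delta> (z - \<alpha>))))"

definition wait_operator ::
    "('n :: finite) risk_model \<Rightarrow> real \<Rightarrow> (nat ^ 'n \<Rightarrow> real) \<Rightarrow> nat ^ 'n \<Rightarrow> real" where
  "wait_operator M \<delta> w m =
     w (m + 1) * exp (- (discount M + intensity M) * \<delta>) + claim_operator M \<delta> w m -
     (LINT t:{0..\<delta>}|lborel. exp (- (discount M + intensity M) * t) *
        expected_penalty M (grid_point M \<delta> m + t *\<^sub>R premium M))"

definition pay_operator ::
    "('n :: finite) risk_model \<Rightarrow> real \<Rightarrow> 'n \<Rightarrow> (nat ^ 'n \<Rightarrow> real) \<Rightarrow> nat ^ 'n \<Rightarrow> real" where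
  "pay_operator M \<delta> i w m = w (m - axis i 1) + \<delta> * weight M $ i * premium M $ i"

definition switch_operator ::
    "('n :: finite) risk_model \<Rightarrow> real \<Rightarrow> (nat ^ 'n \<Rightarrow> real) \<Rightarrow> nat ^ 'n \<Rightarrow> real" where
  "switch_operator M \<delta> w m = switch_value M (grid_point M \<delta> m)"

definition hjb_operator ::
    "('n :: finite) risk_model \<Rightarrow> real \<Rightarrow> (nat ^ 'n \<Rightarrow> real) \<Rightarrow> nat ^ 'n \<Rightarrow> real" where
  "hjb_operator M \<delta> w m = Max ({wait_operator M \<delta> w m, switch_operator M \<delta> w m} \<union>
     {pay_operator M \<delta> i w m | i. 0 < m $ i})"

end

(*
Three facts carry the proof. First, up to a constant factor K the growth weight is a pathwise
supersolution of the dynamics: every action, discounted, decreases it by at least the reward it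
earns, so total payoffs are at most K times the weight. Second, value iteration started at the
switch value increases and stays below that bound, so it converges to a solution w of the
discrete HJB equation; paying everything out shows w >= w 0. Third, for any control the expected
payoff with w in place of f at the switch satisfies a one-step renewal inequality, because the
first action does not depend on the path and the remaining path is again Poisson, independent of
the first jump. As one waiting step contracts the growth weight by a factor < 1, iterating the
inequality n times compares the payoff with w up to an error of order contraction^n. Hence every
payoff is at most w, and equals w if all actions attain the maximum, which a stationary control
achieves. Only the payoff as a whole has to be measurable for this, never the control; its
measurability comes from integration by parts, sum of e^{-c r} dL_r = int c e^{-c u} L_u du.
*)
theory Submission
  imports Defs
begin

section \<open>Paths\<close>

text \<open>The switch-value function is bounded only from above, so the value of a control may be
  -\<infinity> and its payoff need not be integrable. This is why the comparison uses payoffs with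
  the HJB solution \<open>w\<close> in its place: \<open>w\<close> has two-sided growth bounds, it
  dominates the switch value, and a greedy control switches only where both agree. The factor c/(2n)
  in the exponent of the growth weight lets premiums inflate it at rate c/2, half the discount rate;
  the other half produces the contraction. Payments take no time and contract nothing, so they need
  an induction of their own, on the number of grid units held, which each payment lowers by one. A
  control is an arbitrary function of the path, and its continuations after different first jumps
  are unrelated to each other. Therefore no continuation is ever selected measurably: the estimates
  bound every element of the set of attainable expectations, and Fubini supplies, for almost every
  first jump, a continuation whose payoff is measurable.\<close>

lemma paths_jump_time_pos:
  assumes "\<omega> \<in> paths" shows "0 < jump_time \<omega> k"
proof -
  have "jump_time \<omega> 0 \<le> jump_time \<omega> k"
    using assms unfolding paths_def by (auto intro: strict_mono_leD)
  then show ?thesis using assms unfolding paths_def by auto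
qed

lemma paths_jump_time_less_iff:
  assumes "\<omega> \<in> paths" shows "jump_time \<omega> j < jump_time \<omega> k \<longleftrightarrow> j < k"
  using assms unfolding paths_def by (simp add: strict_mono_less[of "jump_time \<omega>"])

lemma paths_jump_time_le_iff:
  assumes "\<omega> \<in> paths" shows "jump_time \<omega> j \<le> jump_time \<omega> k \<longleftrightarrow> j \<le> k"
  using assms unfolding paths_def by (simp add: strict_mono_less_eq[of "jump_time \<omega>"])

lemma paths_jump_size_nonneg: "\<omega> \<in> paths \<Longrightarrow> 0 \<le> jump_size \<omega> k"
  unfolding paths_def by auto

lemma jump_count_eqI:
  assumes "\<And>k. jump_time \<omega> k \<le> t \<longleftrightarrow> k < N" shows "jump_count \<omega> t = N"
proof -
  have "{k. jump_time \<omega> k \<le> t} = {..<N}" using assms by auto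
  then show ?thesis unfolding jump_count_def by simp
qed

text \<open>On \<open>paths\<close> the jump times increase strictly to infinity, so the jumps up to
  \<open>t\<close> form a finite initial segment of the numbering, which is determined by its
  cardinality.\<close>

lemma jump_time_le_iff_jump_count:
  assumes "\<omega> \<in> paths" shows "jump_time \<omega> k \<le> t \<longleftrightarrow> k < jump_count \<omega> t"
proof -
  have "filterlim (jump_time \<omega>) at_top sequentially" using assms by (simp add: paths_def)
  then have "\<exists>k. t < jump_time \<omega> k"
    unfolding filterlim_at_top_dense eventually_sequentially by blast
  then obtain N where N: "t < jump_time \<omega> N" "\<And>k. k < N \<Longrightarrow> \<not> t < jump_time \<omega> k"
    using exists_least_iff[of "\<lambda>k. t < jump_time \<omega> k"] by auto
  have iff: "jump_time \<omega> j \<le> t \<longleftrightarrow> j < N" for j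
  proof
    assume "jump_time \<omega> j \<le> t"
    then have "jump_time \<omega> j < jump_time \<omega> N" using N(1) by simp
    then show "j < N" using paths_jump_time_less_iff[OF assms] by simp
  qed (use N(2)[of j] in simp)
  then have "jump_count \<omega> t = N" by (rule jump_count_eqI)
  then show ?thesis using iff by simp
qed

lemma jump_count_mono:
  assumes "\<omega> \<in> paths" "t \<le> t'" shows "jump_count \<omega> t \<le> jump_count \<omega> t'"
proof (rule ccontr)
  assume "\<not> ?thesis"
  then have "jump_count \<omega> t' < jump_count \<omega> t" by simp
  then have "jump_time \<omega> (jump_count \<omega> t') \<le> t'"
    using jump_time_le_iff_jump_count[OF assms(1), of "jump_count \<omega> t'" t] assms(2) by linarith
  then show False using jump_time_le_iff_jump_count[OF assms(1)] by blast
qed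

lemma jump_count_less_jump_time:
  assumes "\<omega> \<in> paths" shows "t < jump_time \<omega> (jump_count \<omega> t)"
  using jump_time_le_iff_jump_count[OF assms, of "jump_count \<omega> t" t] by (simp add: not_le[symmetric])

lemma jump_count_0: "\<omega> \<in> paths \<Longrightarrow> jump_count \<omega> 0 = 0"
  using paths_jump_time_pos by (intro jump_count_eqI) (auto simp: not_le)

lemma jump_count_jump_time: "\<omega> \<in> paths \<Longrightarrow> jump_count \<omega> (jump_time \<omega> k) = Suc k"
  by (intro jump_count_eqI) (auto simp: paths_jump_time_le_iff)

lemma jump_count_before_next:
  assumes "\<omega> \<in> paths" "t \<le> t'" "t' < jump_time \<omega> (jump_count \<omega> t)"
  shows "jump_count \<omega> t' = jump_count \<omega> t"
proof (rule jump_count_eqI)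
  fix k
  show "jump_time \<omega> k \<le> t' \<longleftrightarrow> k < jump_count \<omega> t"
    using assms jump_time_le_iff_jump_count[OF assms(1), of k t]
      paths_jump_time_le_iff[OF assms(1), of "jump_count \<omega> t" k] by force
qed

section \<open>Shifting, delaying and prepending paths\<close>

definition drop_path :: "real \<Rightarrow> ('n :: finite) path \<Rightarrow> 'n path" where
  "drop_path t \<omega> = (\<lambda>k. (jump_time \<omega> (k + jump_count \<omega> t) - t, jump_size \<omega> (k + jump_count \<omega> t)))"

definition delay_path :: "real \<Rightarrow> ('n :: finite) path \<Rightarrow> 'n path" where
  "delay_path t \<omega> = (\<lambda>k. (t + jump_time \<omega> k, jump_size \<omega> k))"

text \<open>First-jump decomposition read backwards: \<open>x\<close> is the first jump, and the
  clock of \<open>\<omega>\<close> starts when it occurs.\<close>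

definition cons_path :: "real \<times> (real ^ 'n) \<Rightarrow> ('n :: finite) path \<Rightarrow> 'n path" where
  "cons_path x \<omega> = case_nat x (delay_path (fst x) \<omega>)"

lemma jump_count_drop_path:
  assumes "\<omega> \<in> paths" "0 \<le> r"
  shows "jump_count \<omega> (t + r) = jump_count (drop_path t \<omega>) r + jump_count \<omega> t"
proof -
  have "jump_count (drop_path t \<omega>) r = jump_count \<omega> (t + r) - jump_count \<omega> t"
    using jump_time_le_iff_jump_count[OF assms(1), of _ "t + r"]
    by (intro jump_count_eqI) (auto simp: drop_path_def algebra_simps less_diff_conv)
  moreover have "jump_count \<omega> t \<le> jump_count \<omega> (t + r)" using assms by (intro jump_count_mono) auto
  ultimately show ?thesis by simp
qed

lemma filterlim_add_const_at_top_iff: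
  "filterlim (\<lambda>k. t + f k :: real) at_top F \<longleftrightarrow> filterlim f at_top F"
proof
  assume "filterlim (\<lambda>k. t + f k) at_top F"
  then have "filterlim (\<lambda>k. - t + (t + f k)) at_top F"
    by (rule filterlim_tendsto_add_at_top[OF tendsto_const])
  then show "filterlim f at_top F" by simp
qed (rule filterlim_tendsto_add_at_top[OF tendsto_const])

lemma drop_path_in_paths:
  assumes "\<omega> \<in> paths" shows "drop_path t \<omega> \<in> paths"
proof -
  let ?N = "jump_count \<omega> t"
  have "filterlim (\<lambda>k. jump_time \<omega> (k + ?N)) at_top sequentially"
    using assms unfolding paths_def
    by (intro filterlim_compose[OF _ filterlim_add_const_nat_at_top, of "jump_time \<omega>"]) simp
  then have "filterlim (\<lambda>k. - t + jump_time \<omega> (k + ?N)) at_top sequentially"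
    by (simp only: filterlim_add_const_at_top_iff)
  then have "filterlim (jump_time (drop_path t \<omega>)) at_top sequentially"
    by (simp add: drop_path_def)
  moreover have "strict_mono (jump_time (drop_path t \<omega>))"
    using paths_jump_time_less_iff[OF assms] by (auto simp: strict_mono_def drop_path_def)
  ultimately show ?thesis
    using jump_count_less_jump_time[OF assms, of t] paths_jump_size_nonneg[OF assms]
    unfolding paths_def by (auto simp: drop_path_def)
qed

lemma drop_path_0: "\<omega> \<in> paths \<Longrightarrow> drop_path 0 \<omega> = \<omega>"
  by (simp add: drop_path_def jump_count_0)

lemma delay_path_in_paths:
  assumes "0 \<le> t" "\<omega> \<in> paths" shows "delay_path t \<omega> \<in> paths"
proof -
  have "filterlim (jump_time (delay_path t \<omega>)) at_top sequentially"
    using assms by (simp add: delay_path_def paths_def filterlim_add_const_at_top_iff)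
  then show ?thesis
    using assms unfolding paths_def by (auto simp: delay_path_def strict_mono_def)
qed

text \<open>The equivalence lets the indicator of \<open>paths\<close> pass between the extended
  path and its tail when integrals over \<open>paths\<close> are written on the full product
  space.\<close>

lemma cons_path_in_paths_iff:
  assumes "0 < fst x" "0 \<le> snd x" shows "cons_path x \<omega> \<in> paths \<longleftrightarrow> \<omega> \<in> paths"
proof -
  have s: "cons_path x \<omega> (Suc k) = delay_path (fst x) \<omega> k" "cons_path x \<omega> 0 = x" for k
    by (simp_all add: cons_path_def)
  have "filterlim (jump_time (cons_path x \<omega>)) at_top sequentially
    \<longleftrightarrow> filterlim (\<lambda>k. jump_time (cons_path x \<omega>) (Suc k)) at_top sequentially"
    by (rule filterlim_sequentially_Suc[symmetric])
  also have "\<dots> \<longleftrightarrow> filterlim (jump_time \<omega>) at_top sequentially"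
    by (simp add: s delay_path_def filterlim_add_const_at_top_iff)
  finally have 1: "filterlim (jump_time (cons_path x \<omega>)) at_top sequentially
    \<longleftrightarrow> filterlim (jump_time \<omega>) at_top sequentially" .
  have 2: "strict_mono (jump_time (cons_path x \<omega>)) \<longleftrightarrow> strict_mono (jump_time \<omega>) \<and> 0 < jump_time \<omega> 0"
  proof
    assume L: "strict_mono (jump_time (cons_path x \<omega>))"
    have "jump_time \<omega> j < jump_time \<omega> k" if "j < k" for j k
      using strict_monoD[OF L, of "Suc j" "Suc k"] that by (simp add: s delay_path_def)
    then show "strict_mono (jump_time \<omega>) \<and> 0 < jump_time \<omega> 0"
      using strict_monoD[OF L, of 0 "Suc 0"] by (simp add: s delay_path_def strict_mono_def)
  next
    assume R: "strict_mono (jump_time \<omega>) \<and> 0 < jump_time \<omega> 0"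
    then have pos: "0 < jump_time \<omega> k" for k
      using strict_mono_less_eq[of "jump_time \<omega>" 0 k] by simp
    show "strict_mono (jump_time (cons_path x \<omega>))"
    proof (rule strict_monoI)
      fix j k :: nat assume "j < k"
      then show "jump_time (cons_path x \<omega>) j < jump_time (cons_path x \<omega>) k"
        using R pos
        by (cases j; cases k) (simp_all add: s delay_path_def strict_mono_less[of "jump_time \<omega>"])
    qed
  qed
  have 3: "(\<forall>k. 0 \<le> jump_size (cons_path x \<omega>) k) \<longleftrightarrow> (\<forall>k. 0 \<le> jump_size \<omega> k)"
    using assms by (auto simp: cons_path_def delay_path_def split: nat.splits)
  show ?thesis unfolding paths_def using 1 2 3 assms by (auto simp: s(2))
qed

lemma drop_delay_path:
  assumes "\<omega> \<in> paths" "0 \<le> t" shows "drop_path t (delay_path t \<omega>) = \<omega>"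
proof -
  have "jump_count (delay_path t \<omega>) t = 0"
    using paths_jump_time_pos[OF assms(1)]
    by (intro jump_count_eqI) (auto simp: delay_path_def not_le)
  then show ?thesis by (simp add: drop_path_def delay_path_def)
qed

lemma drop_cons_path:
  assumes "\<omega> \<in> paths" "0 < fst x" "0 \<le> snd x" shows "drop_path (fst x) (cons_path x \<omega>) = \<omega>"
proof -
  have "jump_count (cons_path x \<omega>) (fst x) = 1"
    using paths_jump_time_pos[OF assms(1)]
    by (intro jump_count_eqI) (auto simp: cons_path_def delay_path_def not_le split: nat.splits)
  then show ?thesis by (simp add: drop_path_def cons_path_def delay_path_def)
qed

section \<open>Paths with a common history\<close>

lemma same_historyD:
  assumes "same_history t \<omega> \<omega>'" "jump_time \<omega> k \<le> t \<or> jump_time \<omega>' k \<le> t" shows "\<omega> k = \<omega>' k"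
  using assms unfolding same_history_def by blast

lemma same_history_delay_path:
  assumes "same_history r \<omega> \<omega>'"
  shows "same_history (t + r) (delay_path t \<omega>) (delay_path t \<omega>')"
  unfolding same_history_def
proof (intro allI impI)
  fix k assume "jump_time (delay_path t \<omega>) k \<le> t + r \<or> jump_time (delay_path t \<omega>') k \<le> t + r"
  then have "\<omega> k = \<omega>' k" by (intro same_historyD[OF assms]) (simp add: delay_path_def)
  then show "delay_path t \<omega> k = delay_path t \<omega>' k" by (simp add: delay_path_def)
qed

lemma same_history_cons_path:
  assumes "same_history r \<omega> \<omega>'"
  shows "same_history (fst x + r) (cons_path x \<omega>) (cons_path x \<omega>')"
  unfolding same_history_def
proof (intro allI impI)
  fix k
  assume "jump_time (cons_path x \<omega>) k \<le> fst x + r \<or> jump_time (cons_path x \<omega>') k \<le> fst x + r"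
  then show "cons_path x \<omega> k = cons_path x \<omega>' k"
    using same_historyD[OF same_history_delay_path[OF assms, of "fst x"]]
    unfolding cons_path_def by (cases k) simp_all
qed

lemma same_history_sym: "same_history t \<omega> \<omega>' \<Longrightarrow> same_history t \<omega>' \<omega>"
  unfolding same_history_def by metis

lemma same_history_jump_time_le:
  assumes "same_history t \<omega> \<omega>'" "r \<le> t" "jump_time \<omega> k \<le> r" shows "jump_time \<omega>' k \<le> r"
  using same_historyD[OF assms(1), of k] assms by simp

lemma same_history_jump_count:
  assumes "same_history t \<omega> \<omega>'" "r \<le> t" shows "jump_count \<omega> r = jump_count \<omega>' r"
proof -
  have "{k. jump_time \<omega> k \<le> r} = {k. jump_time \<omega>' k \<le> r}"
    using same_history_jump_time_le[OF assms]
      same_history_jump_time_le[OF same_history_sym[OF assms(1)] assms(2)] by blast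
  then show ?thesis by (simp add: jump_count_def)
qed

section \<open>Runs of a control\<close>

text \<open>The number of grid units held by all companies together. A payment lowers it by one, so
  it limits the number of consecutive payments.\<close>

abbreviation level :: "nat ^ 'n \<Rightarrow> nat" where "level q \<equiv> \<Sum>i\<in>UNIV. q $ i"

definition next_time :: "('n :: finite) path \<Rightarrow> real \<Rightarrow> real" where
  "next_time \<omega> t = jump_time \<omega> (jump_count \<omega> t)"

definition next_size :: "('n :: finite) path \<Rightarrow> real \<Rightarrow> real ^ 'n" where
  "next_size \<omega> t = jump_size \<omega> (jump_count \<omega> t)"

lemma next_time_less: "\<omega> \<in> paths \<Longrightarrow> t < next_time \<omega> t"
  unfolding next_time_def by (rule jump_count_less_jump_time)

lemma next_size_nonneg: "\<omega> \<in> paths \<Longrightarrow> 0 \<le> next_size \<omega> t"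
  unfolding next_size_def by (rule paths_jump_size_nonneg)

lemma next_time_drop_path:
  "\<omega> \<in> paths \<Longrightarrow> 0 \<le> r \<Longrightarrow> next_time \<omega> (t + r) = t + next_time (drop_path t \<omega>) r"
  by (simp add: next_time_def jump_count_drop_path) (simp add: drop_path_def)

lemma next_size_drop_path:
  "\<omega> \<in> paths \<Longrightarrow> 0 \<le> r \<Longrightarrow> next_size \<omega> (t + r) = next_size (drop_path t \<omega>) r"
  by (simp add: next_size_def jump_count_drop_path) (simp add: drop_path_def)

section \<open>Grid points and the effect of a single action\<close>

locale grid_model = dividend_model M for M :: "('n :: finite) risk_model" +
  fixes \<delta> :: real
  assumes step_pos: "0 < \<delta>"
begin

abbreviation "gp \<equiv> grid_point M \<delta>"
abbreviation "gi \<equiv> grid_index M \<delta>"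
abbreviation "gf \<equiv> grid_floor M \<delta>"
abbreviation "step \<equiv> grid_step M \<delta>"
text \<open>\<open>grid_run\<close> consults its control only at the path on which it runs, so
  pathwise arguments can be made for a plain action sequence \<open>ds\<close>;
  \<open>grid_run_eq_run\<close> translates back.\<close>

abbreviation "run m ds \<omega> \<equiv> grid_run M \<delta> m (\<lambda>_. ds) \<omega>"

definition carried :: "nat ^ 'n \<Rightarrow> real \<Rightarrow> real ^ 'n" where
  "carried q r = gp q + r *\<^sub>R premium M"

lemma grid_point_nonneg: "0 \<le> gp q"
  using premium_pos step_pos by (simp add: grid_point_def less_eq_vec_def less_imp_le)

lemma carried_nonneg: "0 \<le> r \<Longrightarrow> 0 \<le> carried q r"
  using premium_pos grid_point_nonneg[of q]
  by (simp add: carried_def less_eq_vec_def less_imp_le)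

lemma grid_point_add_1: "gp (q + 1) = carried q \<delta>"
  by (simp add: carried_def grid_point_def vec_eq_iff algebra_simps)

lemma grid_point_diff_axis: "0 < q $ i \<Longrightarrow> gp (q - axis i 1) = gp q - axis i (premium M $ i * \<delta>)"
  by (simp add: grid_point_def vec_eq_iff axis_def algebra_simps of_nat_diff)

lemma level_diff_axis:
  assumes "0 < q $ i" shows "level q = Suc (level (q - axis i 1))"
proof -
  have "level q = q $ i + (\<Sum>j\<in>UNIV - {i}. q $ j)" by (simp add: sum.remove[of UNIV i])
  moreover have "level (q - axis i 1) = (q $ i - 1) + (\<Sum>j\<in>UNIV - {i}. q $ j)"
    by (simp add: sum.remove[of UNIV i] axis_def)
  ultimately show ?thesis using assms by simp
qed

lemma grid_index_grid_point: "gi (gp q) = q"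
proof -
  have "premium M $ i * \<delta> * real (q $ i) / (\<delta> * premium M $ i) = real (q $ i)" for i
    using premium_pos[of i] step_pos by (simp add: field_simps)
  then show ?thesis by (simp add: grid_index_def grid_point_def vec_eq_iff)
qed

lemma grid_floor_le: "0 \<le> y \<Longrightarrow> gf y \<le> y"
proof -
  assume y: "0 \<le> y"
  have "gf y $ i \<le> y $ i" for i
  proof -
    have "0 \<le> y $ i / (\<delta> * premium M $ i)"
      using y premium_pos[of i] step_pos by (simp add: less_eq_vec_def)
    then have "real (nat \<lfloor>y $ i / (\<delta> * premium M $ i)\<rfloor>) \<le> y $ i / (\<delta> * premium M $ i)" by simp
    then show ?thesis using premium_pos[of i] step_pos
      by (simp add: grid_floor_def grid_point_def grid_index_def field_simps)
  qed
  then show ?thesis by (simp add: less_eq_vec_def)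
qed

lemma grid_floor_nonneg: "0 \<le> gf y"
  by (simp add: grid_floor_def grid_point_nonneg)

text \<open>A waiting step gains at most one grid unit per coordinate, so it can land on finitely
  many indices only. On these every real function of the index is bounded.\<close>

lemma grid_index_landing_le:
  assumes "r \<le> \<delta>" "0 \<le> u" shows "gi (carried q r - u) \<le> q + 1"
proof -
  have "nat \<lfloor>(carried q r - u) $ i / (\<delta> * premium M $ i)\<rfloor> \<le> q $ i + 1" for i
  proof -
    have "(carried q r - u) $ i \<le> premium M $ i * \<delta> * real (q $ i) + r * premium M $ i"
      using assms by (simp add: carried_def grid_point_def less_eq_vec_def)
    also have "\<dots> \<le> premium M $ i * \<delta> * real (q $ i) + \<delta> * premium M $ i"
      using assms premium_pos[of i] by simp
    finally have "(carried q r - u) $ i / (\<delta> * premium M $ i) \<le> real (q $ i + 1)"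
      using premium_pos[of i] step_pos by (simp add: field_simps)
    then have "\<lfloor>(carried q r - u) $ i / (\<delta> * premium M $ i)\<rfloor> \<le> \<lfloor>real (q $ i + 1)\<rfloor>"
      by (rule floor_mono)
    then show ?thesis by linarith
  qed
  then show ?thesis by (simp add: less_eq_vec_def grid_index_def)
qed

lemma level_landing_le:
  assumes "r \<le> \<delta>" "0 \<le> u" shows "level (gi (carried q r - u)) \<le> level q + CARD('n)"
proof -
  have "level (gi (carried q r - u)) \<le> level (q + 1)"
    using grid_index_landing_le[OF assms, of q] by (intro sum_mono) (simp add: less_eq_vec_def)
  also have "\<dots> = level q + CARD('n)"
    by (simp only: vector_add_component one_index sum.distrib) simp
  finally show ?thesis .
qed

lemma grid_step_Wait:
  "step \<omega> Wait t q =
     (let y = carried q (next_time \<omega> t - t) - next_size \<omega> t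
      in if \<delta> < next_time \<omega> t - t then Some (t + \<delta>, q + 1, 0)
         else if 0 \<le> y then Some (next_time \<omega> t, gi y, y - gf y) else None)"
  by (simp add: Let_def next_time_def next_size_def carried_def)

declare grid_step.simps(1)[simp del]

text \<open>A step depends on the path only through the next jump after its starting time, and
  dropping earlier jumps leaves that jump in place.\<close>

lemma grid_step_drop_path:
  assumes "\<omega> \<in> paths" "0 \<le> r"
  shows "step \<omega> a (t + r) q = map_option (\<lambda>(r', y). (t + r', y)) (step (drop_path t \<omega>) a r q)"
  using assms
  by (cases a) (simp_all add: grid_step_Wait next_time_drop_path next_size_drop_path Let_def)

lemma surplus_Suc:
  assumes "\<omega> \<in> paths"
  shows "surplus M x (next_time \<omega> t) \<omega> =
    surplus M x t \<omega> + (next_time \<omega> t - t) *\<^sub>R premium M - next_size \<omega> t"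
  using jump_count_jump_time[OF assms, of "jump_count \<omega> t"]
  by (simp add: surplus_def next_time_def next_size_def algebra_simps)

lemma surplus_before_next:
  assumes "\<omega> \<in> paths" "t \<le> t'" "t' < next_time \<omega> t"
  shows "surplus M x t' \<omega> = surplus M x t \<omega> + (t' - t) *\<^sub>R premium M"
  using jump_count_before_next[OF assms(1,2)] assms(3)
  by (simp add: surplus_def next_time_def algebra_simps)

text \<open>The last conclusion is a potential estimate that charges one unit for every action. A
  payment is covered by the loss of one level. A waiting step may raise the level by n, but it uses
  up a full period \<delta> or a jump, each of which is credited with n + 1.\<close>

lemma grid_step_SomeD:
  assumes "\<omega> \<in> paths" "step \<omega> a t q = Some (t', q', d')" "\<And>i. a = Pay i \<Longrightarrow> 0 < q $ i"
  shows "t \<le> t'" and "0 \<le> d'"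
    and "gp q' + d' - gp q = surplus M x t' \<omega> - surplus M x t \<omega>"
    and "t' \<le> next_time \<omega> t"
    and "real (Suc (level q')) \<le> real (level q) +
      (real CARD('n) + 1) * ((t' - t) / \<delta> + (real (jump_count \<omega> t') - real (jump_count \<omega> t)))"
proof -
  note nt = next_time_less[OF assms(1), of t]
  show "t \<le> t'" using assms(2) nt step_pos
    by (cases a) (auto simp: grid_step_Wait Let_def split: if_splits)
  show "0 \<le> d'"
  proof (cases a)
    case Wait
    then show ?thesis using assms(2) grid_floor_le
      by (auto simp: grid_step_Wait Let_def split: if_splits)
  next
    case (Pay i)
    then show ?thesis using assms(2) premium_pos step_pos
      by (auto simp: less_eq_vec_def axis_def less_imp_le)
  qed (use assms(2) in simp)
  show "gp q' + d' - gp q = surplus M x t' \<omega> - surplus M x t \<omega>"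
  proof (cases a)
    case Wait
    then show ?thesis using assms(2) nt step_pos surplus_Suc[OF assms(1), of x t]
        surplus_before_next[OF assms(1), of t "t + \<delta>" x]
      by (auto simp: grid_step_Wait Let_def grid_point_add_1 grid_floor_def[symmetric] carried_def
          split: if_splits)
  next
    case (Pay i)
    then show ?thesis using assms(2) grid_point_diff_axis[OF assms(3)[OF Pay]] by auto
  qed (use assms(2) in simp)
  show "t' \<le> next_time \<omega> t" using assms(2) nt
    by (cases a) (auto simp: grid_step_Wait Let_def split: if_splits)
  show "real (Suc (level q')) \<le> real (level q) +
      (real CARD('n) + 1) * ((t' - t) / \<delta> + (real (jump_count \<omega> t') - real (jump_count \<omega> t)))"
  proof (cases a)
    case Wait
    show ?thesis
    proof (cases "\<delta> < next_time \<omega> t - t")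
      case True
      then have "jump_count \<omega> t' = jump_count \<omega> t" "t' = t + \<delta>" "q' = q + 1"
        using assms(2) Wait step_pos jump_count_before_next[OF assms(1), of t t']
        by (auto simp: grid_step_Wait Let_def next_time_def)
      then show ?thesis using step_pos by (simp add: sum.distrib)
    next
      case False
      then have "t' = next_time \<omega> t" "q' = gi (carried q (next_time \<omega> t - t) - next_size \<omega> t)"
        using assms(2) Wait by (auto simp: grid_step_Wait Let_def split: if_splits)
      moreover have "jump_count \<omega> (next_time \<omega> t) = Suc (jump_count \<omega> t)"
        using jump_count_jump_time[OF assms(1)] by (simp add: next_time_def)
      moreover have "real (level q') \<le> real (level q + CARD('n))"
        unfolding of_nat_le_iff using calculation False level_landing_le[of "next_time \<omega> t - t" "next_size \<omega> t" q]
          next_size_nonneg[OF assms(1)] by simp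
      moreover have "0 \<le> (real CARD('n) + 1) * ((next_time \<omega> t - t) / \<delta>)"
        using nt step_pos by simp
      ultimately show ?thesis by (simp add: distrib_left del: of_nat_sum)
    qed
  next
    case (Pay i)
    then show ?thesis using assms(2) level_diff_axis[OF assms(3)[OF Pay]] by auto
  qed (use assms(2) in simp)
qed

lemma grid_run_eq_run: "grid_run M \<delta> m s \<omega> k = run m (s \<omega>) \<omega> k"
  by (induction k) (simp_all split: option.splits)

text \<open>The dividend component needs the case \<open>k = 0\<close>: the restarted run begins
  with dividend 0, whereas the same state of the original run records the dividend of the first
  action. Nonnegative times are carried along in the induction because
  \<open>grid_step_drop_path\<close> asks for them.\<close>

lemma run_shift:
  assumes "\<omega> \<in> paths" "step \<omega> (ds 0) 0 m = Some (t, q, d)"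
  shows "run m ds \<omega> (Suc k) = map_option (\<lambda>(r, q', d'). (t + r, q', if k = 0 then d else d'))
    (run q (\<lambda>j. ds (Suc j)) (drop_path t \<omega>) k) \<and>
    (\<forall>r q' d'. run q (\<lambda>j. ds (Suc j)) (drop_path t \<omega>) k = Some (r, q', d') \<longrightarrow> 0 \<le> r)"
proof (induction k)
  case 0
  then show ?case using assms(2) by simp
next
  case (Suc k)
  show ?case
  proof (cases "run q (\<lambda>j. ds (Suc j)) (drop_path t \<omega>) k")
    case None
    then show ?thesis using Suc by simp
  next
    case (Some z)
    then obtain r q' d' where z: "run q (\<lambda>j. ds (Suc j)) (drop_path t \<omega>) k = Some (r, q', d')"
      by (cases z) auto
    then have r: "0 \<le> r" using Suc by auto
    have "run m ds \<omega> (Suc (Suc k)) = step \<omega> (ds (Suc k)) (t + r) q'"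
      using Suc z by simp
    also have "\<dots> = map_option (\<lambda>(r', y). (t + r', y)) (step (drop_path t \<omega>) (ds (Suc k)) r q')"
      by (rule grid_step_drop_path[OF assms(1) r])
    finally have 1: "run m ds \<omega> (Suc (Suc k)) = \<dots>" .
    have "r < next_time (drop_path t \<omega>) r"
      by (rule next_time_less[OF drop_path_in_paths[OF assms(1)]])
    then have "0 \<le> r''" if "step (drop_path t \<omega>) (ds (Suc k)) r q' = Some (r'', q'', d'')" for r'' q'' d''
      using that r step_pos
      by (cases "ds (Suc k)") (auto simp: grid_step_Wait Let_def split: if_splits)
    then show ?thesis using 1 z by (auto intro!: option.map_cong0)
  qed
qed

section \<open>Legal runs and their length\<close>

definition legal :: "nat ^ 'n \<Rightarrow> (nat \<Rightarrow> 'n action) \<Rightarrow> 'n path \<Rightarrow> bool" where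
  "legal m ds \<omega> \<longleftrightarrow> (\<forall>k t q d i. run m ds \<omega> k = Some (t, q, d) \<and> ds k = Pay i \<longrightarrow> 0 < q $ i)"

lemma legalD: "legal m ds \<omega> \<Longrightarrow> run m ds \<omega> k = Some (t, q, d) \<Longrightarrow> ds k = Pay i \<Longrightarrow> 0 < q $ i"
  unfolding legal_def by blast

lemma run_Suc_SomeE:
  assumes "run m ds \<omega> (Suc k) = Some (t', q', d')"
  obtains t q d where "run m ds \<omega> k = Some (t, q, d)" "step \<omega> (ds k) t q = Some (t', q', d')"
  using assms by (auto split: option.splits)

text \<open>The potential estimate of \<open>grid_step_SomeD\<close> telescopes. It bounds the
  number of actions by elapsed time and number of jumps, so actions cannot accumulate in finite
  time.\<close>

lemma run_SomeD:
  assumes "\<omega> \<in> paths" "legal m ds \<omega>" "run m ds \<omega> k = Some (t, q, d)"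
  shows "0 \<le> t" and "0 \<le> d"
    and "real k + real (level q) \<le> real (level m) + (real CARD('n) + 1) * (t / \<delta> + real (jump_count \<omega> t))"
proof -
  have "0 \<le> t \<and> 0 \<le> d \<and> real k + real (level q) \<le>
    real (level m) + (real CARD('n) + 1) * (t / \<delta> + real (jump_count \<omega> t))"
    using assms(3)
  proof (induction k arbitrary: t q d)
    case 0
    then show ?case by (auto simp: jump_count_0[OF assms(1)])
  next
    case (Suc k)
    from Suc.prems obtain t' q' d' where *: "run m ds \<omega> k = Some (t', q', d')"
      "step \<omega> (ds k) t' q' = Some (t, q, d)" by (rule run_Suc_SomeE)
    note IH = Suc.IH[OF *(1)] and S = grid_step_SomeD[OF assms(1) *(2) legalD[OF assms(2) *(1)]]
    have "real (Suc k) + real (level q) = real k + real (Suc (level q))" by simp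
    also have "\<dots> \<le> real k + (real (level q') + (real CARD('n) + 1) *
      ((t - t') / \<delta> + (real (jump_count \<omega> t) - real (jump_count \<omega> t'))))"
      using S(5) by simp
    also have "\<dots> \<le> real (level m) + (real CARD('n) + 1) * (t' / \<delta> + real (jump_count \<omega> t')) +
      (real CARD('n) + 1) * ((t - t') / \<delta> + (real (jump_count \<omega> t) - real (jump_count \<omega> t')))"
      using IH by simp
    also have "\<dots> = real (level m) + (real CARD('n) + 1) * (t / \<delta> + real (jump_count \<omega> t))"
      by (simp add: distrib_left[symmetric] diff_divide_distrib add.assoc)
    finally show ?case using IH S(1,2) by simp
  qed
  then show "0 \<le> t" "0 \<le> d"
    "real k + real (level q) \<le> real (level m) + (real CARD('n) + 1) * (t / \<delta> + real (jump_count \<omega> t))"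
    by auto
qed

lemma run_None_mono: "run m ds \<omega> k = None \<Longrightarrow> k \<le> j \<Longrightarrow> run m ds \<omega> j = None"
  by (induction j) (auto simp: le_Suc_eq)

lemma run_time_mono:
  assumes "\<omega> \<in> paths" "legal m ds \<omega>" "k \<le> j"
    "run m ds \<omega> k = Some (t, q, d)" "run m ds \<omega> j = Some (t', q', d')"
  shows "t \<le> t'"
  using assms(3,5)
proof (induction j arbitrary: t' q' d')
  case 0
  then show ?case using assms(4) by simp
next
  case (Suc j)
  show ?case
  proof (cases "k = Suc j")
    case True
    then show ?thesis using Suc.prems assms(4) by simp
  next
    case False
    from Suc.prems(2) obtain r x y where *: "run m ds \<omega> j = Some (r, x, y)"
      "step \<omega> (ds j) r x = Some (t', q', d')" by (rule run_Suc_SomeE)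
    then show ?thesis
      using Suc.IH[OF _ *(1)] False Suc.prems grid_step_SomeD(1)[OF assms(1) *(2) legalD[OF assms(2) *(1)]]
      by simp
  qed
qed

section \<open>Rewards along a run\<close>

definition reward_term ::
    "('n path \<Rightarrow> 'n action \<Rightarrow> real \<Rightarrow> nat ^ 'n \<Rightarrow> real) \<Rightarrow> nat ^ 'n \<Rightarrow> (nat \<Rightarrow> 'n action) \<Rightarrow> 'n path \<Rightarrow> nat \<Rightarrow> real"
  where "reward_term X m ds \<omega> k = (case run m ds \<omega> k of None \<Rightarrow> 0 | Some (t, q, d) \<Rightarrow> X \<omega> (ds k) t q)"

definition total ::
    "('n path \<Rightarrow> 'n action \<Rightarrow> real \<Rightarrow> nat ^ 'n \<Rightarrow> real) \<Rightarrow> nat ^ 'n \<Rightarrow> (nat \<Rightarrow> 'n action) \<Rightarrow> 'n path \<Rightarrow> real"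
  where "total X m ds \<omega> = (\<Sum>k. reward_term X m ds \<omega> k)"

text \<open>Restarting the clock at \<open>t\<close> changes a reward only by the discount factor
  for the elapsed time. This is what turns \<open>total\<close> into a one-step recursion.\<close>

definition homogeneous :: "('n path \<Rightarrow> 'n action \<Rightarrow> real \<Rightarrow> nat ^ 'n \<Rightarrow> real) \<Rightarrow> bool" where
  "homogeneous X \<longleftrightarrow> (\<forall>\<omega>\<in>paths. \<forall>a q t r. 0 \<le> t \<and> 0 \<le> r \<longrightarrow>
     X \<omega> a (t + r) q = exp (- discount M * t) * X (drop_path t \<omega>) a r q)"

text \<open>After the first term is split off, \<open>run_shift\<close> identifies the remaining
  ones with the discounted terms of the run restarted on the dropped path.\<close>

lemma total_rec:
  assumes X: "homogeneous X" and "\<omega> \<in> paths" "legal m ds \<omega>" and sm: "summable (reward_term X m ds \<omega>)"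
  shows "total X m ds \<omega> = X \<omega> (ds 0) 0 m + (case step \<omega> (ds 0) 0 m of None \<Rightarrow> 0
    | Some (t, q, d) \<Rightarrow> exp (- discount M * t) * total X q (\<lambda>j. ds (Suc j)) (drop_path t \<omega>))"
proof -
  have "total X m ds \<omega> = X \<omega> (ds 0) 0 m + (\<Sum>k. reward_term X m ds \<omega> (Suc k))"
    unfolding total_def by (subst suminf_split_head[OF sm]) (simp add: reward_term_def)
  also have "(\<Sum>k. reward_term X m ds \<omega> (Suc k)) = (case step \<omega> (ds 0) 0 m of None \<Rightarrow> 0
    | Some (t, q, d) \<Rightarrow> exp (- discount M * t) * total X q (\<lambda>j. ds (Suc j)) (drop_path t \<omega>))"
  proof (cases "step \<omega> (ds 0) 0 m")
    case None
    then have "run m ds \<omega> (Suc 0) = None" by simp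
    then have "run m ds \<omega> (Suc k) = None" for k by (rule run_None_mono) simp
    then show ?thesis using None by (simp add: reward_term_def del: grid_run.simps)
  next
    case (Some z)
    then obtain t q d where z: "step \<omega> (ds 0) 0 m = Some (t, q, d)" by (cases z) auto
    have t: "0 \<le> t"
      using grid_step_SomeD(1)[OF assms(2) z] assms(3) legalD[OF assms(3), of 0] by simp
    let ?Y = "reward_term X q (\<lambda>j. ds (Suc j)) (drop_path t \<omega>)"
    have eq: "reward_term X m ds \<omega> (Suc k) = exp (- discount M * t) * ?Y k" for k
    proof (cases "run q (\<lambda>j. ds (Suc j)) (drop_path t \<omega>) k")
      case None
      then show ?thesis using run_shift[where ds = ds, OF assms(2) z, of k]
        by (simp add: reward_term_def del: grid_run.simps)
    next
      case (Some y)
      then obtain r q' d' where y: "run q (\<lambda>j. ds (Suc j)) (drop_path t \<omega>) k = Some (r, q', d')"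
        by (cases y) auto
      then have "0 \<le> r" using run_shift[where ds = ds, OF assms(2) z, of k] by blast
      then have "X \<omega> (ds (Suc k)) (t + r) q' = exp (- discount M * t) * X (drop_path t \<omega>) (ds (Suc k)) r q'"
        using X assms(2) t unfolding homogeneous_def by blast
      then show ?thesis using run_shift[where ds = ds, OF assms(2) z, of k] y
        by (simp add: reward_term_def del: grid_run.simps)
    qed
    have "summable (\<lambda>k. exp (- discount M * t) * ?Y k)"
      using summable_ignore_initial_segment[OF sm, of 1] eq by simp
    then have "summable ?Y" by (rule summable_mult_D) simp
    then show ?thesis using z eq by (simp add: total_def suminf_mult)
  qed
  finally show ?thesis .
qed

definition dividend_reward :: "'n path \<Rightarrow> 'n action \<Rightarrow> real \<Rightarrow> nat ^ 'n \<Rightarrow> real" where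
  "dividend_reward \<omega> a t q = (case step \<omega> a t q of None \<Rightarrow> 0
     | Some (t', q', d') \<Rightarrow> exp (- discount M * t') * (weight M \<bullet> d'))"

text \<open>The value collected at a switch is a parameter: the given switch value for the strategy
  value itself, the HJB solution in the comparison.\<close>

definition switch_reward ::
    "(nat ^ 'n \<Rightarrow> real) \<Rightarrow> 'n path \<Rightarrow> 'n action \<Rightarrow> real \<Rightarrow> nat ^ 'n \<Rightarrow> real" where
  "switch_reward w \<omega> a t q = (if a = Switch then exp (- discount M * t) * w q else 0)"

text \<open>A switch also makes \<open>step\<close> return \<open>None\<close>, so ruin has to be
  recognised by the action \<open>Wait\<close> in addition.\<close>

definition ruin_reward :: "'n path \<Rightarrow> 'n action \<Rightarrow> real \<Rightarrow> nat ^ 'n \<Rightarrow> real" where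
  "ruin_reward \<omega> a t q = (if a = Wait \<and> step \<omega> a t q = None
     then exp (- discount M * next_time \<omega> t) *
       penalty M (carried q (next_time \<omega> t - t)) (next_size \<omega> t) else 0)"

definition net_reward ::
    "(nat ^ 'n \<Rightarrow> real) \<Rightarrow> 'n path \<Rightarrow> 'n action \<Rightarrow> real \<Rightarrow> nat ^ 'n \<Rightarrow> real" where
  "net_reward w \<omega> a t q = dividend_reward \<omega> a t q + switch_reward w \<omega> a t q - ruin_reward \<omega> a t q"

lemma homogeneous_net_reward: "homogeneous (net_reward w)"
proof -
  have *: "exp (- (discount M * (t + r))) = exp (- (discount M * t)) * exp (- (discount M * r))" for t r
    by (simp add: exp_add[symmetric] algebra_simps)
  have 1: "homogeneous dividend_reward"
    by (auto simp: homogeneous_def dividend_reward_def grid_step_drop_path * split: option.splits)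
  have 2: "homogeneous (switch_reward w)"
    by (auto simp: homogeneous_def switch_reward_def *)
  have 3: "homogeneous ruin_reward"
    by (auto simp: homogeneous_def ruin_reward_def grid_step_drop_path next_time_drop_path
        next_size_drop_path *)
  show ?thesis using 1 2 3 unfolding homogeneous_def net_reward_def
    by (simp add: right_diff_distrib distrib_left)
qed

end

section \<open>The law of the paths\<close>

lemma borel_measurable_le_vec [measurable (raw)]:
  fixes f g :: "'a \<Rightarrow> real ^ 'n::finite"
  assumes [measurable]: "f \<in> borel_measurable N" "g \<in> borel_measurable N"
  shows "Measurable.pred N (\<lambda>x. f x \<le> g x)"
proof -
  have [measurable]: "(\<lambda>v::real^'n. v $ i) \<in> borel_measurable borel" for i
    by (intro borel_measurable_continuous_onI continuous_intros)
  show ?thesis unfolding less_eq_vec_def by measurable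
qed

abbreviation jump_space :: "(real \<times> (real ^ 'n)) measure" where
  "jump_space \<equiv> borel \<Otimes>\<^sub>M borel"

abbreviation path_space :: "('n::finite) path measure" where
  "path_space \<equiv> \<Pi>\<^sub>M k\<in>UNIV. jump_space"

lemma space_jump_space [simp]: "space jump_space = UNIV"
  by (simp add: space_pair_measure)

lemma space_path_space [simp]: "space path_space = UNIV"
  by (simp add: space_PiM)

lemma measurable_cons_path [measurable]:
  "(\<lambda>(x, \<omega>). cons_path x \<omega>) \<in> jump_space \<Otimes>\<^sub>M path_space \<rightarrow>\<^sub>M path_space"
proof (rule measurable_PiM_single')
  fix k :: nat
  show "(\<lambda>y. (case y of (x, \<omega>) \<Rightarrow> cons_path x \<omega>) k) \<in> jump_space \<Otimes>\<^sub>M path_space \<rightarrow>\<^sub>M jump_space"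
    by (cases k) (simp_all add: cons_path_def delay_path_def split_beta')
qed simp

lemma measurable_cons_path1: "cons_path x \<in> path_space \<rightarrow>\<^sub>M path_space"
  using measurable_compose[OF measurable_Pair1' measurable_cons_path, of x] by (simp add: space_pair_measure)

lemma measurable_delay_path [measurable]: "delay_path t \<in> path_space \<rightarrow>\<^sub>M path_space"
proof (rule measurable_PiM_single')
  fix k :: nat
  show "(\<lambda>\<omega>. delay_path t \<omega> k) \<in> path_space \<rightarrow>\<^sub>M jump_space"
    by (simp add: delay_path_def)
qed simp

text \<open>For an increasing sequence, divergence only has to be tested against the natural
  numbers, which leaves countably many measurable conditions.\<close>

lemma paths_in_sets [measurable]: "(paths :: ('n::finite) path set) \<in> sets path_space"
proof -
  have 1: "filterlim (jump_time \<omega>) at_top sequentially \<longleftrightarrow> (\<forall>Z::nat. \<exists>k. real Z < jump_time \<omega> k)"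
    if sm: "strict_mono (jump_time \<omega>)" for \<omega> :: "'n path"
  proof
    assume "filterlim (jump_time \<omega>) at_top sequentially"
    then show "\<forall>Z::nat. \<exists>k. real Z < jump_time \<omega> k"
      unfolding filterlim_at_top_dense eventually_sequentially by blast
  next
    assume H: "\<forall>Z::nat. \<exists>k. real Z < jump_time \<omega> k"
    show "filterlim (jump_time \<omega>) at_top sequentially"
      unfolding filterlim_at_top eventually_sequentially
    proof
      fix Z :: real
      obtain k where k: "real (nat \<lceil>Z\<rceil>) < jump_time \<omega> k" using H by blast
      have "Z \<le> jump_time \<omega> n" if "k \<le> n" for n
        using k that strict_mono_less_eq[OF sm, of k n] by linarith
      then show "\<exists>N. \<forall>n\<ge>N. Z \<le> jump_time \<omega> n" by blast
    qed
  qed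
  have "(paths :: 'n path set) = {\<omega> \<in> space path_space. 0 < jump_time \<omega> 0 \<and>
      (\<forall>j k. j < k \<longrightarrow> jump_time \<omega> j < jump_time \<omega> k) \<and> (\<forall>Z::nat. \<exists>k. real Z < jump_time \<omega> k) \<and>
      (\<forall>k. 0 \<le> jump_size \<omega> k)}"
    unfolding paths_def using 1 by (auto simp: strict_mono_def)
  also have "\<dots> \<in> sets path_space" by measurable
  finally show ?thesis .
qed

lemma discounted_path_sum_cons:
  fixes h :: "(real^'n::finite) \<Rightarrow> ennreal"
  shows "(\<Sum>k<Suc N. ennreal (exp (- c * jump_time (cons_path x \<omega>) k)) * h (jump_size (cons_path x \<omega>) k)) =
    ennreal (exp (- c * fst x)) *
      (h (snd x) + (\<Sum>k<N. ennreal (exp (- c * jump_time \<omega> k)) * h (jump_size \<omega> k)))"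
proof -
  have "ennreal (exp (- c * (fst x + s))) = ennreal (exp (- c * fst x)) * ennreal (exp (- c * s))" for s
    by (simp add: ennreal_mult'[symmetric] exp_add[symmetric] algebra_simps)
  then show ?thesis
    by (subst sum.lessThan_Suc_shift)
      (simp add: cons_path_def delay_path_def distrib_left sum_distrib_left mult.assoc)
qed

section \<open>Independent waiting times and claims\<close>

context dividend_model
begin

definition step_law :: "(real \<times> (real ^ 'n)) measure" where
  "step_law = density lborel (exponential_density (intensity M)) \<Otimes>\<^sub>M claim_law M"

text \<open>The law before restriction to \<open>paths\<close>. On the whole product space
  prepending a jump is an everywhere defined measurable map, so Fubini and image measures apply
  directly; \<open>AE_paths\<close> leads back to \<open>path_measure\<close>.\<close>

definition full_law :: "'n path measure" where
  "full_law = distr (\<Pi>\<^sub>M k\<in>UNIV. step_law) path_space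
     (\<lambda>\<xi> k. (\<Sum>j\<le>k. fst (\<xi> j), snd (\<xi> k)))"

lemma sets_claim_law [measurable_cong, simp]: "sets (claim_law M) = sets borel"
  by (rule claim_sets)

lemma space_claim_law [simp]: "space (claim_law M) = UNIV"
  using sets_eq_imp_space_eq[OF claim_sets] by simp

lemma sets_step_law [measurable_cong, simp]: "sets step_law = sets jump_space"
  unfolding step_law_def by (intro sets_pair_measure_cong) simp_all

lemma space_step_law [simp]: "space step_law = UNIV"
  using sets_eq_imp_space_eq[OF sets_step_law] by (simp add: space_pair_measure)

lemma prob_space_exp: "prob_space (density lborel (exponential_density (intensity M)))"
  by (rule prob_space_exponential_density[OF intensity_pos])

lemma prob_space_step_law: "prob_space step_law"
proof -
  interpret A: prob_space "density lborel (exponential_density (intensity M))" by (rule prob_space_exp)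
  interpret B: prob_space "claim_law M" by (rule claim_prob)
  interpret pair_prob_space "density lborel (exponential_density (intensity M))" "claim_law M" ..
  show ?thesis unfolding step_law_def by unfold_locales
qed

lemma measurable_partial_sums [measurable]:
  "(\<lambda>\<xi> k. (\<Sum>j\<le>k. fst (\<xi> j), snd (\<xi> k))) \<in> (\<Pi>\<^sub>M k\<in>UNIV. step_law) \<rightarrow>\<^sub>M path_space"
  by (rule measurable_PiM_single') simp_all

lemma sets_full_law [measurable_cong, simp]: "sets full_law = sets path_space"
  by (simp add: full_law_def)

lemma space_full_law [simp]: "space full_law = UNIV"
  by (simp add: full_law_def space_PiM space_pair_measure)

lemma prob_space_full_law: "prob_space full_law"
proof -
  interpret product_prob_space "\<lambda>_. step_law" "UNIV :: nat set"
    using prob_space_step_law by (simp add: product_prob_spaceI)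
  show ?thesis unfolding full_law_def by (rule prob_space_distr) measurable
qed

lemma path_measure_eq: "path_measure M = restrict_space full_law paths"
  unfolding path_measure_def full_law_def step_law_def ..

text \<open>The renewal property at the first jump. A product of identical factors is invariant
  under prepending an independent factor (\<open>PiM_iter\<close>), and taking partial sums turns
  the prepended waiting time into a delay of all later jumps.\<close>

lemma distr_cons_path: "distr (step_law \<Otimes>\<^sub>M full_law) path_space (\<lambda>(x, \<omega>). cons_path x \<omega>) = full_law"
proof -
  interpret sequence_space step_law
    using prob_space_step_law by (simp add: sequence_space_def product_prob_spaceI)
  let ?W = "(\<lambda>\<xi> k. (\<Sum>j\<le>k. fst (\<xi> j), snd (\<xi> k))) :: (nat \<Rightarrow> real \<times> (real^'n)) \<Rightarrow> 'n path"
  have W: "?W (case_nat x \<xi>) = cons_path x (?W \<xi>)" for x \<xi>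
  proof
    fix k
    show "?W (case_nat x \<xi>) k = cons_path x (?W \<xi>) k"
    proof (cases k)
      case 0
      then show ?thesis by (simp add: cons_path_def)
    next
      case (Suc l)
      have "(\<Sum>j\<le>Suc l. fst (case_nat x \<xi> j)) = fst x + (\<Sum>j\<le>l. fst (\<xi> j))"
        by (subst sum.atMost_Suc_shift) simp
      then show ?thesis using Suc by (simp add: cons_path_def delay_path_def del: sum.atMost_Suc)
    qed
  qed
  have F: "sigma_finite_measure (distr S path_space ?W)"
    using prob_space_full_law unfolding full_law_def
    by (intro finite_measure.sigma_finite_measure prob_space.finite_measure)
  have "full_law = distr (distr (step_law \<Otimes>\<^sub>M S) S (\<lambda>(s, \<omega>). case_nat s \<omega>)) path_space ?W"
    unfolding full_law_def by (simp only: PiM_iter)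
  also have "\<dots> = distr (step_law \<Otimes>\<^sub>M S) path_space (\<lambda>y. ?W ((\<lambda>(s, \<omega>). case_nat s \<omega>) y))"
    by (subst distr_distr) (simp_all add: comp_def)
  also have "\<dots> = distr (step_law \<Otimes>\<^sub>M S) path_space
     (\<lambda>y. (\<lambda>(x, \<omega>). cons_path x \<omega>) ((\<lambda>(x, \<xi>). (x, ?W \<xi>)) y))"
    by (simp add: split_beta' W)
  also have "\<dots> = distr (distr (step_law \<Otimes>\<^sub>M S) (step_law \<Otimes>\<^sub>M path_space) (\<lambda>(x, \<xi>). (x, ?W \<xi>)))
     path_space (\<lambda>(x, \<omega>). cons_path x \<omega>)"
    by (subst distr_distr) (simp_all add: comp_def)
  also have "distr (step_law \<Otimes>\<^sub>M S) (step_law \<Otimes>\<^sub>M path_space) (\<lambda>(x, \<xi>). (x, ?W \<xi>)) =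
     distr step_law step_law (\<lambda>x. x) \<Otimes>\<^sub>M distr S path_space ?W"
    by (subst pair_measure_distr[OF _ _ F]) simp_all
  also have "distr step_law step_law (\<lambda>x. x) = step_law" by (rule distr_id)
  also have "distr S path_space ?W = full_law" by (simp add: full_law_def)
  finally show ?thesis ..
qed

lemma nn_integral_full_law:
  assumes G[measurable]: "G \<in> borel_measurable path_space"
  shows "(\<integral>\<^sup>+\<omega>. G \<omega> \<partial>full_law) = (\<integral>\<^sup>+x. \<integral>\<^sup>+\<omega>. G (cons_path x \<omega>) \<partial>full_law \<partial>step_law)"
proof -
  interpret Q: prob_space full_law by (rule prob_space_full_law)
  have "(\<integral>\<^sup>+\<omega>. G \<omega> \<partial>full_law) =
      (\<integral>\<^sup>+\<omega>. G \<omega> \<partial>distr (step_law \<Otimes>\<^sub>M full_law) path_space (\<lambda>(x, \<omega>). cons_path x \<omega>))"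
    by (simp only: distr_cons_path)
  also have "\<dots> = (\<integral>\<^sup>+y. G ((\<lambda>(x, \<omega>). cons_path x \<omega>) y) \<partial>(step_law \<Otimes>\<^sub>M full_law))"
    by (intro nn_integral_distr) simp_all
  also have "\<dots> = (\<integral>\<^sup>+x. \<integral>\<^sup>+\<omega>. G (cons_path x \<omega>) \<partial>full_law \<partial>step_law)"
    by (subst Q.nn_integral_fst[symmetric]) simp_all
  finally show ?thesis .
qed

lemma nn_integral_step_law:
  assumes [measurable]: "G \<in> borel_measurable jump_space"
  shows "(\<integral>\<^sup>+x. G x \<partial>step_law) =
    (\<integral>\<^sup>+u. \<integral>\<^sup>+t. ennreal (exponential_density (intensity M) t) * G (t, u) \<partial>lborel \<partial>claim_law M)"
proof -
  interpret A: prob_space "density lborel (exponential_density (intensity M))" by (rule prob_space_exp)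
  interpret B: prob_space "claim_law M" by (rule claim_prob)
  interpret pair_sigma_finite "density lborel (exponential_density (intensity M))" "claim_law M" ..
  have "(\<integral>\<^sup>+x. G x \<partial>step_law) = (\<integral>\<^sup>+u. \<integral>\<^sup>+t. G (t, u)
    \<partial>density lborel (exponential_density (intensity M)) \<partial>claim_law M)"
    unfolding step_law_def by (subst nn_integral_snd[symmetric]) simp_all
  also have "\<dots> = (\<integral>\<^sup>+u. \<integral>\<^sup>+t. ennreal (exponential_density (intensity M) t) * G (t, u) \<partial>lborel \<partial>claim_law M)"
    by (subst nn_integral_density) simp_all
  finally show ?thesis .
qed

text \<open>The Laplace transform of the waiting time: multiplying the density by the discount
  factor gives a multiple of the exponential density of rate \<open>intensity M + s\<close>.\<close>

lemma exponential_discount: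
  assumes "0 < s"
  shows "(\<integral>\<^sup>+t. ennreal (exponential_density (intensity M) t) * ennreal (exp (- s * t)) \<partial>lborel) =
    ennreal (intensity M / (intensity M + s))"
proof -
  let ?l = "intensity M"
  interpret A: prob_space "density lborel (exponential_density (?l + s))"
    using intensity_pos assms by (intro prob_space_exponential_density) simp
  have one: "(\<integral>\<^sup>+t. ennreal (exponential_density (?l + s) t) \<partial>lborel) = 1"
    using A.emeasure_space_1 by (simp add: emeasure_density)
  have "exponential_density ?l t * exp (- s * t) = ?l / (?l + s) * exponential_density (?l + s) t" for t
    using intensity_pos assms
    by (auto simp: exponential_density_def exp_add[symmetric] field_simps)
  then have "(\<integral>\<^sup>+t. ennreal (exponential_density ?l t) * ennreal (exp (- s * t)) \<partial>lborel) =
    (\<integral>\<^sup>+t. ennreal (?l / (?l + s)) * ennreal (exponential_density (?l + s) t) \<partial>lborel)"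
    using intensity_pos assms by (simp add: ennreal_mult''[symmetric])
  also have "\<dots> = ennreal (?l / (?l + s))" by (simp add: nn_integral_cmult one)
  finally show ?thesis .
qed

lemma AE_step_law: "AE x in step_law. 0 < fst x \<and> 0 \<le> snd x"
proof -
  interpret A: prob_space "density lborel (exponential_density (intensity M))" by (rule prob_space_exp)
  interpret B: prob_space "claim_law M" by (rule claim_prob)
  interpret pair_sigma_finite "density lborel (exponential_density (intensity M))" "claim_law M" ..
  \<comment> \<open>The density excludes negative times only; time 0 is removed as a Lebesgue null
    set.\<close>
  have "AE t in lborel. t \<noteq> (0::real)" by (rule AE_lborel_singleton)
  then have "AE t in density lborel (exponential_density (intensity M)). 0 < t"
    by (subst AE_density) (auto simp: exponential_density_def)
  then have "AE t in density lborel (exponential_density (intensity M)).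
      AE u in claim_law M. 0 < fst (t, u) \<and> 0 \<le> snd (t, u)"
  proof eventually_elim
    case (elim t)
    show ?case using claim_nonneg by eventually_elim (use elim in simp)
  qed
  moreover have "{x \<in> space step_law. 0 < fst x \<and> 0 \<le> snd x} \<in> sets step_law" by measurable
  ultimately show ?thesis unfolding step_law_def by (intro AE_pair_measure)
qed

text \<open>Renewal at the first jump gives the partial sums the affine recursion I(N+1) = \<theta>
  (H + I(N)) with \<theta> < 1, so they stay bounded. With h = 1 this yields divergence of the jump
  times, with the penalty at surplus zero it yields an integrable bound for all ruin
  penalties.\<close>

lemma nn_integral_discounted_path_sum:
  fixes h :: "(real^'n) \<Rightarrow> ennreal"
  assumes [measurable]: "h \<in> borel_measurable borel" and h: "(\<integral>\<^sup>+u. h u \<partial>claim_law M) < \<infinity>" and c: "0 < c"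
  shows "(\<integral>\<^sup>+\<omega>. (\<Sum>k. ennreal (exp (- c * jump_time \<omega> k)) * h (jump_size \<omega> k)) \<partial>full_law) < \<infinity>"
proof -
  interpret Q: prob_space full_law by (rule prob_space_full_law)
  interpret B: prob_space "claim_law M" by (rule claim_prob)
  let ?\<theta> = "intensity M / (intensity M + c)"
  define s where "s N \<omega> = (\<Sum>k<N. ennreal (exp (- c * jump_time \<omega> k)) * h (jump_size \<omega> k))"
    for N and \<omega> :: "'n path"
  define H where "H = (\<integral>\<^sup>+u. h u \<partial>claim_law M)"
  have s[measurable]: "s N \<in> borel_measurable path_space" for N
    unfolding s_def by measurable
  have rec: "(\<integral>\<^sup>+\<omega>. s (Suc N) \<omega> \<partial>full_law) = ennreal ?\<theta> * (H + (\<integral>\<^sup>+\<omega>. s N \<omega> \<partial>full_law))" for N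
  proof -
    have "(\<integral>\<^sup>+\<omega>. s (Suc N) \<omega> \<partial>full_law) = (\<integral>\<^sup>+x. \<integral>\<^sup>+\<omega>. s (Suc N) (cons_path x \<omega>) \<partial>full_law \<partial>step_law)"
      by (rule nn_integral_full_law) measurable
    also have "\<dots> = (\<integral>\<^sup>+x. ennreal (exp (- c * fst x)) * (h (snd x) + (\<integral>\<^sup>+\<omega>. s N \<omega> \<partial>full_law)) \<partial>step_law)"
      unfolding s_def discounted_path_sum_cons unfolding s_def[symmetric]
      using Q.emeasure_space_1 by (simp add: nn_integral_cmult nn_integral_add)
    also have "\<dots> = (\<integral>\<^sup>+u. (\<integral>\<^sup>+t. ennreal (exponential_density (intensity M) t) *
        ennreal (exp (- c * t)) * (h u + (\<integral>\<^sup>+\<omega>. s N \<omega> \<partial>full_law)) \<partial>lborel) \<partial>claim_law M)"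
      by (subst nn_integral_step_law) (simp_all add: mult.assoc)
    also have "\<dots> = (\<integral>\<^sup>+u. ennreal ?\<theta> * (h u + (\<integral>\<^sup>+\<omega>. s N \<omega> \<partial>full_law)) \<partial>claim_law M)"
      by (subst nn_integral_multc) (simp_all only: exponential_discount[OF c], measurable)
    also have "\<dots> = ennreal ?\<theta> * (H + (\<integral>\<^sup>+\<omega>. s N \<omega> \<partial>full_law))"
      using B.emeasure_space_1 by (simp add: nn_integral_cmult nn_integral_add H_def)
    finally show ?thesis .
  qed
  obtain H' where H': "0 \<le> H'" "H = ennreal H'" using h unfolding H_def by (cases "\<integral>\<^sup>+u. h u \<partial>claim_law M") auto
  \<comment> \<open>The bound is the fixed point of the affine recursion \<open>rec\<close>.\<close>
  have bound: "(\<integral>\<^sup>+\<omega>. s N \<omega> \<partial>full_law) \<le> ennreal (intensity M * H' / c)" for N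
  proof (induction N)
    case 0
    then show ?case by (simp add: s_def)
  next
    case (Suc N)
    have "(\<integral>\<^sup>+\<omega>. s (Suc N) \<omega> \<partial>full_law) \<le> ennreal ?\<theta> * (ennreal H' + ennreal (intensity M * H' / c))"
      unfolding rec H'(2) by (intro mult_left_mono add_left_mono Suc) simp
    also have "\<dots> = ennreal (?\<theta> * (H' + intensity M * H' / c))"
      using H' c intensity_pos by (simp add: ennreal_plus[symmetric] ennreal_mult'[symmetric] del: ennreal_plus)
    also have "?\<theta> * (H' + intensity M * H' / c) = intensity M * H' / c"
    proof -
      have "H' + intensity M * H' / c = (intensity M + c) * H' / c" using c by (simp add: field_simps)
      moreover have "intensity M + c \<noteq> 0" using c intensity_pos by simp
      ultimately show ?thesis by simp
    qed
    finally show ?case .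
  qed
  have "(\<integral>\<^sup>+\<omega>. (\<Sum>k. ennreal (exp (- c * jump_time \<omega> k)) * h (jump_size \<omega> k)) \<partial>full_law) =
    (\<Sum>k. \<integral>\<^sup>+\<omega>. ennreal (exp (- c * jump_time \<omega> k)) * h (jump_size \<omega> k) \<partial>full_law)"
    by (rule nn_integral_suminf) measurable
  also have "\<dots> \<le> ennreal (intensity M * H' / c)"
  proof (rule suminf_le_const[OF summableI])
    fix N
    have "(\<Sum>k<N. \<integral>\<^sup>+\<omega>. ennreal (exp (- c * jump_time \<omega> k)) * h (jump_size \<omega> k) \<partial>full_law) =
      (\<integral>\<^sup>+\<omega>. s N \<omega> \<partial>full_law)"
      unfolding s_def by (rule nn_integral_sum[symmetric]) measurable
    then show "(\<Sum>k<N. \<integral>\<^sup>+\<omega>. ennreal (exp (- c * jump_time \<omega> k)) * h (jump_size \<omega> k) \<partial>full_law) \<le>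
      ennreal (intensity M * H' / c)" using bound by simp
  qed
  finally show ?thesis by (simp add: le_less_trans)
qed

text \<open>The expected value of the sum of exp (- \<tau>) over all jump times \<tau> is finite, so
  almost surely its terms tend to 0, that is, the jump times tend to infinity. Positivity and
  monotonicity come from the positive waiting times.\<close>

lemma AE_paths: "AE \<omega> in full_law. \<omega> \<in> paths"
proof -
  interpret B: prob_space "claim_law M" by (rule claim_prob)
  have "(\<integral>\<^sup>+\<omega>. (\<Sum>k. ennreal (exp (- 1 * jump_time \<omega> k)) * 1) \<partial>full_law) < \<infinity>"
    using B.emeasure_space_1 by (intro nn_integral_discounted_path_sum) simp_all
  then have "AE \<omega> in full_law. (\<Sum>k. ennreal (exp (- 1 * jump_time \<omega> k)) * 1) \<noteq> \<infinity>"
    by (intro nn_integral_PInf_AE) (auto simp: less_top)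
  moreover have "AE \<omega> in full_law. 0 < jump_time \<omega> 0 \<and> (\<forall>k. jump_time \<omega> k < jump_time \<omega> (Suc k)) \<and>
    (\<forall>k. 0 \<le> jump_size \<omega> k)"
  proof -
    have "AE \<xi> in (\<Pi>\<^sub>M k\<in>UNIV. step_law). \<forall>k::nat. 0 < fst (\<xi> k) \<and> 0 \<le> snd (\<xi> k)"
      unfolding AE_all_countable
      by (intro allI AE_PiM_component prob_space_step_law AE_step_law) simp_all
    then show ?thesis
      unfolding full_law_def by (subst AE_distr_iff) (simp, measurable, auto)
  qed
  ultimately show ?thesis
  proof eventually_elim
    case (elim \<omega>)
    have "summable (\<lambda>k. exp (- jump_time \<omega> k))"
      using elim(1) by (intro summable_suminf_not_top) (auto simp: top_ennreal_def)
    then have "(\<lambda>k. exp (- jump_time \<omega> k)) \<longlonglongrightarrow> 0" by (rule summable_LIMSEQ_zero)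
    then have "filterlim (\<lambda>k. inverse (exp (- jump_time \<omega> k))) at_top sequentially"
      by (intro filterlim_inverse_at_top) simp_all
    then have "filterlim (\<lambda>k. exp (jump_time \<omega> k)) at_top sequentially" by (simp add: exp_minus)
    then have "filterlim (\<lambda>k. ln (exp (jump_time \<omega> k))) at_top sequentially"
      by (rule filterlim_compose[OF ln_at_top])
    then have "filterlim (jump_time \<omega>) at_top sequentially" by simp
    then show ?case using elim(2) unfolding paths_def by (simp add: strict_mono_Suc_iff)
  qed
qed

lemma prob_space_path_measure: "prob_space (path_measure M)"
proof -
  interpret Q: prob_space full_law by (rule prob_space_full_law)
  have "emeasure full_law paths = 1"
    by (rule Q.emeasure_eq_1_AE[OF _ AE_paths]) simp
  then show ?thesis unfolding path_measure_eq by (intro prob_space_restrict_space) simp_all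
qed

lemma space_path_measure [simp]: "space (path_measure M) = paths"
  unfolding path_measure_eq by (simp add: space_restrict_space)

lemma integrable_path_measure_iff:
  fixes G :: "'n path \<Rightarrow> real"
  shows "integrable (path_measure M) G \<longleftrightarrow> integrable full_law (\<lambda>\<omega>. indicator paths \<omega> *\<^sub>R G \<omega>)"
  unfolding path_measure_eq by (subst integrable_restrict_space) simp_all

lemma integral_path_measure_eq:
  fixes G :: "'n path \<Rightarrow> real"
  shows "integral\<^sup>L (path_measure M) G = integral\<^sup>L full_law (\<lambda>\<omega>. indicator paths \<omega> *\<^sub>R G \<omega>)"
  unfolding path_measure_eq by (subst integral_restrict_space) simp_all

section \<open>The memoryless property and renewal at the first jump\<close>

lemma nn_integral_memoryless:
  assumes [measurable]: "\<phi> \<in> borel_measurable jump_space" and d: "0 < d"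
  shows "(\<integral>\<^sup>+x. indicator {d<..} (fst x) * \<phi> x \<partial>step_law) =
    ennreal (exp (- intensity M * d)) * (\<integral>\<^sup>+x. \<phi> (d + fst x, snd x) \<partial>step_law)"
proof -
  let ?l = "intensity M"
  \<comment> \<open>Equality fails only at \<open>t = 0\<close>, where the strict indicator vanishes
    but the density does not.\<close>
  have dens: "AE t in lborel. indicator {d<..} (d + t) * exponential_density ?l (d + t) =
      exp (- ?l * d) * exponential_density ?l t"
    using AE_lborel_singleton[of "0::real"]
  proof eventually_elim
    case (elim t)
    have "exp (- ?l * (d + t)) = exp (- ?l * d) * exp (- ?l * t)"
      by (simp add: exp_add[symmetric] algebra_simps)
    then show ?case using elim d
      by (auto simp: exponential_density_def indicator_def algebra_simps)
  qed
  have inner: "(\<integral>\<^sup>+t. ennreal (exponential_density ?l t) * (indicator {d<..} t * \<phi> (t, u)) \<partial>lborel) =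
      ennreal (exp (- ?l * d)) * (\<integral>\<^sup>+t. ennreal (exponential_density ?l t) * \<phi> (d + t, u) \<partial>lborel)" for u
  proof -
    have "(\<integral>\<^sup>+t. ennreal (exponential_density ?l t) * (indicator {d<..} t * \<phi> (t, u)) \<partial>lborel) =
       (\<integral>\<^sup>+t. ennreal (indicator {d<..} t * exponential_density ?l t) * \<phi> (t, u) \<partial>lborel)"
      by (intro nn_integral_cong) (auto simp: indicator_def)
    also have "\<dots> = (\<integral>\<^sup>+t. ennreal (indicator {d<..} (d + t) * exponential_density ?l (d + t)) * \<phi> (d + t, u) \<partial>lborel)"
      by (subst nn_integral_real_affine[where c = 1 and t = d]) simp_all
    also have "\<dots> = (\<integral>\<^sup>+t. ennreal (exp (- ?l * d)) * (ennreal (exponential_density ?l t) * \<phi> (d + t, u)) \<partial>lborel)"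
    proof (rule nn_integral_cong_AE)
      show "AE t in lborel. ennreal (indicator {d<..} (d + t) * exponential_density ?l (d + t)) * \<phi> (d + t, u) =
          ennreal (exp (- ?l * d)) * (ennreal (exponential_density ?l t) * \<phi> (d + t, u))"
        using dens
      proof eventually_elim
        case (elim t)
        show ?case unfolding elim
          by (subst ennreal_mult) (simp_all add: mult.assoc exponential_density_nonneg[OF intensity_pos])
      qed
    qed
    also have "\<dots> = ennreal (exp (- ?l * d)) * (\<integral>\<^sup>+t. ennreal (exponential_density ?l t) * \<phi> (d + t, u) \<partial>lborel)"
      by (rule nn_integral_cmult) measurable
    finally show ?thesis .
  qed
  interpret E: sigma_finite_measure lborel by (rule lborel.sigma_finite_measure_axioms)
  have [measurable]: "(\<lambda>u. \<integral>\<^sup>+t. ennreal (exponential_density ?l t) * \<phi> (d + t, u) \<partial>lborel)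
      \<in> borel_measurable (claim_law M)"
    by measurable
  show ?thesis
    by (subst (1 2) nn_integral_step_law) (measurable, simp add: inner nn_integral_cmult)
qed

text \<open>The renewal identity at the first jump, with the paths that do not jump before \<open>d\<close>
  split off: by the memoryless property the remaining path is distributed as a new one.\<close>

lemma nn_integral_full_law_delay:
  assumes [measurable]: "G \<in> borel_measurable path_space" and d: "0 < d"
  shows "(\<integral>\<^sup>+y. indicator {d<..} (fst (fst y)) * G (cons_path (fst y) (snd y)) \<partial>(step_law \<Otimes>\<^sub>M full_law)) =
    ennreal (exp (- intensity M * d)) * (\<integral>\<^sup>+\<omega>. G (delay_path d \<omega>) \<partial>full_law)"
proof -
  interpret Q: prob_space full_law by (rule prob_space_full_law)
  have delay_cons: "delay_path d (cons_path x \<omega>) = cons_path (d + fst x, snd x) \<omega>" for x and \<omega> :: "'n path"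
    by (auto simp: delay_path_def cons_path_def fun_eq_iff split: nat.splits)
  have [measurable]: "(\<lambda>y. cons_path (fst y) (snd y)) \<in> step_law \<Otimes>\<^sub>M full_law \<rightarrow>\<^sub>M path_space"
    using measurable_cons_path by (simp add: split_beta' cong: measurable_cong_sets)
  have [measurable]: "(\<lambda>x. \<integral>\<^sup>+\<omega>. G (cons_path x \<omega>) \<partial>full_law) \<in> borel_measurable jump_space"
  proof -
    have "(\<lambda>x. \<integral>\<^sup>+\<omega>. (\<lambda>y. G (cons_path (fst y) (snd y))) (x, \<omega>) \<partial>full_law) \<in> borel_measurable step_law"
      by (intro Q.borel_measurable_nn_integral_fst) measurable
    then show ?thesis by (simp cong: measurable_cong_sets)
  qed
  have c1[measurable]: "(\<lambda>\<omega>. G (cons_path x \<omega>)) \<in> borel_measurable full_law" for x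
    using measurable_compose[OF measurable_cons_path1[of x] assms(1)] by (simp cong: measurable_cong_sets)
  have "(\<integral>\<^sup>+y. indicator {d<..} (fst (fst y)) * G (cons_path (fst y) (snd y)) \<partial>(step_law \<Otimes>\<^sub>M full_law)) =
    (\<integral>\<^sup>+x. indicator {d<..} (fst x) * (\<integral>\<^sup>+\<omega>. G (cons_path x \<omega>) \<partial>full_law) \<partial>step_law)"
    by (subst Q.nn_integral_fst[symmetric]) (simp_all add: nn_integral_cmult)
  also have "\<dots> = ennreal (exp (- intensity M * d)) *
    (\<integral>\<^sup>+x. \<integral>\<^sup>+\<omega>. G (cons_path (d + fst x, snd x) \<omega>) \<partial>full_law \<partial>step_law)"
    by (rule nn_integral_memoryless[OF _ d]) measurable
  also have "(\<integral>\<^sup>+x. \<integral>\<^sup>+\<omega>. G (cons_path (d + fst x, snd x) \<omega>) \<partial>full_law \<partial>step_law) =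
    (\<integral>\<^sup>+\<omega>. G (delay_path d \<omega>) \<partial>full_law)"
    by (subst nn_integral_full_law) (simp_all add: delay_cons)
  finally show ?thesis .
qed

text \<open>Conditioning on the first jump \<open>x\<close>, with the paths without a jump up to
  \<open>d\<close> kept apart because a waiting step ends at \<open>d\<close> for them. The sections
  of \<open>G\<close> are integrable for almost every \<open>x\<close> only, so the conditional
  expectation is delivered as a function \<open>e\<close> identified almost everywhere.\<close>

lemma path_measure_renewal:
  fixes G :: "'n path \<Rightarrow> real"
  assumes G: "integrable (path_measure M) G" and d: "0 < d"
  obtains e where "integrable step_law e"
    "AE x in step_law. 0 < fst x \<and> 0 \<le> snd x \<and> integrable (path_measure M) (\<lambda>\<omega>. G (cons_path x \<omega>)) \<and>
       e x = (\<integral>\<omega>. G (cons_path x \<omega>) \<partial>path_measure M)"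
    "integrable (path_measure M) (\<lambda>\<omega>. G (delay_path d \<omega>))"
    "(\<integral>\<omega>. G \<omega> \<partial>path_measure M) = exp (- intensity M * d) * (\<integral>\<omega>. G (delay_path d \<omega>) \<partial>path_measure M) +
       (\<integral>x. indicator {..d} (fst x) * e x \<partial>step_law)"
proof -
  interpret S: prob_space step_law by (rule prob_space_step_law)
  interpret Q: prob_space full_law by (rule prob_space_full_law)
  interpret pair_prob_space step_law full_law ..
  \<comment> \<open>Extension by zero moves the problem to the full product space, where the first
    jump and the remaining path are independent coordinates.\<close>
  define H where "H \<omega> = indicator paths \<omega> *\<^sub>R G \<omega>" for \<omega> :: "'n path"
  have H: "integrable full_law H" using G unfolding integrable_path_measure_iff H_def .
  then have [measurable]: "H \<in> borel_measurable path_space" by (auto dest: borel_measurable_integrable)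
  let ?Z = "\<lambda>y. H (cons_path (fst y) (snd y))"
  have mc[measurable]: "(\<lambda>y. cons_path (fst y) (snd y)) \<in> step_law \<Otimes>\<^sub>M full_law \<rightarrow>\<^sub>M path_space"
    using measurable_cons_path by (simp add: split_beta' cong: measurable_cong_sets)
  have full: "distr (step_law \<Otimes>\<^sub>M full_law) path_space (\<lambda>y. cons_path (fst y) (snd y)) = full_law"
    using distr_cons_path by (simp add: split_beta')
  have Z: "integrable (step_law \<Otimes>\<^sub>M full_law) ?Z"
    by (rule integrable_distr[OF mc]) (simp add: full H)
  define e where "e x = (\<integral>\<omega>. H (cons_path x \<omega>) \<partial>full_law)" for x
  have e: "integrable step_law e" unfolding e_def using integrable_fst'[OF Z] by simp
  have ae: "AE x in step_law. 0 < fst x \<and> 0 \<le> snd x \<and> integrable (path_measure M) (\<lambda>\<omega>. G (cons_path x \<omega>)) \<and>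
       e x = (\<integral>\<omega>. G (cons_path x \<omega>) \<partial>path_measure M)"
    using AE_step_law AE_integrable_fst'[OF Z]
  proof eventually_elim
    case (elim x)
    then have "(\<lambda>\<omega>. H (cons_path x \<omega>)) = (\<lambda>\<omega>. indicator paths \<omega> *\<^sub>R G (cons_path x \<omega>))"
      by (auto simp: H_def indicator_def cons_path_in_paths_iff)
    then show ?case
      using elim by (simp add: e_def integrable_path_measure_iff integral_path_measure_eq)
  qed
  \<comment> \<open>A delayed path may lie in \<open>paths\<close> although the original one does
    not, so the indicator has to stay here; it disappears under the integral by
    \<open>AE_paths\<close>.\<close>
  have delay_eq: "indicator paths \<omega> *\<^sub>R G (delay_path d \<omega>) = indicator paths \<omega> * H (delay_path d \<omega>)" for \<omega>
    using d by (auto simp: H_def delay_path_in_paths indicator_def)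
  \<comment> \<open>Stated for a measurable transform \<open>s\<close> so that the norm and the
    positive and negative parts are all instances.\<close>
  have nn: "(\<integral>\<^sup>+y. indicator {d<..} (fst (fst y)) * ennreal (s (?Z y)) \<partial>(step_law \<Otimes>\<^sub>M full_law)) =
    ennreal (exp (- intensity M * d)) * (\<integral>\<^sup>+\<omega>. ennreal (s (H (delay_path d \<omega>))) \<partial>full_law)"
    if [measurable]: "s \<in> borel_measurable borel" for s :: "real \<Rightarrow> real"
    using nn_integral_full_law_delay[where G = "\<lambda>\<omega>. ennreal (s (H \<omega>))", OF _ d] by simp
  have Dm[measurable]: "(\<lambda>\<omega>. H (delay_path d \<omega>)) \<in> borel_measurable full_law"
    by (simp cong: measurable_cong_sets)
  have Zi: "integrable (step_law \<Otimes>\<^sub>M full_law) (\<lambda>y. indicator {d<..} (fst (fst y)) * ?Z y)"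
    by (rule Bochner_Integration.integrable_bound[OF Z]) (auto simp: indicator_def)
  have D: "integrable full_law (\<lambda>\<omega>. H (delay_path d \<omega>))"
  proof (rule integrableI_bounded)
    have "ennreal (exp (- intensity M * d)) * (\<integral>\<^sup>+\<omega>. ennreal (norm (H (delay_path d \<omega>))) \<partial>full_law) =
      (\<integral>\<^sup>+y. indicator {d<..} (fst (fst y)) * ennreal (norm (?Z y)) \<partial>(step_law \<Otimes>\<^sub>M full_law))"
      by (rule nn[symmetric]) measurable
    also have "\<dots> \<le> (\<integral>\<^sup>+y. ennreal (norm (?Z y)) \<partial>(step_law \<Otimes>\<^sub>M full_law))"
      by (intro nn_integral_mono) (auto simp: indicator_def)
    also have "\<dots> < \<infinity>" using Z unfolding integrable_iff_bounded by simp
    finally show "(\<integral>\<^sup>+\<omega>. ennreal (norm (H (delay_path d \<omega>))) \<partial>full_law) < \<infinity>"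
      by (auto simp: ennreal_mult_less_top)
  qed simp
  have 1: "(\<integral>y. indicator {d<..} (fst (fst y)) * ?Z y \<partial>(step_law \<Otimes>\<^sub>M full_law)) =
      exp (- intensity M * d) * (\<integral>\<omega>. H (delay_path d \<omega>) \<partial>full_law)"
  proof -
    have pull: "ennreal (indicator {d<..} t * r) = indicator {d<..} t * ennreal r"
      "ennreal (- (indicator {d<..} t * r)) = indicator {d<..} t * ennreal (- r)" for t r :: real
      by (auto simp: indicator_def)
    show ?thesis
      unfolding real_lebesgue_integral_def[OF Zi] real_lebesgue_integral_def[OF D] pull
        nn[of "\<lambda>r. r", simplified] nn[of uminus, simplified]
      by (simp add: enn2real_mult right_diff_distrib)
  qed
  have split: "?Z y = indicator {d<..} (fst (fst y)) * ?Z y + indicator {..d} (fst (fst y)) * ?Z y" for y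
    by (auto simp: indicator_def)
  have Zi2: "integrable (step_law \<Otimes>\<^sub>M full_law) (\<lambda>y. indicator {..d} (fst (fst y)) * ?Z y)"
    by (rule Bochner_Integration.integrable_bound[OF Z]) (auto simp: indicator_def)
  have 2: "(\<integral>y. indicator {..d} (fst (fst y)) * ?Z y \<partial>(step_law \<Otimes>\<^sub>M full_law)) =
      (\<integral>x. indicator {..d} (fst x) * e x \<partial>step_law)"
    using integral_fst'[OF Zi2] by (simp add: e_def)
  have "(\<integral>\<omega>. G \<omega> \<partial>path_measure M) = (\<integral>\<omega>. H \<omega> \<partial>full_law)"
    by (simp add: integral_path_measure_eq H_def)
  also have "\<dots> = (\<integral>\<omega>. H \<omega> \<partial>distr (step_law \<Otimes>\<^sub>M full_law) path_space (\<lambda>y. cons_path (fst y) (snd y)))"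
    by (simp only: full)
  also have "\<dots> = (\<integral>y. ?Z y \<partial>(step_law \<Otimes>\<^sub>M full_law))" by (rule integral_distr) measurable
  also have "\<dots> = (\<integral>y. indicator {d<..} (fst (fst y)) * ?Z y \<partial>(step_law \<Otimes>\<^sub>M full_law)) +
      (\<integral>y. indicator {..d} (fst (fst y)) * ?Z y \<partial>(step_law \<Otimes>\<^sub>M full_law))"
    by (subst split) (rule Bochner_Integration.integral_add[OF Zi Zi2])
  also have "(\<integral>y. indicator {d<..} (fst (fst y)) * ?Z y \<partial>(step_law \<Otimes>\<^sub>M full_law)) =
      exp (- intensity M * d) * (\<integral>\<omega>. G (delay_path d \<omega>) \<partial>path_measure M)"
  proof -
    have "(\<integral>\<omega>. H (delay_path d \<omega>) \<partial>full_law) = (\<integral>\<omega>. indicator paths \<omega> *\<^sub>R G (delay_path d \<omega>) \<partial>full_law)"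
      unfolding delay_eq using AE_paths by (intro integral_cong_AE) (simp_all, measurable, auto)
    then show ?thesis unfolding 1 integral_path_measure_eq by simp
  qed
  finally have main: "(\<integral>\<omega>. G \<omega> \<partial>path_measure M) = exp (- intensity M * d) * (\<integral>\<omega>. G (delay_path d \<omega>) \<partial>path_measure M) +
       (\<integral>x. indicator {..d} (fst x) * e x \<partial>step_law)" unfolding 2 .
  have "integrable (path_measure M) (\<lambda>\<omega>. G (delay_path d \<omega>))"
    unfolding integrable_path_measure_iff delay_eq
    by (rule Bochner_Integration.integrable_bound[OF D]) (simp_all, measurable, auto simp: indicator_def)
  then show ?thesis using that[OF e ae] main by blast
qed

end

section \<open>The discrete HJB equation\<close>

context dividend_model
begin

abbreviation "H \<equiv> growth_weight M"

lemma growth_weight_pos: "0 < H x"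
  by (simp add: growth_weight_def)

text \<open>Each of the n coordinates adds \<open>t\<close> to the sum in the exponent, which
  cancels the n in the constant; discounting then still leaves a factor exp (- c t / 2).\<close>

lemma growth_weight_drift: "H (x + t *\<^sub>R premium M) = exp (discount M * t / 2) * H x"
proof -
  have "(x + t *\<^sub>R premium M) $ i / premium M $ i = x $ i / premium M $ i + t" for i
    using premium_pos[of i] by (simp add: field_simps)
  then show ?thesis
    by (simp add: growth_weight_def exp_add[symmetric] sum.distrib field_simps)
qed

text \<open>The exponential has slope at least 1 on nonnegative arguments. The linear lower bound is
  what dividends, linear in the amount paid, are compared with.\<close>

lemma growth_weight_increment:
  assumes "0 \<le> x" "x \<le> y"
  shows "discount M / (2 * real CARD('n)) * (\<Sum>i\<in>UNIV. (y - x) $ i / premium M $ i) \<le> H y - H x"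
proof -
  let ?b = "discount M / (2 * real CARD('n))"
  let ?s = "\<lambda>x :: real ^ 'n. ?b * (\<Sum>i\<in>UNIV. x $ i / premium M $ i)"
  have b: "0 \<le> ?b" using discount_pos by simp
  have nonneg: "0 \<le> ?s z" if "0 \<le> z" for z
    using that discount_pos premium_pos
    by (intro mult_nonneg_nonneg sum_nonneg divide_nonneg_pos) (auto simp: less_eq_vec_def less_imp_le)
  have d: "?s (y - x) = ?s y - ?s x"
    by (simp add: diff_divide_distrib sum_subtractf right_diff_distrib)
  have "0 \<le> ?s (y - x)" using assms by (intro nonneg) simp
  then have "1 * (?s (y - x)) \<le> exp (?s x) * (exp (?s (y - x)) - 1)"
    using nonneg[OF assms(1)] exp_ge_add_one_self[of "?s (y - x)"]
    by (intro mult_mono) (simp_all add: algebra_simps)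
  also have "\<dots> = exp (?s y) - exp (?s x)"
  proof -
    have "?s x + ?s (y - x) = ?s y" unfolding d by simp
    then show ?thesis unfolding right_diff_distrib exp_add[symmetric] by simp
  qed
  finally show ?thesis by (simp add: growth_weight_def)
qed

lemma growth_weight_mono: "0 \<le> x \<Longrightarrow> x \<le> y \<Longrightarrow> H x \<le> H y"
proof -
  assume *: "0 \<le> x" "x \<le> y"
  have "0 \<le> discount M / (2 * real CARD('n)) * (\<Sum>i\<in>UNIV. (y - x) $ i / premium M $ i)"
    using discount_pos premium_pos *
    by (intro mult_nonneg_nonneg sum_nonneg divide_nonneg_pos) (auto simp: less_eq_vec_def less_imp_le)
  then show "H x \<le> H y" using growth_weight_increment[OF *] by simp
qed

lemma growth_weight_ge_1: "0 \<le> x \<Longrightarrow> 1 \<le> H x"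
  using growth_weight_mono[of 0 x] by (simp add: growth_weight_def)

lemma growth_conditionD:
  assumes "growth_condition M h" obtains C where "0 \<le> C" "\<And>x. 0 \<le> x \<Longrightarrow> h x \<le> C * H x"
proof -
  obtain C where C: "\<And>x. 0 \<le> x \<Longrightarrow> h x / H x \<le> C"
    using assms unfolding growth_condition_def bdd_above_def by auto
  have "h x \<le> max 0 C * H x" if "0 \<le> x" for x
    using C[OF that] growth_weight_pos[of x] by (simp add: pos_divide_le_eq le_max_iff_disj max_mult_distrib_right)
  then show ?thesis by (intro that[of "max 0 C"]) simp_all
qed

text \<open>The first condition makes the slope of K times the growth weight in direction
  \<open>i\<close> at least the weight of a dividend of company \<open>i\<close>; the other two are
  the growth conditions with a common constant.\<close>

lemma growth_constant_exists:
  "\<exists>K. (\<forall>i. weight M $ i * premium M $ i \<le> discount M / (2 * real CARD('n)) * K) \<and>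
     (\<forall>x\<ge>0. switch_value M x \<le> K * H x) \<and>
     (\<forall>x \<alpha>. (x, \<alpha>) \<in> ruin_pairs \<longrightarrow> - penalty M x \<alpha> \<le> K * H x)"
proof -
  obtain C where C: "0 \<le> C" "\<And>x. 0 \<le> x \<Longrightarrow> switch_value M x \<le> C * H x"
    using growth_conditionD[OF switch_growth] by blast
  obtain D where D: "0 \<le> D" "\<And>x. 0 \<le> x \<Longrightarrow> (SUP \<alpha>\<in>{\<alpha>. (x, \<alpha>) \<in> ruin_pairs}. - penalty M x \<alpha>) \<le> D * H x"
    using growth_conditionD[OF penalty_growth] by blast
  let ?b = "discount M / (2 * real CARD('n))"
  have b: "0 < ?b" using discount_pos by simp
  \<comment> \<open>A sum of nonnegative terms, hence at least as large as each of them, so that one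
    constant serves all companies.\<close>
  let ?E = "\<Sum>i\<in>UNIV. weight M $ i * premium M $ i / ?b"
  have nonneg: "0 \<le> weight M $ i * premium M $ i / ?b" for i
    using b weight_pos[of i] premium_pos[of i] by (intro divide_nonneg_pos mult_nonneg_nonneg) (auto simp: less_imp_le)
  have E: "weight M $ i * premium M $ i / ?b \<le> ?E" for i
    using nonneg by (intro member_le_sum) auto
  have E0: "0 \<le> ?E" by (intro sum_nonneg nonneg)
  let ?K = "?E + C + D"
  have "weight M $ i * premium M $ i \<le> ?b * ?K" for i
  proof -
    have "weight M $ i * premium M $ i / ?b \<le> ?K" using E[of i] C D by simp
    then show ?thesis using b by (simp only: pos_divide_le_eq mult.commute)
  qed
  moreover have "switch_value M x \<le> ?K * H x" if "0 \<le> x" for x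
    using C(2)[OF that] E0 D(1) growth_weight_pos[of x]
    by (intro order_trans[OF C(2)[OF that]] mult_right_mono) auto
  moreover have "- penalty M x \<alpha> \<le> ?K * H x" if *: "(x, \<alpha>) \<in> ruin_pairs" for x \<alpha>
  proof -
    have x: "0 \<le> x" using * by (auto simp: ruin_pairs_def)
    have "- penalty M x \<alpha> \<le> (SUP \<alpha>\<in>{\<alpha>. (x, \<alpha>) \<in> ruin_pairs}. - penalty M x \<alpha>)"
      using * penalty_bdd[OF x] by (intro cSUP_upper) auto
    also have "\<dots> \<le> D * H x" by (rule D(2)[OF x])
    also have "\<dots> \<le> ?K * H x" using E0 C(1) growth_weight_pos[of x] by (intro mult_right_mono) auto
    finally show ?thesis .
  qed
  ultimately show ?thesis by (intro exI[of _ ?K]) blast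
qed

text \<open>Extending the penalty by zero makes it Borel measurable on the whole space.\<close>

definition loss :: "real ^ 'n \<Rightarrow> real ^ 'n \<Rightarrow> real" where
  "loss x \<alpha> = (if (x, \<alpha>) \<in> ruin_pairs then penalty M x \<alpha> else 0)"

lemma pred_ruin_pairs [measurable (raw)]:
  assumes [measurable]: "f \<in> borel_measurable N" "g \<in> borel_measurable N"
  shows "Measurable.pred N (\<lambda>x. (f x, g x :: real ^ 'n) \<in> ruin_pairs)"
  unfolding ruin_pairs_def by simp

lemma borel_measurable_loss [measurable (raw)]:
  assumes [measurable]: "f \<in> borel_measurable N" "g \<in> borel_measurable N"
  shows "(\<lambda>x. loss (f x) (g x)) \<in> borel_measurable N"
proof -
  have R: "(ruin_pairs :: ((real ^ 'n) \<times> (real ^ 'n)) set) \<in> sets borel"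
  proof -
    have "{x \<in> space (borel \<Otimes>\<^sub>M borel). (fst x, snd x :: real ^ 'n) \<in> ruin_pairs} \<in> sets (borel \<Otimes>\<^sub>M borel)"
      by measurable
    then show ?thesis unfolding borel_prod by simp
  qed
  have "(\<lambda>x. indicator ruin_pairs x *\<^sub>R case_prod (penalty M) x) \<in> borel_measurable borel"
    using penalty_measurable R by (subst (asm) borel_measurable_restrict_space_iff) simp_all
  also have "(\<lambda>x. indicator ruin_pairs x *\<^sub>R case_prod (penalty M) x) = (\<lambda>x. loss (fst x) (snd x))"
    by (auto simp: loss_def fun_eq_iff)
  finally have [measurable]: "(\<lambda>x. loss (fst x) (snd x)) \<in> borel_measurable (borel \<Otimes>\<^sub>M borel)"
    by (simp add: borel_prod)
  have "(\<lambda>x. (\<lambda>x. loss (fst x) (snd x)) (f x, g x)) \<in> borel_measurable N"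
    by measurable
  then show ?thesis by simp
qed

text \<open>For a fixed claim the penalty is largest at surplus zero, the surplus at which its
  integrability is assumed.\<close>

lemma loss_le: "(x, \<alpha>) \<in> ruin_pairs \<Longrightarrow> penalty M x \<alpha> \<le> loss 0 \<alpha>"
proof -
  assume *: "(x, \<alpha>) \<in> ruin_pairs"
  then have "(0, \<alpha>) \<in> ruin_pairs" "0 \<le> x"
    by (auto simp: ruin_pairs_def)
  then show ?thesis using penalty_antimono[OF _ *, of 0] by (simp add: loss_def)
qed

lemma integrable_loss_0: "integrable (claim_law M) (\<lambda>u. loss 0 u)"
proof -
  have "(\<lambda>u. loss 0 u) = (\<lambda>u. indicator {\<alpha>. (0, \<alpha>) \<in> ruin_pairs} u *\<^sub>R penalty M 0 u)"
    by (auto simp: loss_def fun_eq_iff)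
  then show ?thesis using penalty_integrable unfolding set_integrable_def by simp
qed

end

lemma finite_le_vec: "finite {q :: nat ^ 'n::finite. q \<le> b}"
proof (rule finite_subset)
  show "{q. q \<le> b} \<subseteq> vec_lambda ` (PiE UNIV (\<lambda>i. {..b $ i}))"
  proof
    fix q :: "nat ^ 'n" assume "q \<in> {q. q \<le> b}"
    then show "q \<in> vec_lambda ` (PiE UNIV (\<lambda>i. {..b $ i}))"
      by (intro image_eqI[of _ _ "\<lambda>i. q $ i"]) (auto simp: less_eq_vec_def)
  qed
qed (intro finite_imageI finite_PiE, simp_all)

section \<open>One waiting step and its contraction factor\<close>

context grid_model
begin

lemma measurable_grid_index [measurable]: "gi \<in> borel \<rightarrow>\<^sub>M count_space UNIV"
proof -
  have [measurable]: "(\<lambda>v::real^'n. v $ i) \<in> borel_measurable borel" for i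
    by (intro borel_measurable_continuous_onI continuous_intros)
  have "gi -` {q} \<inter> space borel \<in> sets borel" for q
  proof -
    have "gi -` {q} \<inter> space borel = {x \<in> space borel. \<forall>i. nat \<lfloor>x $ i / (\<delta> * premium M $ i)\<rfloor> = q $ i}"
      by (auto simp: grid_index_def vec_eq_iff)
    also have "\<dots> \<in> sets borel" by measurable
    finally show ?thesis .
  qed
  then show ?thesis by (subst measurable_count_space_eq2_countable) simp_all
qed

lemma measurable_grid_fun [measurable (raw)]:
  assumes "f \<in> borel_measurable N" shows "(\<lambda>x. \<kappa> (gi (f x)) :: real) \<in> borel_measurable N"
  by (rule measurable_compose[OF assms]) (rule measurable_compose[OF measurable_grid_index], simp)

lemma measurable_grid_floor [measurable (raw)]:
  assumes "f \<in> borel_measurable N" shows "(\<lambda>x. gf (f x)) \<in> borel_measurable N"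
  unfolding grid_floor_def
  by (rule measurable_compose[OF assms]) (rule measurable_compose[OF measurable_grid_index], simp)

lemma measurable_carried [measurable (raw)]:
  assumes [measurable]: "f \<in> borel_measurable N" shows "(\<lambda>x. carried q (f x)) \<in> borel_measurable N"
  unfolding carried_def by measurable

abbreviation "h q \<equiv> H (gp q)"

lemma growth_weight_carried: "H (carried q t) = exp (discount M * t / 2) * h q"
  unfolding carried_def by (rule growth_weight_drift)

text \<open>The discounted outcome of waiting as a function of the first jump \<open>x\<close> (time
  and size), when that jump ends the step; \<open>\<kappa>\<close> is the continuation
  value.\<close>

definition wait_payoff :: "(nat ^ 'n \<Rightarrow> real) \<Rightarrow> nat ^ 'n \<Rightarrow> real \<times> (real ^ 'n) \<Rightarrow> real" where
  "wait_payoff \<kappa> m x = exp (- discount M * fst x) *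
     (let z = carried m (fst x); y = z - snd x in
      if 0 \<le> y then \<kappa> (gi y) + weight M \<bullet> (y - gf y) else - loss z (snd x))"

text \<open>The part of \<open>wait_payoff\<close> that is linear in \<open>\<kappa>\<close>:
  perturbing the continuation value changes the payoff by this part alone.\<close>

definition wait_weight :: "(nat ^ 'n \<Rightarrow> real) \<Rightarrow> nat ^ 'n \<Rightarrow> real \<times> (real ^ 'n) \<Rightarrow> real" where
  "wait_weight \<kappa> m x = exp (- discount M * fst x) *
     (let y = carried m (fst x) - snd x in if 0 \<le> y then \<kappa> (gi y) else 0)"

lemma borel_measurable_wait_payoff [measurable]: "wait_payoff \<kappa> m \<in> borel_measurable jump_space"
  unfolding wait_payoff_def Let_def by measurable

lemma borel_measurable_wait_weight [measurable]: "wait_weight \<kappa> m \<in> borel_measurable jump_space"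
  unfolding wait_weight_def Let_def by measurable

lemma wait_payoff_eq:
  "wait_payoff \<kappa> m x = wait_weight \<kappa> m x + wait_payoff (\<lambda>_. 0) m x"
  by (simp add: wait_payoff_def wait_weight_def Let_def distrib_left)

lemma wait_weight_linear:
  "wait_weight (\<lambda>q. \<kappa> q + \<epsilon> * \<eta> q) m x = wait_weight \<kappa> m x + \<epsilon> * wait_weight \<eta> m x"
  by (simp add: wait_weight_def Let_def distrib_left)

lemma discount_growth_carried:
  "exp (- discount M * t) * H (carried m t) = exp (- (discount M / 2) * t) * h m"
  by (simp add: growth_weight_carried exp_add[symmetric] field_simps)

lemma wait_weight_growth_le:
  assumes "0 < t" "0 \<le> u"
  shows "wait_weight h m (t, u) \<le> exp (- (discount M / 2) * t) * h m"
proof (cases "0 \<le> carried m t - u")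
  case True
  have "h (gi (carried m t - u)) \<le> H (carried m t)"
    using True assms grid_floor_le[OF True]
    by (intro growth_weight_mono grid_point_nonneg) (simp add: grid_floor_def order_trans)
  then have "exp (- discount M * t) * h (gi (carried m t - u)) \<le> exp (- discount M * t) * H (carried m t)"
    by (intro mult_left_mono) simp_all
  then show ?thesis using True unfolding discount_growth_carried by (simp add: wait_weight_def Let_def)
next
  case False
  then show ?thesis using growth_weight_pos by (simp add: wait_weight_def less_imp_le)
qed

lemma integral_step_law:
  assumes f: "integrable step_law f"
  shows "(\<integral>x. f x \<partial>step_law) =
    (\<integral>t. exponential_density (intensity M) t * (\<integral>u. f (t, u) \<partial>claim_law M) \<partial>lborel)"
proof -
  interpret A: prob_space "density lborel (exponential_density (intensity M))" by (rule prob_space_exp)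
  interpret B: prob_space "claim_law M" by (rule claim_prob)
  interpret pair_sigma_finite "density lborel (exponential_density (intensity M))" "claim_law M" ..
  have [measurable]: "f \<in> borel_measurable (lborel \<Otimes>\<^sub>M claim_law M)"
    using f by (auto dest!: borel_measurable_integrable cong: measurable_cong_sets)
  have "(\<integral>x. f x \<partial>step_law) =
      (\<integral>t. (\<integral>u. f (t, u) \<partial>claim_law M) \<partial>density lborel (exponential_density (intensity M)))"
    using f unfolding step_law_def by (rule integral_fst'[symmetric])
  also have "\<dots> = (\<integral>t. exponential_density (intensity M) t *\<^sub>R (\<integral>u. f (t, u) \<partial>claim_law M) \<partial>lborel)"
    using exponential_density_nonneg[OF intensity_pos]
    by (intro integral_density) (auto intro!: B.borel_measurable_lebesgue_integral)
  finally show ?thesis by simp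
qed

text \<open>The expectation of exp (- c min(\<tau>, \<delta>) / 2) for the exponential waiting time
  \<tau>; the first summand is the contribution of \<tau> > \<delta>.\<close>

definition contraction :: real where
  "contraction = exp (- (intensity M + discount M / 2) * \<delta>) +
     (\<integral>x. indicator {..\<delta>} (fst x) * exp (- (discount M / 2) * fst x) \<partial>step_law)"

lemma integrable_step_discount: "0 < s \<Longrightarrow> integrable step_law (\<lambda>x. exp (- s * fst x))"
proof -
  assume s: "0 < s"
  interpret S: prob_space step_law by (rule prob_space_step_law)
  show ?thesis
  proof (rule S.integrable_const_bound[of _ 1])
    show "AE x in step_law. norm (exp (- s * fst x)) \<le> 1"
      using AE_step_law by eventually_elim (use s in simp)
  qed simp
qed

text \<open>By memorylessness the constant equals e + (1 - e) \<theta> with \<theta> = \<lambda> /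
  (\<lambda> + c/2) and e = exp (- (\<lambda> + c/2) \<delta>): a convex combination of 1 and
  \<theta> < 1 in which \<theta> has positive weight, since \<delta> > 0.\<close>

lemma contraction_bounds: "0 \<le> contraction" "contraction < 1"
proof -
  interpret B: prob_space "claim_law M" by (rule claim_prob)
  interpret S: prob_space step_law by (rule prob_space_step_law)
  let ?s = "discount M / 2" and ?l = "intensity M"
  let ?\<theta> = "?l / (?l + ?s)" and ?e = "exp (- (?l + ?s) * \<delta>)"
  have s: "0 < ?s" using discount_pos by simp
  note int = integrable_step_discount[OF s]
  have "(\<integral>\<^sup>+x. ennreal (exp (- ?s * fst x)) \<partial>step_law) = ennreal ?\<theta>"
    by (subst nn_integral_step_law) (simp_all only: exponential_discount[OF s] fst_conv nn_integral_const
        space_claim_law B.emeasure_space_1[simplified] mult_1_right, measurable)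
  then have tot: "(\<integral>x. exp (- ?s * fst x) \<partial>step_law) = ?\<theta>"
    using int s intensity_pos by (intro integral_eq_nn_integral[THEN trans]) auto
  have nn: "(\<integral>\<^sup>+x. ennreal (indicator {\<delta><..} (fst x) * exp (- ?s * fst x)) \<partial>step_law) = ennreal (?e * ?\<theta>)"
  proof -
    have "(\<integral>\<^sup>+x. ennreal (indicator {\<delta><..} (fst x) * exp (- ?s * fst x)) \<partial>step_law) =
      (\<integral>\<^sup>+x. indicator {\<delta><..} (fst x) * ennreal (exp (- ?s * fst x)) \<partial>step_law)"
      by (intro nn_integral_cong) (auto simp: indicator_def)
    also have "\<dots> = ennreal (exp (- ?l * \<delta>)) * (\<integral>\<^sup>+x. ennreal (exp (- ?s * (\<delta> + fst x))) \<partial>step_law)"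
      using nn_integral_memoryless[of "\<lambda>x. ennreal (exp (- ?s * fst x))", OF _ step_pos] by simp
    also have "(\<integral>\<^sup>+x. ennreal (exp (- ?s * (\<delta> + fst x))) \<partial>step_law) =
      (\<integral>\<^sup>+x. ennreal (exp (- ?s * \<delta>)) * ennreal (exp (- ?s * fst x)) \<partial>step_law)"
      by (intro nn_integral_cong) (simp add: ennreal_mult'[symmetric] exp_add[symmetric] algebra_simps)
    also have "\<dots> = ennreal (exp (- ?s * \<delta>)) * ennreal ?\<theta>"
      using \<open>(\<integral>\<^sup>+x. ennreal (exp (- ?s * fst x)) \<partial>step_law) = ennreal ?\<theta>\<close>
      by (subst nn_integral_cmult) simp_all
    also have "ennreal (exp (- ?l * \<delta>)) * (ennreal (exp (- ?s * \<delta>)) * ennreal ?\<theta>) = ennreal (?e * ?\<theta>)"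
      using s intensity_pos
      by (simp add: ennreal_mult'[symmetric] exp_add[symmetric] mult.assoc[symmetric] algebra_simps)
    finally show ?thesis .
  qed
  have int1: "integrable step_law (\<lambda>x. indicator {\<delta><..} (fst x) * exp (- ?s * fst x))"
    by (rule Bochner_Integration.integrable_bound[OF int]) (auto simp: indicator_def)
  have "(\<integral>x. indicator {\<delta><..} (fst x) * exp (- ?s * fst x) \<partial>step_law) =
      enn2real (\<integral>\<^sup>+x. ennreal (indicator {\<delta><..} (fst x) * exp (- ?s * fst x)) \<partial>step_law)"
    by (rule integral_eq_nn_integral) auto
  also have "\<dots> = ?e * ?\<theta>" unfolding nn using s intensity_pos by simp
  finally have gt: "(\<integral>x. indicator {\<delta><..} (fst x) * exp (- ?s * fst x) \<partial>step_law) = ?e * ?\<theta>" .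
  have int2: "integrable step_law (\<lambda>x. indicator {..\<delta>} (fst x) * exp (- ?s * fst x))"
    by (rule Bochner_Integration.integrable_bound[OF int]) (auto simp: indicator_def)
  have "?\<theta> = (\<integral>x. indicator {\<delta><..} (fst x) * exp (- ?s * fst x) + indicator {..\<delta>} (fst x) * exp (- ?s * fst x) \<partial>step_law)"
    unfolding tot[symmetric] by (intro Bochner_Integration.integral_cong) (auto simp: indicator_def)
  also have "\<dots> = ?e * ?\<theta> + (contraction - ?e)"
    unfolding Bochner_Integration.integral_add[OF int1 int2] gt contraction_def by simp
  finally have c: "contraction = ?e + (1 - ?e) * ?\<theta>" by (simp add: algebra_simps)
  have e: "0 < ?e" "?e < 1" using step_pos s intensity_pos by (simp_all add: mult_neg_pos)
  have t: "0 < ?\<theta>" "?\<theta> < 1" using s intensity_pos by simp_all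
  have "0 \<le> (1 - ?e) * ?\<theta>" using e t by (intro mult_nonneg_nonneg) auto
  then show "0 \<le> contraction" unfolding c using e by linarith
  have "(1 - ?e) * ?\<theta> < (1 - ?e) * 1" using e t by (intro mult_strict_left_mono) auto
  then have "?e + (1 - ?e) * ?\<theta> < ?e + (1 - ?e) * 1" by (rule add_strict_left_mono)
  also have "?e + (1 - ?e) * 1 = 1" by simp
  finally show "contraction < 1" unfolding c .
qed

end

locale grid_bound = grid_model M \<delta> for M :: "('n :: finite) risk_model" and \<delta> +
  fixes K :: real
  assumes K_weight: "\<And>i. weight M $ i * premium M $ i \<le> discount M / (2 * real CARD('n)) * K"
    and K_switch: "\<And>x. 0 \<le> x \<Longrightarrow> switch_value M x \<le> K * H x"
    and K_penalty: "\<And>x \<alpha>. (x, \<alpha>) \<in> ruin_pairs \<Longrightarrow> - penalty M x \<alpha> \<le> K * H x"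
begin

lemma K_pos: "0 < K"
proof -
  have "0 < discount M / (2 * real CARD('n)) * K"
    using K_weight[of undefined] weight_pos[of undefined] premium_pos[of undefined]
      mult_pos_pos[of "weight M $ undefined" "premium M $ undefined"] by linarith
  then show ?thesis using discount_pos by (simp add: zero_less_divide_iff zero_less_mult_iff)
qed

text \<open>Coordinatewise, \<open>K_weight\<close> compares the dividend weight with K times the
  guaranteed slope of the growth weight from \<open>growth_weight_increment\<close>.\<close>

lemma dividend_le:
  assumes "0 \<le> x" "x \<le> y" shows "weight M \<bullet> (y - x) + K * H x \<le> K * H y"
proof -
  let ?b = "discount M / (2 * real CARD('n))"
  have "weight M \<bullet> (y - x) \<le> (\<Sum>i\<in>UNIV. ?b * K * ((y - x) $ i / premium M $ i))"
    unfolding inner_vec_def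
  proof (rule sum_mono)
    fix i
    have "0 \<le> (y - x) $ i / premium M $ i"
      using assms premium_pos[of i] by (simp add: less_eq_vec_def)
    from mult_right_mono[OF K_weight[of i] this]
    show "weight M $ i \<bullet> (y - x) $ i \<le> ?b * K * ((y - x) $ i / premium M $ i)"
      using premium_pos[of i] by simp
  qed
  also have "\<dots> = K * (?b * (\<Sum>i\<in>UNIV. (y - x) $ i / premium M $ i))"
    by (simp add: sum_distrib_left mult_ac)
  also have "\<dots> \<le> K * (H y - H x)"
    using growth_weight_increment[OF assms] K_pos by (intro mult_left_mono) auto
  finally show ?thesis by (simp add: right_diff_distrib)
qed

text \<open>From below the growth condition bounds the penalty, from above its value at surplus zero
  does; so integrability is reduced to that of \<open>loss 0\<close>.\<close>

lemma abs_loss_le: "\<bar>loss x \<alpha>\<bar> \<le> K * H x + \<bar>loss 0 \<alpha>\<bar>"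
proof (cases "(x, \<alpha>) \<in> ruin_pairs")
  case True
  then have "loss x \<alpha> = penalty M x \<alpha>" by (simp add: loss_def)
  then show ?thesis using K_penalty[OF True] loss_le[OF True] mult_pos_pos[OF K_pos growth_weight_pos[of x]]
    by linarith
next
  case False
  then show ?thesis using mult_pos_pos[OF K_pos growth_weight_pos[of x]] by (simp add: loss_def[of x])
qed

text \<open>This holds for every \<open>\<kappa>\<close>, since only finitely many landing indices
  are possible within one step. The integrable majorant is a constant plus the penalty at surplus
  zero.\<close>

lemma integrable_wait_payoff:
  "integrable step_law (\<lambda>x. indicator {..\<delta>} (fst x) * wait_payoff \<kappa> m x)"
proof -
  interpret A: prob_space "density lborel (exponential_density (intensity M))" by (rule prob_space_exp)
  interpret B: prob_space "claim_law M" by (rule claim_prob)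
  interpret S: prob_space step_law by (rule prob_space_step_law)
  interpret pair_sigma_finite "density lborel (exponential_density (intensity M))" "claim_law M" ..
  \<comment> \<open>The maximum over all indices at which the step can land, by
    \<open>grid_index_landing_le\<close>.\<close>
  let ?B = "Max ((\<lambda>q. \<bar>\<kappa> q\<bar>) ` {q. q \<le> m + 1})"
  have B: "\<bar>\<kappa> q\<bar> \<le> ?B" if "q \<le> m + 1" for q
    using that finite_le_vec by (intro Max_ge) auto
  have B0: "0 \<le> ?B" using B[of 0] by (simp add: less_eq_vec_def)
  let ?D = "?B + K * H (carried m \<delta>)"
  have L: "integrable step_law (\<lambda>x. \<bar>loss 0 (snd x)\<bar>)"
  proof (rule integrableI_bounded)
    have "(\<integral>\<^sup>+x. ennreal (norm \<bar>loss 0 (snd x)\<bar>) \<partial>step_law) =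
      (\<integral>\<^sup>+t. \<integral>\<^sup>+u. ennreal (norm (loss 0 u)) \<partial>claim_law M \<partial>density lborel (exponential_density (intensity M)))"
      unfolding step_law_def by (subst B.nn_integral_fst[symmetric]) simp_all
    also have "\<dots> = (\<integral>\<^sup>+u. ennreal (norm (loss 0 u)) \<partial>claim_law M)"
      using A.emeasure_space_1 by simp
    also have "\<dots> < \<infinity>" using integrable_loss_0 unfolding integrable_iff_bounded by simp
    finally show "(\<integral>\<^sup>+x. ennreal (norm \<bar>loss 0 (snd x)\<bar>) \<partial>step_law) < \<infinity>" .
  qed simp
  have "integrable step_law (\<lambda>x. ?D + \<bar>loss 0 (snd x)\<bar>)" using L by simp
  then show ?thesis
  proof (rule Bochner_Integration.integrable_bound)
    show "AE x in step_law. norm (indicator {..\<delta>} (fst x) * wait_payoff \<kappa> m x) \<le> norm (?D + \<bar>loss 0 (snd x)\<bar>)"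
      using AE_step_law
    proof eventually_elim
      case (elim x)
      obtain t u where x: "x = (t, u)" by (cases x)
      have H0: "0 < K * H z" for z using K_pos growth_weight_pos by simp
      show ?case
      proof (cases "t \<le> \<delta>")
        case False
        then show ?thesis using B0 H0[of "carried m \<delta>"] by (simp add: x)
      next
        case True
        have t: "0 < t" "0 \<le> u" using elim x by auto
        have Hz: "K * H (carried m t) \<le> K * H (carried m \<delta>)"
          unfolding growth_weight_carried using True K_pos discount_pos growth_weight_pos
          by (intro mult_left_mono mult_right_mono) (auto simp: less_imp_le)
        have e: "exp (- discount M * t) \<le> 1" using t discount_pos by simp
        have "\<bar>let z = carried m t; y = z - u in
           if 0 \<le> y then \<kappa> (gi y) + weight M \<bullet> (y - gf y) else - loss z u\<bar> \<le> ?D + \<bar>loss 0 u\<bar>"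
        proof (cases "0 \<le> carried m t - u")
          case T: True
          let ?y = "carried m t - u"
          have "0 \<le> weight M \<bullet> (?y - gf ?y)"
            using grid_floor_le[OF T] weight_pos unfolding inner_vec_def
            by (intro sum_nonneg) (auto simp: less_eq_vec_def less_imp_le)
          moreover have "weight M \<bullet> (?y - gf ?y) \<le> K * H ?y"
            using dividend_le[OF grid_floor_nonneg grid_floor_le[OF T]] H0[of "gf ?y"] by linarith
          moreover have "K * H ?y \<le> K * H (carried m t)"
            using T t K_pos by (intro mult_left_mono growth_weight_mono) auto
          moreover have "\<bar>\<kappa> (gi ?y)\<bar> \<le> ?B" using True t by (intro B grid_index_landing_le) auto
          ultimately show ?thesis using T Hz by (simp add: Let_def del: diff_ge_0_iff_ge)
        next
          case False
          then show ?thesis using abs_loss_le[of "carried m t" u] Hz B0 by (simp add: Let_def)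
        qed
        then have "\<bar>wait_payoff \<kappa> m x\<bar> \<le> 1 * (?D + \<bar>loss 0 u\<bar>)"
          unfolding wait_payoff_def abs_mult x fst_conv snd_conv using e by (intro mult_mono) auto
        then show ?thesis using True by (simp add: x)
      qed
    qed
  qed simp
qed

lemma integrable_wait_weight:
  "integrable step_law (\<lambda>x. indicator {..\<delta>} (fst x) * wait_weight \<kappa> m x)"
proof -
  have "indicator {..\<delta>} (fst x) * wait_weight \<kappa> m x = indicator {..\<delta>} (fst x) * wait_payoff \<kappa> m x -
     indicator {..\<delta>} (fst x) * wait_payoff (\<lambda>_. 0) m x" for x
    using wait_payoff_eq[of \<kappa> m x] by (simp add: right_diff_distrib[symmetric])
  then show ?thesis
    using Bochner_Integration.integrable_diff[OF integrable_wait_payoff[of \<kappa> m] integrable_wait_payoff[of "\<lambda>_. 0" m]]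
    by simp
qed

text \<open>The expected discounted growth weight at the end of a waiting step, with ruin counted as
  0. It is the derivative of the waiting operator in the direction \<open>h\<close>.\<close>

definition landing_weight :: "nat ^ 'n \<Rightarrow> real" where
  "landing_weight m = h (m + 1) * exp (- (discount M + intensity M) * \<delta>) +
     (\<integral>x. indicator {..\<delta>} (fst x) * wait_weight h m x \<partial>step_law)"

text \<open>Premium growth exp (c t / 2) against the discount exp (- c t) leaves exp (- c t / 2),
  while a claim and the rounding to the grid only lower the weight. Averaging over the end of the
  step gives the factor \<open>contraction\<close>.\<close>

lemma landing_weight_bounds: "0 \<le> landing_weight m" "landing_weight m \<le> contraction * h m"
proof -
  have "0 \<le> (\<integral>x. indicator {..\<delta>} (fst x) * wait_weight h m x \<partial>step_law)"
    using growth_weight_pos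
    by (intro Bochner_Integration.integral_nonneg) (auto simp: wait_weight_def Let_def less_imp_le)
  then show "0 \<le> landing_weight m" using growth_weight_pos unfolding landing_weight_def by (auto simp: less_imp_le)
  have s: "0 < discount M / 2" using discount_pos by simp
  have "(\<integral>x. indicator {..\<delta>} (fst x) * wait_weight h m x \<partial>step_law) \<le>
      (\<integral>x. (indicator {..\<delta>} (fst x) * exp (- (discount M / 2) * fst x)) * h m \<partial>step_law)"
  proof (rule integral_mono_AE[OF integrable_wait_weight])
    show "integrable step_law (\<lambda>x. (indicator {..\<delta>} (fst x) * exp (- (discount M / 2) * fst x)) * h m)"
      by (intro integrable_mult_left Bochner_Integration.integrable_bound[OF integrable_step_discount[OF s]])
        (auto simp: indicator_def)
    show "AE x in step_law. indicator {..\<delta>} (fst x) * wait_weight h m x \<le>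
        (indicator {..\<delta>} (fst x) * exp (- (discount M / 2) * fst x)) * h m"
      using AE_step_law
    proof eventually_elim
      case (elim x)
      then show ?case using wait_weight_growth_le[of "fst x" "snd x" m] by (simp add: indicator_def)
    qed
  qed
  also have "\<dots> = (\<integral>x. indicator {..\<delta>} (fst x) * exp (- (discount M / 2) * fst x) \<partial>step_law) * h m"
    by simp
  also have "h (m + 1) * exp (- (discount M + intensity M) * \<delta>) =
      exp (- (intensity M + discount M / 2) * \<delta>) * h m"
  proof -
    have "exp (discount M * \<delta> / 2) * exp (- (discount M + intensity M) * \<delta>) =
        exp (- (intensity M + discount M / 2) * \<delta>)"
      unfolding exp_add[symmetric] by (rule arg_cong[where f = exp]) (simp add: field_simps)
    then show ?thesis unfolding grid_point_add_1 growth_weight_carried by (metis mult.commute mult.assoc)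
  qed
  ultimately show "landing_weight m \<le> contraction * h m"
    unfolding landing_weight_def contraction_def by (simp add: distrib_right)
qed

text \<open>Combines the separate integrals of the discrete HJB operator into one expectation over
  the first jump. The factor \<lambda> exp (- \<lambda> t) is the exponential density, and the
  constraint that claims be nonnegative holds almost surely.\<close>

lemma wait_operator_eq:
  "wait_operator M \<delta> \<kappa> m = \<kappa> (m + 1) * exp (- (discount M + intensity M) * \<delta>) +
     (\<integral>x. indicator {..\<delta>} (fst x) * wait_payoff \<kappa> m x \<partial>step_law)"
proof -
  let ?c = "discount M" and ?l = "intensity M"
  define F where "F x = (let y = carried m (fst x) - snd x in
    if 0 \<le> y then \<kappa> (gi y) + weight M \<bullet> (y - gf y) else 0)" for x
  let ?f1 = "\<lambda>x. indicator {..\<delta>} (fst x) * (exp (- ?c * fst x) * F x)"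
  let ?f2 = "\<lambda>x. indicator {..\<delta>} (fst x) * (exp (- ?c * fst x) * loss (carried m (fst x)) (snd x))"
  have F[measurable]: "F \<in> borel_measurable jump_space" unfolding F_def Let_def by measurable
  have loss0: "loss z u = 0" if "u \<le> z" for z u :: "real ^ 'n"
    using that by (simp add: loss_def ruin_pairs_def)
  have wp: "wait_payoff \<kappa> m x = exp (- ?c * fst x) * F x - exp (- ?c * fst x) * loss (carried m (fst x)) (snd x)" for x
    using loss0 by (simp add: wait_payoff_def F_def Let_def)
  \<comment> \<open>For each jump either the landing part or the ruin part vanishes, so each of them
    is dominated by the whole \<open>wait_payoff\<close>.\<close>
  have i1: "integrable step_law ?f1"
    by (rule Bochner_Integration.integrable_bound[OF integrable_wait_payoff[of \<kappa> m]])
      (auto simp: wp F_def Let_def indicator_def loss0)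
  have i2: "integrable step_law ?f2"
    by (rule Bochner_Integration.integrable_bound[OF integrable_wait_payoff[of \<kappa> m]])
      (auto simp: wp F_def Let_def indicator_def loss0)
  have "(\<integral>x. indicator {..\<delta>} (fst x) * wait_payoff \<kappa> m x \<partial>step_law) = (\<integral>x. ?f1 x - ?f2 x \<partial>step_law)"
    by (intro Bochner_Integration.integral_cong) (simp_all add: wp right_diff_distrib)
  also have "\<dots> = (\<integral>x. ?f1 x \<partial>step_law) - (\<integral>x. ?f2 x \<partial>step_law)"
    by (rule Bochner_Integration.integral_diff[OF i1 i2])
  also have "(\<integral>x. ?f1 x \<partial>step_law) = claim_operator M \<delta> \<kappa> m"
    unfolding integral_step_law[OF i1] claim_operator_def set_lebesgue_integral_def
  proof (intro Bochner_Integration.integral_cong refl)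
    fix t :: real
    show "exponential_density ?l t * (\<integral>u. ?f1 (t, u) \<partial>claim_law M) = indicator {0..\<delta>} t *\<^sub>R
      (let z = gp m + t *\<^sub>R premium M in \<integral>\<alpha>. indicator {\<alpha>. 0 \<le> \<alpha> \<and> \<alpha> \<le> z} \<alpha> *\<^sub>R
        (?l * exp (- (?c + ?l) * t) * (\<kappa> (gi (z - \<alpha>)) + weight M \<bullet> (z - \<alpha> - gf (z - \<alpha>)))) \<partial>claim_law M)"
    proof (cases "0 \<le> t \<and> t \<le> \<delta>")
      case False
      then show ?thesis by (auto simp: exponential_density_def)
    next
      case True
      let ?z = "carried m t"
      have e: "?l * exp (- t * ?l) * exp (- ?c * t) = ?l * exp (- (?c + ?l) * t)"
        by (simp add: exp_add[symmetric] algebra_simps)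
      have "exponential_density ?l t * (\<integral>u. ?f1 (t, u) \<partial>claim_law M) =
          (\<integral>u. ?l * exp (- (?c + ?l) * t) * F (t, u) \<partial>claim_law M)"
        using True unfolding e[symmetric] by (simp add: exponential_density_def)
      also have "\<dots> = (\<integral>\<alpha>. indicator {\<alpha>. 0 \<le> \<alpha> \<and> \<alpha> \<le> ?z} \<alpha> *\<^sub>R
        (?l * exp (- (?c + ?l) * t) * (\<kappa> (gi (?z - \<alpha>)) + weight M \<bullet> (?z - \<alpha> - gf (?z - \<alpha>)))) \<partial>claim_law M)"
      proof (rule integral_cong_AE)
        show "AE u in claim_law M. ?l * exp (- (?c + ?l) * t) * F (t, u) = indicator {\<alpha>. 0 \<le> \<alpha> \<and> \<alpha> \<le> ?z} u *\<^sub>R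
          (?l * exp (- (?c + ?l) * t) * (\<kappa> (gi (?z - u)) + weight M \<bullet> (?z - u - gf (?z - u))))"
          using claim_nonneg by eventually_elim (auto simp: F_def Let_def indicator_def)
      qed measurable
      finally show ?thesis using True by (simp add: carried_def Let_def)
    qed
  qed
  also have "(\<integral>x. ?f2 x \<partial>step_law) = (LINT t:{0..\<delta>}|lborel. exp (- (?c + ?l) * t) *
        expected_penalty M (gp m + t *\<^sub>R premium M))"
    unfolding integral_step_law[OF i2] set_lebesgue_integral_def
  proof (intro Bochner_Integration.integral_cong refl)
    fix t :: real
    show "exponential_density ?l t * (\<integral>u. ?f2 (t, u) \<partial>claim_law M) =
      indicator {0..\<delta>} t *\<^sub>R (exp (- (?c + ?l) * t) * expected_penalty M (gp m + t *\<^sub>R premium M))"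
    proof (cases "0 \<le> t \<and> t \<le> \<delta>")
      case False
      then show ?thesis by (auto simp: exponential_density_def)
    next
      case True
      have e: "?l * exp (- t * ?l) * exp (- ?c * t) = ?l * exp (- (?c + ?l) * t)"
        by (simp add: exp_add[symmetric] algebra_simps)
      have l: "loss z u = indicator {\<alpha>. (z, \<alpha>) \<in> ruin_pairs} u *\<^sub>R penalty M z u" for z u
        by (simp add: loss_def)
      have "exponential_density ?l t * (\<integral>u. ?f2 (t, u) \<partial>claim_law M) =
          ?l * exp (- t * ?l) * exp (- ?c * t) * (\<integral>u. loss (carried m t) u \<partial>claim_law M)"
        using True by (simp add: exponential_density_def)
      then show ?thesis using True unfolding e
        by (simp add: expected_penalty_def set_lebesgue_integral_def l carried_def mult_ac)
    qed
  qed
  finally show ?thesis unfolding wait_operator_def by simp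
qed

lemma wait_operator_mono:
  assumes "\<And>q. \<kappa> q \<le> \<kappa>' q" shows "wait_operator M \<delta> \<kappa> m \<le> wait_operator M \<delta> \<kappa>' m"
  unfolding wait_operator_eq
proof (intro add_mono mult_right_mono assms integral_mono integrable_wait_payoff)
  fix x
  show "indicator {..\<delta>} (fst x) * wait_payoff \<kappa> m x \<le> indicator {..\<delta>} (fst x) * wait_payoff \<kappa>' m x"
    using assms by (intro mult_left_mono) (auto simp: wait_payoff_def Let_def)
qed simp

text \<open>The operator is affine in the continuation value. The lemma is applied with
  \<open>\<epsilon>\<close> of either sign, for the upper and for the lower estimate of
  payoffs.\<close>

lemma wait_operator_perturb:
  "wait_operator M \<delta> (\<lambda>q. \<kappa> q + \<epsilon> * h q) m = wait_operator M \<delta> \<kappa> m + \<epsilon> * landing_weight m"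
proof -
  have "wait_payoff (\<lambda>q. \<kappa> q + \<epsilon> * h q) m x = wait_payoff \<kappa> m x + \<epsilon> * wait_weight h m x" for x
    using wait_payoff_eq[of "\<lambda>q. \<kappa> q + \<epsilon> * h q" m x] wait_payoff_eq[of \<kappa> m x]
      wait_weight_linear[of \<kappa> \<epsilon> h m x] by simp
  then have "(\<integral>x. indicator {..\<delta>} (fst x) * wait_payoff (\<lambda>q. \<kappa> q + \<epsilon> * h q) m x \<partial>step_law) =
    (\<integral>x. indicator {..\<delta>} (fst x) * wait_payoff \<kappa> m x + \<epsilon> * (indicator {..\<delta>} (fst x) * wait_weight h m x) \<partial>step_law)"
    by (intro Bochner_Integration.integral_cong) (simp_all add: algebra_simps)
  also have "\<dots> = (\<integral>x. indicator {..\<delta>} (fst x) * wait_payoff \<kappa> m x \<partial>step_law) +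
     \<epsilon> * (\<integral>x. indicator {..\<delta>} (fst x) * wait_weight h m x \<partial>step_law)"
    using Bochner_Integration.integral_add[OF integrable_wait_payoff[of \<kappa> m]
        integrable_mult_right[OF integrable_wait_weight[of h m], of \<epsilon>]] by simp
  finally show ?thesis
    unfolding wait_operator_eq landing_weight_def by (simp add: algebra_simps)
qed

text \<open>On landing, the amount paid to reach the grid is covered by \<open>dividend_le\<close>;
  at ruin, the gain from a negative penalty is covered by \<open>K_penalty\<close>.\<close>

lemma wait_payoff_super_le:
  assumes "0 < t" "0 \<le> u"
  shows "wait_payoff (\<lambda>q. K * h q) m (t, u) \<le> K * (exp (- (discount M / 2) * t) * h m)"
proof -
  let ?z = "carried m t"
  have z: "0 \<le> ?z" using assms by (intro carried_nonneg) simp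
  have H0: "0 < K * H y" for y using K_pos growth_weight_pos by simp
  have "(let y = ?z - u in if 0 \<le> y then K * h (gi y) + weight M \<bullet> (y - gf y) else - loss ?z u) \<le> K * H ?z"
  proof (cases "0 \<le> ?z - u")
    case T: True
    have "K * h (gi (?z - u)) + weight M \<bullet> (?z - u - gf (?z - u)) \<le> K * H (?z - u)"
      using dividend_le[OF grid_floor_nonneg grid_floor_le[OF T]] by (simp add: grid_floor_def)
    also have "\<dots> \<le> K * H ?z" using T assms K_pos by (intro mult_left_mono growth_weight_mono) auto
    finally show ?thesis using T by (simp add: Let_def)
  next
    case False
    then show ?thesis using K_penalty[of ?z u] H0[of ?z] by (auto simp: loss_def)
  qed
  then have "wait_payoff (\<lambda>q. K * h q) m (t, u) \<le> exp (- discount M * t) * (K * H ?z)"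
    unfolding wait_payoff_def fst_conv snd_conv Let_def by (rule mult_left_mono) simp
  also have "\<dots> = K * (exp (- (discount M / 2) * t) * h m)"
    unfolding discount_growth_carried[symmetric] by simp
  finally show ?thesis .
qed

lemma wait_operator_super: "wait_operator M \<delta> (\<lambda>q. K * h q) m \<le> K * h m"
proof -
  have s: "0 < discount M / 2" using discount_pos by simp
  have "(\<integral>x. indicator {..\<delta>} (fst x) * wait_payoff (\<lambda>q. K * h q) m x \<partial>step_law) \<le>
      (\<integral>x. (indicator {..\<delta>} (fst x) * exp (- (discount M / 2) * fst x)) * (K * h m) \<partial>step_law)"
  proof (rule integral_mono_AE[OF integrable_wait_payoff])
    show "integrable step_law (\<lambda>x. (indicator {..\<delta>} (fst x) * exp (- (discount M / 2) * fst x)) * (K * h m))"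
      by (intro integrable_mult_left Bochner_Integration.integrable_bound[OF integrable_step_discount[OF s]])
        (auto simp: indicator_def)
    show "AE x in step_law. indicator {..\<delta>} (fst x) * wait_payoff (\<lambda>q. K * h q) m x \<le>
        (indicator {..\<delta>} (fst x) * exp (- (discount M / 2) * fst x)) * (K * h m)"
      using AE_step_law
    proof eventually_elim
      case (elim x)
      then show ?case using wait_payoff_super_le[of "fst x" "snd x" m]
        by (simp add: indicator_def mult_ac)
    qed
  qed
  also have "\<dots> = (\<integral>x. indicator {..\<delta>} (fst x) * exp (- (discount M / 2) * fst x) \<partial>step_law) * (K * h m)"
    by simp
  also have "K * h (m + 1) * exp (- (discount M + intensity M) * \<delta>) =
      exp (- (intensity M + discount M / 2) * \<delta>) * (K * h m)"
  proof -
    have "exp (discount M * \<delta> / 2) * exp (- (discount M + intensity M) * \<delta>) =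
        exp (- (intensity M + discount M / 2) * \<delta>)"
      unfolding exp_add[symmetric] by (rule arg_cong[where f = exp]) (simp add: field_simps)
    then show ?thesis unfolding grid_point_add_1 growth_weight_carried by (metis mult.commute mult.assoc)
  qed
  ultimately have "wait_operator M \<delta> (\<lambda>q. K * h q) m \<le> contraction * (K * h m)"
    unfolding wait_operator_eq contraction_def distrib_right by linarith
  also have "\<dots> \<le> 1 * (K * h m)"
    using contraction_bounds K_pos growth_weight_pos by (intro mult_right_mono) (auto simp: less_imp_le)
  finally show ?thesis by simp
qed

section \<open>Monotonicity of the discrete operator and value iteration\<close>

lemma finite_pay: "finite {pay_operator M \<delta> i \<kappa> m | i. 0 < m $ i}"
  using finite_imageI[of "{i. 0 < m $ i}" "\<lambda>i. pay_operator M \<delta> i \<kappa> m"] by (simp add: setcompr_eq_image)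

lemma hjb_le_iff:
  "hjb_operator M \<delta> \<kappa> m \<le> b \<longleftrightarrow> wait_operator M \<delta> \<kappa> m \<le> b \<and> switch_value M (gp m) \<le> b \<and>
     (\<forall>i. 0 < m $ i \<longrightarrow> pay_operator M \<delta> i \<kappa> m \<le> b)"
  unfolding hjb_operator_def using finite_pay[of \<kappa> m]
  by (subst Max_le_iff) (auto simp: switch_operator_def)

lemma hjb_cases:
  "hjb_operator M \<delta> \<kappa> m = wait_operator M \<delta> \<kappa> m \<or> hjb_operator M \<delta> \<kappa> m = switch_value M (gp m) \<or>
     (\<exists>i. 0 < m $ i \<and> hjb_operator M \<delta> \<kappa> m = pay_operator M \<delta> i \<kappa> m)"
proof -
  have "hjb_operator M \<delta> \<kappa> m \<in> {wait_operator M \<delta> \<kappa> m, switch_operator M \<delta> \<kappa> m} \<union>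
     {pay_operator M \<delta> i \<kappa> m | i. 0 < m $ i}"
    unfolding hjb_operator_def using finite_pay[of \<kappa> m] by (intro Max_in) auto
  then show ?thesis by (auto simp: switch_operator_def)
qed

lemma hjb_mono:
  assumes "\<And>q. \<kappa> q \<le> \<kappa>' q" shows "hjb_operator M \<delta> \<kappa> m \<le> hjb_operator M \<delta> \<kappa>' m"
proof -
  have "pay_operator M \<delta> i \<kappa> m \<le> pay_operator M \<delta> i \<kappa>' m" for i
    using assms by (simp add: pay_operator_def)
  moreover have "wait_operator M \<delta> \<kappa> m \<le> wait_operator M \<delta> \<kappa>' m"
    by (rule wait_operator_mono) (rule assms)
  ultimately show ?thesis
    using hjb_le_iff[of \<kappa>' m "hjb_operator M \<delta> \<kappa>' m"]
    by (subst hjb_le_iff) (auto intro: order_trans)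
qed

lemma pay_super: "0 < m $ i \<Longrightarrow> pay_operator M \<delta> i (\<lambda>q. K * h q) m \<le> K * h m"
proof -
  assume i: "0 < m $ i"
  note p = grid_point_diff_axis[OF i]
  have "gp (m - axis i 1) \<le> gp m"
    unfolding p using premium_pos[of i] step_pos by (simp add: less_eq_vec_def axis_def)
  from dividend_le[OF grid_point_nonneg this] show ?thesis
    unfolding pay_operator_def p by (simp add: inner_axis mult_ac)
qed

lemma hjb_super: "hjb_operator M \<delta> (\<lambda>q. K * h q) m \<le> K * h m"
  using wait_operator_super K_switch[OF grid_point_nonneg] pay_super by (simp add: hjb_le_iff)

lemma hjb_solution_exists:
  "\<exists>w. (\<forall>m. hjb_operator M \<delta> w m = w m) \<and> (\<forall>m. w m \<le> K * h m)"
proof -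
  let ?T = "hjb_operator M \<delta>"
  define W where "W k = (?T ^^ k) (\<lambda>m. switch_value M (gp m))" for k
  have W0: "W 0 m = switch_value M (gp m)" and WS: "W (Suc k) m = ?T (W k) m" for k m
    by (simp_all add: W_def)
  have bound: "W k m \<le> K * h m" for k m
  proof (induction k arbitrary: m)
    case 0
    then show ?case by (simp add: W0 K_switch grid_point_nonneg)
  next
    case (Suc k)
    then show ?case unfolding WS using order_trans[OF hjb_mono hjb_super] by blast
  qed
  have mono: "W k m \<le> W (Suc k) m" for k m
  proof (induction k arbitrary: m)
    case 0
    have "switch_value M (gp m) \<le> ?T (W 0) m" using hjb_le_iff[of "W 0" m "?T (W 0) m"] by blast
    then show ?case by (metis W0 WS)
  next
    case (Suc k)
    then show ?case unfolding WS[of "Suc k"] WS[of k] by (intro hjb_mono) (simp add: WS)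
  qed
  then have inc: "incseq (\<lambda>k. W k m)" for m by (intro incseq_SucI)
  have bdd: "bdd_above (range (\<lambda>k. W k m))" for m
    by (rule bdd_aboveI2[where M = "K * h m"]) (rule bound)
  define w where "w m = (SUP k. W k m)" for m
  have lim: "(\<lambda>k. W k m) \<longlonglongrightarrow> w m" for m
    unfolding w_def by (rule LIMSEQ_incseq_SUP[OF bdd inc])
  have le_w: "W k m \<le> w m" for k m unfolding w_def by (rule cSUP_upper[OF UNIV_I bdd])
  have w_le: "w m \<le> K * h m" for m unfolding w_def by (rule cSUP_least) (simp_all add: bound)
  have lim_Suc: "(\<lambda>k. W (Suc k) m) \<longlonglongrightarrow> w m" for m using lim by (rule LIMSEQ_Suc)
  have pw: "(\<lambda>k. indicator {..\<delta>} (fst x) * wait_payoff (W k) m x) \<longlonglongrightarrow> indicator {..\<delta>} (fst x) * wait_payoff w m x" for m x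
    unfolding wait_payoff_def Let_def
    by (cases "0 \<le> carried m (fst x) - snd x") (auto intro!: tendsto_intros lim simp del: diff_ge_0_iff_ge)
  \<comment> \<open>The iterates lie between \<open>W 0\<close> and \<open>w\<close>, so the
    absolute values of these two integrable payoffs dominate the whole sequence.\<close>
  have wait_lim: "(\<lambda>k. wait_operator M \<delta> (W k) m) \<longlonglongrightarrow> wait_operator M \<delta> w m" for m
    unfolding wait_operator_eq
  proof (intro tendsto_intros lim integral_dominated_convergence)
    let ?g = "\<lambda>\<kappa> x. indicator {..\<delta>} (fst x) * wait_payoff \<kappa> m x"
    show "integrable step_law (\<lambda>x. \<bar>?g (W 0) x\<bar> + \<bar>?g w x\<bar>)"
      using integrable_wait_payoff by (intro Bochner_Integration.integrable_add integrable_abs) auto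
    show "AE x in step_law. norm (?g (W k) x) \<le> \<bar>?g (W 0) x\<bar> + \<bar>?g w x\<bar>" for k
    proof (rule AE_I2)
      fix x
      have "?g (W 0) x \<le> ?g (W k) x" "?g (W k) x \<le> ?g w x"
        using inc le_w by (auto intro!: mult_left_mono simp: wait_payoff_def Let_def incseq_def)
      then show "norm (?g (W k) x) \<le> \<bar>?g (W 0) x\<bar> + \<bar>?g w x\<bar>" by simp
    qed
    show "AE x in step_law. (\<lambda>k. ?g (W k) x) \<longlonglongrightarrow> ?g w x" using pw by simp
  qed measurable
  have op: "wait_operator M \<delta> (W k) m \<le> W (Suc k) m" "switch_value M (gp m) \<le> W (Suc k) m"
    "0 < m $ i \<Longrightarrow> pay_operator M \<delta> i (W k) m \<le> W (Suc k) m" for k m i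
    using hjb_le_iff[of "W k" m "?T (W k) m"] by (auto simp: WS)
  \<comment> \<open>The limit is taken in each operator separately, in the inequalities
    \<open>op\<close>, and not in the maximum.\<close>
  have "?T w m \<le> w m" for m
    unfolding hjb_le_iff
  proof (intro conjI allI impI)
    show "wait_operator M \<delta> w m \<le> w m" by (rule LIMSEQ_le[OF wait_lim lim_Suc]) (use op(1) in blast)
    show "switch_value M (gp m) \<le> w m" using le_w[of 0 m] by (simp add: W0)
    fix i assume i: "0 < m $ i"
    have "(\<lambda>k. pay_operator M \<delta> i (W k) m) \<longlonglongrightarrow> pay_operator M \<delta> i w m"
      unfolding pay_operator_def by (intro tendsto_intros lim)
    then show "pay_operator M \<delta> i w m \<le> w m" by (rule LIMSEQ_le[OF _ lim_Suc]) (use op(3)[OF i] in blast)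
  qed
  \<comment> \<open>The converse comes from monotonicity: every iterate is the switch value or the
    operator applied to an earlier iterate, hence below the operator applied to
    \<open>w\<close>.\<close>
  moreover have "w m \<le> ?T w m" for m
    unfolding w_def
  proof (rule cSUP_least)
    fix k
    show "W k m \<le> ?T (\<lambda>m. SUP k. W k m) m"
      unfolding w_def[symmetric]
    proof (cases k)
      case 0
      then show "W k m \<le> ?T w m" using hjb_le_iff[of w m "?T w m"] by (simp add: W0)
    next
      case (Suc l)
      then show "W k m \<le> ?T w m" unfolding Suc WS by (intro hjb_mono le_w)
    qed
  qed simp
  ultimately show ?thesis using w_le by (intro exI[of _ w]) (auto intro: antisym)
qed

end

section \<open>Pathwise bounds\<close>

locale grid_solution = grid_bound M \<delta> K for M :: "('n :: finite) risk_model" and \<delta> K +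
  fixes w :: "nat ^ 'n \<Rightarrow> real"
  assumes w_fixed: "\<And>m. hjb_operator M \<delta> w m = w m"
    and w_le: "\<And>m. w m \<le> K * h m"
begin

lemma w_ge_wait: "wait_operator M \<delta> w m \<le> w m"
  and w_ge_switch: "switch_value M (gp m) \<le> w m"
  and w_ge_pay: "0 < m $ i \<Longrightarrow> pay_operator M \<delta> i w m \<le> w m"
  using hjb_le_iff[of w m "w m"] by (simp_all add: w_fixed)

lemma w_ge_w_0: "w 0 \<le> w m"
proof (induction "level m" arbitrary: m rule: less_induct)
  case less
  show ?case
  proof (cases "\<exists>i. 0 < m $ i")
    case False
    then have "m = 0" by (simp add: vec_eq_iff)
    then show ?thesis by simp
  next
    case True
    then obtain i where i: "0 < m $ i" by blast
    have "w 0 \<le> w (m - axis i 1)" using level_diff_axis[OF i] by (intro less) simp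
    also have "\<dots> \<le> pay_operator M \<delta> i w m"
      using step_pos weight_pos[of i] premium_pos[of i] by (simp add: pay_operator_def)
    also have "\<dots> \<le> w m" by (rule w_ge_pay[OF i])
    finally show ?thesis .
  qed
qed

text \<open>The two-sided growth bound that the switch value lacks. The constant \<open>w 0\<close>
  is absorbed because the growth weight is at least 1 on the orthant.\<close>

lemma abs_w_le: "\<bar>w m\<bar> \<le> (K + \<bar>w 0\<bar>) * h m"
proof -
  have "1 \<le> h m" by (rule growth_weight_ge_1[OF grid_point_nonneg])
  then have "\<bar>w 0\<bar> * 1 \<le> \<bar>w 0\<bar> * h m" by (rule mult_left_mono) simp
  moreover have "0 \<le> K * h m" using K_pos growth_weight_pos[of "gp m"] by simp
  ultimately show ?thesis using w_le[of m] w_ge_w_0[of m] by (simp add: distrib_right abs_le_iff)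
qed

lemma discount_carried_le:
  assumes "0 \<le> r" shows "exp (- discount M * (t + r)) * H (carried q r) \<le> exp (- discount M * t) * h q"
proof -
  have "exp (- discount M * (t + r)) * H (carried q r) = exp (- discount M * t) * (exp (- discount M * r) * H (carried q r))"
    by (simp add: exp_add[symmetric] algebra_simps)
  also have "\<dots> = exp (- discount M * t) * (exp (- (discount M / 2) * r) * h q)"
    unfolding discount_growth_carried ..
  also have "\<dots> \<le> exp (- discount M * t) * (1 * h q)"
    using assms discount_pos growth_weight_pos
    by (intro mult_left_mono mult_right_mono) (auto simp: less_imp_le)
  finally show ?thesis by simp
qed

text \<open>Discounting outweighs the growth by premiums, claims only lower the weight, and what is
  paid out is covered by \<open>dividend_le\<close> or \<open>pay_super\<close>.\<close>

lemma grid_step_super: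
  assumes "\<omega> \<in> paths" "step \<omega> a t q = Some (t', q', d')" "\<And>i. a = Pay i \<Longrightarrow> 0 < q $ i"
  shows "exp (- discount M * t') * (weight M \<bullet> d') + exp (- discount M * t') * (K * h q')
    \<le> exp (- discount M * t) * (K * h q)"
proof (cases a)
  case Wait
  let ?r = "next_time \<omega> t - t"
  have r: "0 < ?r" using next_time_less[OF assms(1)] by simp
  show ?thesis
  proof (cases "\<delta> < ?r")
    case True
    then have *: "t' = t + \<delta>" "q' = q + 1" "d' = 0"
      using assms(2) Wait by (auto simp: grid_step_Wait Let_def)
    have "K * (exp (- discount M * (t + \<delta>)) * H (carried q \<delta>)) \<le> K * (exp (- discount M * t) * h q)"
      using discount_carried_le[of \<delta> t q] step_pos K_pos by (intro mult_left_mono) auto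
    then show ?thesis unfolding * grid_point_add_1 by (simp add: mult_ac)
  next
    case False
    define y where "y = carried q ?r - next_size \<omega> t"
    have *: "0 \<le> y" "t' = next_time \<omega> t" "q' = gi y" "d' = y - gf y"
      using assms(2) Wait False unfolding y_def by (auto simp: grid_step_Wait Let_def split: if_splits)
    have "weight M \<bullet> (y - gf y) + K * H (gf y) \<le> K * H y"
      by (rule dividend_le[OF grid_floor_nonneg grid_floor_le[OF *(1)]])
    also have "\<dots> \<le> K * H (carried q ?r)"
      using *(1) next_size_nonneg[OF assms(1), of t] K_pos
      by (intro mult_left_mono growth_weight_mono) (auto simp: y_def)
    finally have "exp (- discount M * t') * (weight M \<bullet> d' + K * h q') \<le>
        exp (- discount M * t') * (K * H (carried q ?r))"
      unfolding * grid_floor_def by (intro mult_left_mono) auto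
    also have "\<dots> = K * (exp (- discount M * (t + ?r)) * H (carried q ?r))" by (simp add: *(2))
    also have "\<dots> \<le> K * (exp (- discount M * t) * h q)"
      using discount_carried_le[of ?r t q] r K_pos by (intro mult_left_mono) auto
    finally show ?thesis by (simp add: distrib_left mult_ac)
  qed
next
  case (Pay i)
  then have *: "t' = t" "q' = q - axis i 1" "d' = axis i (premium M $ i * \<delta>)" using assms(2) by auto
  have "weight M \<bullet> d' + K * h q' \<le> K * h q"
    using pay_super[OF assms(3)[OF Pay]] unfolding pay_operator_def * by (simp add: inner_axis mult_ac)
  then have "exp (- discount M * t) * (weight M \<bullet> d' + K * h q') \<le> exp (- discount M * t) * (K * h q)"
    by (intro mult_left_mono) auto
  then show ?thesis unfolding *(1) by (simp add: distrib_left)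
qed (use assms(2) in simp)

lemma reward_term_Some: "run m ds \<omega> k = Some (t, q, d) \<Longrightarrow> reward_term X m ds \<omega> k = X \<omega> (ds k) t q"
  and reward_term_None: "run m ds \<omega> k = None \<Longrightarrow> reward_term X m ds \<omega> k = 0"
  by (simp_all add: reward_term_def)

lemma inner_weight_nonneg: "0 \<le> d \<Longrightarrow> 0 \<le> weight M \<bullet> d"
  using weight_pos unfolding inner_vec_def by (intro sum_nonneg) (auto simp: less_eq_vec_def less_imp_le)

lemma dividend_term_nonneg:
  assumes "\<omega> \<in> paths" "legal m ds \<omega>" shows "0 \<le> reward_term dividend_reward m ds \<omega> k"
proof (cases "run m ds \<omega> k")
  case (Some z)
  then obtain t q d where z: "run m ds \<omega> k = Some (t, q, d)" by (cases z) auto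
  show ?thesis
    using grid_step_SomeD(2)[OF assms(1) _ legalD[OF assms(2) z]] inner_weight_nonneg
    by (auto simp: reward_term_Some[OF z] dividend_reward_def split: option.splits)
qed (simp add: reward_term_None)

lemma run_super:
  assumes "\<omega> \<in> paths" "legal m ds \<omega>" "run m ds \<omega> k = Some (t, q, d)"
  shows "(\<Sum>j<k. reward_term dividend_reward m ds \<omega> j) + exp (- discount M * t) * (K * h q) \<le> K * h m"
  using assms(3)
proof (induction k arbitrary: t q d)
  case 0
  then show ?case by simp
next
  case (Suc k)
  from Suc.prems obtain t' q' d' where *: "run m ds \<omega> k = Some (t', q', d')"
    "step \<omega> (ds k) t' q' = Some (t, q, d)" by (rule run_Suc_SomeE)
  show ?case
    using Suc.IH[OF *(1)] grid_step_super[OF assms(1) *(2) legalD[OF assms(2) *(1)]]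
    by (simp add: reward_term_Some[OF *(1)] dividend_reward_def *(2))
qed

lemma dividend_sum_le:
  assumes "\<omega> \<in> paths" "legal m ds \<omega>"
  shows "(\<Sum>j<k. reward_term dividend_reward m ds \<omega> j) \<le> K * h m"
proof (induction k)
  case 0
  then show ?case using K_pos growth_weight_pos by (simp add: less_imp_le)
next
  case (Suc k)
  show ?case
  proof (cases "run m ds \<omega> (Suc k)")
    case (Some z)
    then obtain t q d where z: "run m ds \<omega> (Suc k) = Some (t, q, d)" by (cases z) auto
    have "0 \<le> exp (- discount M * t) * (K * h q)" using K_pos growth_weight_pos by (simp add: less_imp_le)
    then show ?thesis using run_super[OF assms z] by linarith
  next
    case None
    \<comment> \<open>An action that stops the run pays no dividend, so the bound for
      \<open>k\<close> terms carries over.\<close>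
    then have "reward_term dividend_reward m ds \<omega> k = 0"
      by (auto simp: reward_term_def dividend_reward_def split: option.splits)
    then show ?thesis using Suc by simp
  qed
qed

lemma dividend_summable:
  assumes "\<omega> \<in> paths" "legal m ds \<omega>"
  shows "summable (reward_term dividend_reward m ds \<omega>)"
    and "0 \<le> total dividend_reward m ds \<omega>" and "total dividend_reward m ds \<omega> \<le> K * h m"
proof -
  show s: "summable (reward_term dividend_reward m ds \<omega>)"
    by (rule summableI_nonneg_bounded[OF dividend_term_nonneg[OF assms] dividend_sum_le[OF assms]])
  show "0 \<le> total dividend_reward m ds \<omega>"
    unfolding total_def by (rule suminf_nonneg[OF s dividend_term_nonneg[OF assms]])
  show "total dividend_reward m ds \<omega> \<le> K * h m"
    unfolding total_def by (rule suminf_le_const[OF s dividend_sum_le[OF assms]])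
qed

text \<open>Dividends are nonnegative, so dropping them from \<open>run_super\<close> shows that the
  discounted weight never exceeds its initial value. This controls the reward at stopping, however
  late it occurs.\<close>

lemma discounted_growth_run_le:
  assumes "\<omega> \<in> paths" "legal m ds \<omega>" "run m ds \<omega> k = Some (t, q, d)"
  shows "exp (- discount M * t) * h q \<le> h m"
proof -
  have "0 \<le> (\<Sum>j<k. reward_term dividend_reward m ds \<omega> j)"
    by (rule sum_nonneg) (rule dividend_term_nonneg[OF assms(1,2)])
  then have "K * (exp (- discount M * t) * h q) \<le> K * h m"
    using run_super[OF assms] by (simp add: mult_ac)
  then show ?thesis using K_pos by simp
qed

text \<open>A reward that vanishes on actions after which the run continues is earned at most once,
  by the stopping action. The series therefore has at most one nonzero term and its convergence
  needs no estimate.\<close>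

lemma final_reward_sums:
  assumes X: "\<forall>\<omega> a t q. step \<omega> a t q \<noteq> None \<longrightarrow> X \<omega> a t q = 0"
  shows "(\<exists>k t q d. run m ds \<omega> k = Some (t, q, d) \<and> step \<omega> (ds k) t q = None \<and>
      reward_term X m ds \<omega> sums X \<omega> (ds k) t q) \<or>
    (\<forall>k. run m ds \<omega> k \<noteq> None) \<and> reward_term X m ds \<omega> sums 0"
proof (cases "\<forall>k. run m ds \<omega> k \<noteq> None")
  case True
  have "reward_term X m ds \<omega> k = 0" for k
  proof -
    obtain z where z: "run m ds \<omega> (Suc k) = Some z" using True by blast
    obtain t q d where "run m ds \<omega> k = Some (t, q, d)" "step \<omega> (ds k) t q = Some z"
      using z by (auto split: option.splits)
    then show ?thesis using X[rule_format, of \<omega> "ds k" t q] by (simp add: reward_term_Some)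
  qed
  then have "reward_term X m ds \<omega> = (\<lambda>_. 0)" by (simp add: fun_eq_iff)
  then show ?thesis using True by simp
next
  case False
  then obtain j where "run m ds \<omega> j = None" by blast
  then obtain l where l: "run m ds \<omega> l = None" "\<And>i. i < l \<Longrightarrow> run m ds \<omega> i \<noteq> None"
    using exists_least_iff[of "\<lambda>j. run m ds \<omega> j = None"] by auto
  then obtain k where k: "l = Suc k" by (cases l) auto
  obtain t q d where r: "run m ds \<omega> k = Some (t, q, d)" using l(2)[of k] k by (cases "run m ds \<omega> k") auto
  have st: "step \<omega> (ds k) t q = None" using l(1) r k by simp
  have "reward_term X m ds \<omega> i = 0" if "i \<noteq> k" for i
  proof (cases "i < k")
    case True
    then obtain z where z: "run m ds \<omega> (Suc i) = Some z" using l(2)[of "Suc i"] k by auto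
    obtain t q d where "run m ds \<omega> i = Some (t, q, d)" "step \<omega> (ds i) t q = Some z"
      using z by (auto split: option.splits)
    then show ?thesis using X[rule_format, of \<omega> "ds i" t q] by (simp add: reward_term_Some)
  next
    case False
    then have "run m ds \<omega> i = None" using that l(1) k by (intro run_None_mono[OF l(1)]) simp
    then show ?thesis by (rule reward_term_None)
  qed
  then have "reward_term X m ds \<omega> sums reward_term X m ds \<omega> k"
    by (intro sums_finite[of "{k}", simplified]) auto
  then have "reward_term X m ds \<omega> sums X \<omega> (ds k) t q" by (simp add: reward_term_Some[OF r])
  then show ?thesis using r st by blast
qed

text \<open>Every jump is charged as if it struck at surplus zero. This gives one bound for the ruin
  penalty that is the same for all controls and starting points.\<close>

definition path_loss :: "'n path \<Rightarrow> ennreal" where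
  "path_loss \<omega> = (\<Sum>k. ennreal (exp (- discount M * jump_time \<omega> k)) * ennreal \<bar>loss 0 (jump_size \<omega> k)\<bar>)"

lemma borel_measurable_path_loss [measurable]: "path_loss \<in> borel_measurable path_space"
  unfolding path_loss_def by measurable

lemma ruin_step:
  assumes "\<omega> \<in> paths" "step \<omega> Wait t q = None"
  shows "(carried q (next_time \<omega> t - t), next_size \<omega> t) \<in> ruin_pairs"
proof -
  have "0 \<le> carried q (next_time \<omega> t - t)" using next_time_less[OF assms(1), of t] by (intro carried_nonneg) simp
  then show ?thesis using assms next_size_nonneg[OF assms(1), of t]
    by (auto simp: grid_step_Wait Let_def ruin_pairs_def split: if_splits)
qed

lemma switch_total:
  assumes "\<omega> \<in> paths" "legal m ds \<omega>"
  shows "summable (reward_term (switch_reward \<kappa>) m ds \<omega>)"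
    and "(\<And>q. \<bar>\<kappa> q\<bar> \<le> C * h q) \<Longrightarrow> \<bar>total (switch_reward \<kappa>) m ds \<omega>\<bar> \<le> C * h m"
proof -
  have X: "\<forall>\<omega> a t q. step \<omega> a t q \<noteq> None \<longrightarrow> switch_reward \<kappa> \<omega> a t q = 0"
    by (auto simp: switch_reward_def)
  note dich = final_reward_sums[where X = "switch_reward \<kappa>" and m = m and ds = ds and \<omega> = \<omega>, OF X]
  show "summable (reward_term (switch_reward \<kappa>) m ds \<omega>)"
    using dich by (auto simp: sums_iff)
  assume C: "\<And>q. \<bar>\<kappa> q\<bar> \<le> C * h q"
  have "0 \<le> C * h m" using order_trans[OF abs_ge_zero C] .
  then have C0: "0 \<le> C" using growth_weight_pos[of "gp m"] by (simp add: zero_le_mult_iff)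
  show "\<bar>total (switch_reward \<kappa>) m ds \<omega>\<bar> \<le> C * h m"
    using dich
  proof (elim disjE exE conjE)
    fix k t q d
    assume r: "run m ds \<omega> k = Some (t, q, d)" and s: "reward_term (switch_reward \<kappa>) m ds \<omega> sums switch_reward \<kappa> \<omega> (ds k) t q"
    have "\<bar>switch_reward \<kappa> \<omega> (ds k) t q\<bar> \<le> exp (- discount M * t) * \<bar>\<kappa> q\<bar>"
      by (simp add: switch_reward_def abs_mult)
    also have "\<dots> \<le> exp (- discount M * t) * (C * h q)" by (intro mult_left_mono C) simp
    also have "\<dots> = C * (exp (- discount M * t) * h q)" by simp
    also have "\<dots> \<le> C * h m" by (intro mult_left_mono discounted_growth_run_le[OF assms r] C0)
    finally show ?thesis using s by (simp add: total_def sums_iff)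
  next
    assume "reward_term (switch_reward \<kappa>) m ds \<omega> sums 0"
    then show ?thesis using \<open>0 \<le> C * h m\<close> by (simp add: total_def sums_iff)
  qed
qed

text \<open>The lower bound combines \<open>K_penalty\<close> with the decrease of the discounted
  weight along the run; the upper bound is the single term of \<open>path_loss\<close> that belongs
  to the ruining jump.\<close>

lemma ruin_total:
  assumes "\<omega> \<in> paths" "legal m ds \<omega>"
  shows "summable (reward_term ruin_reward m ds \<omega>)"
    and "- (K * h m) \<le> total ruin_reward m ds \<omega>"
    and "ennreal (total ruin_reward m ds \<omega>) \<le> path_loss \<omega>"
proof -
  have X: "\<forall>\<omega> a t q. step \<omega> a t q \<noteq> None \<longrightarrow> ruin_reward \<omega> a t q = 0"
    by (auto simp: ruin_reward_def)
  note dich = final_reward_sums[where X = ruin_reward and m = m and ds = ds and \<omega> = \<omega>, OF X]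
  show "summable (reward_term ruin_reward m ds \<omega>)"
    using dich by (auto simp: sums_iff)
  have H0: "0 \<le> K * h m" using K_pos growth_weight_pos by (simp add: less_imp_le)
  have "- (K * h m) \<le> total ruin_reward m ds \<omega> \<and> ennreal (total ruin_reward m ds \<omega>) \<le> path_loss \<omega>"
    using dich
  proof (elim disjE exE conjE)
    fix k t q d
    assume r: "run m ds \<omega> k = Some (t, q, d)" and s: "reward_term ruin_reward m ds \<omega> sums ruin_reward \<omega> (ds k) t q"
      and N: "step \<omega> (ds k) t q = None"
    have eq: "total ruin_reward m ds \<omega> = ruin_reward \<omega> (ds k) t q" using s by (simp add: total_def sums_iff)
    show ?thesis
    proof (cases "ds k = Wait")
      case False
      then show ?thesis using H0 by (simp add: eq ruin_reward_def)
    next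
      case True
      let ?r = "next_time \<omega> t - t" and ?u = "next_size \<omega> t"
      let ?e = "exp (- discount M * next_time \<omega> t)"
      have rp: "(carried q ?r, ?u) \<in> ruin_pairs" using ruin_step[OF assms(1)] N True by simp
      have eq: "total ruin_reward m ds \<omega> = ?e * penalty M (carried q ?r) ?u"
        using eq True N by (simp add: ruin_reward_def)
      have "?e * - penalty M (carried q ?r) ?u \<le> ?e * (K * H (carried q ?r))"
        by (intro mult_left_mono K_penalty[OF rp]) simp
      also have "\<dots> = K * (exp (- discount M * (t + ?r)) * H (carried q ?r))" by simp
      also have "\<dots> \<le> K * (exp (- discount M * t) * h q)"
        using next_time_less[OF assms(1), of t] K_pos by (intro mult_left_mono discount_carried_le) auto
      also have "\<dots> \<le> K * h m"
        using discounted_growth_run_le[OF assms r] K_pos by (intro mult_left_mono) auto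
      finally have 1: "- (K * h m) \<le> total ruin_reward m ds \<omega>" unfolding eq by simp
      have "penalty M (carried q ?r) ?u \<le> \<bar>loss 0 ?u\<bar>" using loss_le[OF rp] by linarith
      then have "ennreal (total ruin_reward m ds \<omega>) \<le> ennreal (?e * \<bar>loss 0 ?u\<bar>)"
        unfolding eq by (intro ennreal_leI mult_left_mono) auto
      also have "\<dots> = (\<lambda>k. ennreal (exp (- discount M * jump_time \<omega> k)) * ennreal \<bar>loss 0 (jump_size \<omega> k)\<bar>) (jump_count \<omega> t)"
        by (simp add: ennreal_mult' next_time_def next_size_def)
      also have "\<dots> \<le> path_loss \<omega>"
        unfolding path_loss_def
        using sum_le_suminf[of "\<lambda>k. ennreal (exp (- discount M * jump_time \<omega> k)) * ennreal \<bar>loss 0 (jump_size \<omega> k)\<bar>" "{jump_count \<omega> t}"]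
        by simp
      finally show ?thesis using 1 by simp
    qed
  next
    assume "reward_term ruin_reward m ds \<omega> sums 0"
    then show ?thesis using H0 by (simp add: total_def sums_iff)
  qed
  then show "- (K * h m) \<le> total ruin_reward m ds \<omega>" "ennreal (total ruin_reward m ds \<omega>) \<le> path_loss \<omega>"
    by auto
qed

lemma net_total:
  assumes "\<omega> \<in> paths" "legal m ds \<omega>"
  shows "summable (reward_term (net_reward w) m ds \<omega>)"
    and "total (net_reward w) m ds \<omega> =
      total dividend_reward m ds \<omega> + total (switch_reward w) m ds \<omega> - total ruin_reward m ds \<omega>"
    and "ennreal \<bar>total (net_reward w) m ds \<omega>\<bar> \<le> ennreal ((3 * K + \<bar>w 0\<bar>) * h m) + path_loss \<omega>"
proof -
  have eq: "reward_term (net_reward w) m ds \<omega> k = reward_term dividend_reward m ds \<omega> k +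
    reward_term (switch_reward w) m ds \<omega> k - reward_term ruin_reward m ds \<omega> k" for k
    by (auto simp: reward_term_def net_reward_def split: option.splits)
  note D = dividend_summable[OF assms] and S = switch_total[OF assms, of w] and R = ruin_total[OF assms]
  have "(\<lambda>k. reward_term (net_reward w) m ds \<omega> k) sums
    (total dividend_reward m ds \<omega> + total (switch_reward w) m ds \<omega> - total ruin_reward m ds \<omega>)"
    unfolding eq total_def using D(1) S(1) R(1) by (intro sums_diff sums_add summable_sums)
  then show "summable (reward_term (net_reward w) m ds \<omega>)"
    and e: "total (net_reward w) m ds \<omega> =
      total dividend_reward m ds \<omega> + total (switch_reward w) m ds \<omega> - total ruin_reward m ds \<omega>"
    by (auto simp: sums_iff total_def[of "net_reward w"])
  \<comment> \<open>One \<open>K\<close> each for the dividends, the switch value and the lower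
    bound of the ruin part; a positive ruin part is left to \<open>path_loss\<close>.\<close>
  let ?C = "(3 * K + \<bar>w 0\<bar>) * h m"
  have S2: "\<bar>total (switch_reward w) m ds \<omega>\<bar> \<le> (K + \<bar>w 0\<bar>) * h m" by (rule S(2)[OF abs_w_le])
  have "\<bar>total (net_reward w) m ds \<omega>\<bar> \<le> ?C + max 0 (total ruin_reward m ds \<omega>)"
    unfolding e using D(2,3) S2 R(2) by (simp add: algebra_simps)
  moreover have "0 \<le> ?C" using K_pos growth_weight_pos by (simp add: less_imp_le)
  ultimately have "ennreal \<bar>total (net_reward w) m ds \<omega>\<bar> \<le> ennreal (?C + max 0 (total ruin_reward m ds \<omega>))"
    by (intro ennreal_leI)
  also have "\<dots> = ennreal ?C + ennreal (max 0 (total ruin_reward m ds \<omega>))"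
    by (rule ennreal_plus) (simp_all add: \<open>0 \<le> ?C\<close>)
  also have "ennreal (max 0 (total ruin_reward m ds \<omega>)) \<le> path_loss \<omega>"
    using R(3) by (simp add: max_def)
  finally show "ennreal \<bar>total (net_reward w) m ds \<omega>\<bar> \<le> ennreal ?C + path_loss \<omega>"
    by (simp add: add_left_mono)
qed

lemma path_loss_finite: "(\<integral>\<^sup>+\<omega>. path_loss \<omega> \<partial>path_measure M) < \<infinity>"
proof -
  have "(\<integral>\<^sup>+\<omega>. path_loss \<omega> \<partial>path_measure M) \<le> (\<integral>\<^sup>+\<omega>. path_loss \<omega> \<partial>full_law)"
    unfolding path_measure_eq
    by (subst nn_integral_restrict_space) (auto intro!: nn_integral_mono simp: indicator_def)
  also have "\<dots> < \<infinity>"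
    unfolding path_loss_def
    using integrable_loss_0 discount_pos unfolding integrable_iff_bounded
    by (intro nn_integral_discounted_path_sum) auto
  finally show ?thesis .
qed

end

section \<open>Expected payoffs\<close>

lemma grid_control_payD:
  assumes "grid_control M \<delta> m s" "\<omega> \<in> paths" "grid_run M \<delta> m s \<omega> k = Some (t, q, d)" "s \<omega> k = Pay i"
  shows "0 < q $ i"
  using assms unfolding grid_control_def by blast

lemma grid_control_historyD:
  assumes "grid_control M \<delta> m s" "\<omega> \<in> paths" "\<omega>' \<in> paths" "0 \<le> t" "same_history t \<omega> \<omega>'"
    "grid_run M \<delta> m s \<omega> k = Some (r, q, d)" "r \<le> t"
  shows "s \<omega> k = s \<omega>' k"
  using assms unfolding grid_control_def by blast

text \<open>\<open>\<phi>\<close> puts a fixed initial piece of length \<open>T\<close> in front of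
  a path. All times are shifted by \<open>T\<close> and all action numbers by one, so legality and
  nonanticipation are inherited from \<open>s\<close>.\<close>

lemma embedded_grid_control:
  assumes s: "grid_control M \<delta> m s"
    and \<phi>: "\<And>\<omega>. \<omega> \<in> paths \<Longrightarrow> \<phi> \<omega> \<in> paths"
    and run: "\<And>\<omega> k r q' d'. \<omega> \<in> paths \<Longrightarrow>
      grid_run M \<delta> q (\<lambda>\<omega> k. s (\<phi> \<omega>) (Suc k)) \<omega> k = Some (r, q', d') \<Longrightarrow>
      \<exists>d''. grid_run M \<delta> m s (\<phi> \<omega>) (Suc k) = Some (T + r, q', d'')"
    and hist: "\<And>r \<omega> \<omega>'. same_history r \<omega> \<omega>' \<Longrightarrow> same_history (T + r) (\<phi> \<omega>) (\<phi> \<omega>')"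
    and T: "0 \<le> T"
  shows "grid_control M \<delta> q (\<lambda>\<omega> k. s (\<phi> \<omega>) (Suc k))"
  unfolding grid_control_def
proof (intro conjI ballI allI impI; elim conjE)
  fix \<omega> k t q' d i
  assume *: "\<omega> \<in> paths" "grid_run M \<delta> q (\<lambda>\<omega> k. s (\<phi> \<omega>) (Suc k)) \<omega> k = Some (t, q', d)"
    "s (\<phi> \<omega>) (Suc k) = Pay i"
  obtain d'' where "grid_run M \<delta> m s (\<phi> \<omega>) (Suc k) = Some (T + t, q', d'')"
    using run[OF *(1,2)] by blast
  then show "0 < q' $ i" by (rule grid_control_payD[OF s \<phi>[OF *(1)] _ *(3)])
next
  fix \<omega> \<omega>' t k r q' d
  assume *: "\<omega> \<in> paths" "\<omega>' \<in> paths" "0 \<le> t" "same_history t \<omega> \<omega>'"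
    "grid_run M \<delta> q (\<lambda>\<omega> k. s (\<phi> \<omega>) (Suc k)) \<omega> k = Some (r, q', d)" "r \<le> t"
  obtain d'' where d: "grid_run M \<delta> m s (\<phi> \<omega>) (Suc k) = Some (T + r, q', d'')"
    using run[OF *(1,5)] by blast
  have "0 \<le> T + t" "T + r \<le> T + t" using * T by auto
  then show "s (\<phi> \<omega>) (Suc k) = s (\<phi> \<omega>') (Suc k)"
    using grid_control_historyD[OF s \<phi>[OF *(1)] \<phi>[OF *(2)] _ hist[OF *(4)] d] by blast
qed

context grid_model
begin

lemma grid_control_legal: "grid_control M \<delta> m s \<Longrightarrow> \<omega> \<in> paths \<Longrightarrow> legal m (s \<omega>) \<omega>"
  unfolding legal_def grid_run_eq_run[symmetric]
  by (intro allI impI, elim conjE) (rule grid_control_payD)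

end

section \<open>Attainable expectations and their comparison with the HJB solution\<close>

context grid_solution
begin

fun action_value :: "'n action \<Rightarrow> nat ^ 'n \<Rightarrow> real" where
  "action_value Wait q = wait_operator M \<delta> w q"
| "action_value (Pay i) q = pay_operator M \<delta> i w q"
| "action_value Switch q = switch_value M (gp q)"

definition greedy :: "nat ^ 'n \<Rightarrow> 'n control \<Rightarrow> bool" where
  "greedy m s \<longleftrightarrow> (\<forall>\<omega>\<in>paths. \<forall>k t q d. run m (s \<omega>) \<omega> k = Some (t, q, d) \<longrightarrow> action_value (s \<omega> k) q = w q)"

definition payoff :: "nat ^ 'n \<Rightarrow> 'n control \<Rightarrow> 'n path \<Rightarrow> real" where
  "payoff m s \<omega> = total (net_reward w) m (s \<omega>) \<omega>"

text \<open>The flag \<open>b\<close> runs the upper bound for arbitrary controls and the lower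
  bound for greedy ones through the same induction. Measurability is demanded of the payoff only,
  since that is what Fubini passes on to almost every continuation.\<close>

definition evaluates :: "bool \<Rightarrow> nat ^ 'n \<Rightarrow> 'n control \<Rightarrow> bool" where
  "evaluates b m s \<longleftrightarrow> grid_control M \<delta> m s \<and> payoff m s \<in> borel_measurable (path_measure M) \<and> (b \<longrightarrow> greedy m s)"

text \<open>A set of values instead of a supremum: after each first jump some element of the set for
  the landing point occurs, and a bound valid for all its elements avoids choosing these elements
  measurably.\<close>

definition payoffs :: "bool \<Rightarrow> nat ^ 'n \<Rightarrow> real set" where
  "payoffs b m = {\<integral>\<omega>. payoff m s \<omega> \<partial>path_measure M | s. evaluates b m s}"

lemma payoff_bound:
  assumes "grid_control M \<delta> m s" "\<omega> \<in> paths"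
  shows "ennreal \<bar>payoff m s \<omega>\<bar> \<le> ennreal ((3 * K + \<bar>w 0\<bar>) * h m) + path_loss \<omega>"
  unfolding payoff_def by (rule net_total(3)[OF assms(2) grid_control_legal[OF assms]])

definition payoff_const :: real where
  "payoff_const = 3 * K + \<bar>w 0\<bar> + enn2real (\<integral>\<^sup>+\<omega>. path_loss \<omega> \<partial>path_measure M)"

lemma payoff_const_nonneg: "0 \<le> payoff_const"
  using K_pos unfolding payoff_const_def by simp

lemma payoff_integrable:
  assumes "evaluates b m s"
  shows "integrable (path_measure M) (payoff m s)"
    and "\<bar>\<integral>\<omega>. payoff m s \<omega> \<partial>path_measure M\<bar> \<le> payoff_const * h m"
proof -
  interpret P: prob_space "path_measure M" by (rule prob_space_path_measure)
  have s: "grid_control M \<delta> m s" and [measurable]: "payoff m s \<in> borel_measurable (path_measure M)"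
    using assms by (auto simp: evaluates_def)
  let ?C = "(3 * K + \<bar>w 0\<bar>) * h m"
  let ?L = "\<integral>\<^sup>+\<omega>. path_loss \<omega> \<partial>path_measure M"
  have C: "0 \<le> ?C" using K_pos growth_weight_pos by (simp add: less_imp_le)
  have [measurable]: "path_loss \<in> borel_measurable (path_measure M)"
    unfolding path_measure_eq by (rule measurable_restrict_space1) (simp cong: measurable_cong_sets)
  have "(\<integral>\<^sup>+\<omega>. ennreal \<bar>payoff m s \<omega>\<bar> \<partial>path_measure M) \<le>
      (\<integral>\<^sup>+\<omega>. ennreal ?C + path_loss \<omega> \<partial>path_measure M)"
    by (intro nn_integral_mono payoff_bound[OF s]) simp
  also have "\<dots> = ennreal ?C + ?L" using P.emeasure_space_1 by (simp add: nn_integral_add)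
  also have "?L = ennreal (enn2real ?L)" using path_loss_finite by simp
  also have "ennreal ?C + ennreal (enn2real ?L) = ennreal (?C + enn2real ?L)"
    by (rule ennreal_plus[symmetric]) (simp_all add: C)
  finally have le: "(\<integral>\<^sup>+\<omega>. ennreal \<bar>payoff m s \<omega>\<bar> \<partial>path_measure M) \<le> ennreal (?C + enn2real ?L)" .
  show int: "integrable (path_measure M) (payoff m s)"
    by (rule integrableI_bounded) (use le in \<open>auto simp: le_less_trans\<close>)
  have "\<bar>\<integral>\<omega>. payoff m s \<omega> \<partial>path_measure M\<bar> \<le> (\<integral>\<omega>. \<bar>payoff m s \<omega>\<bar> \<partial>path_measure M)"
    by (rule integral_abs_bound)
  also have "\<dots> = enn2real (\<integral>\<^sup>+\<omega>. ennreal \<bar>payoff m s \<omega>\<bar> \<partial>path_measure M)"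
    by (rule integral_eq_nn_integral) auto
  also have "\<dots> \<le> ?C + enn2real ?L" using le C by (intro enn2real_leI) auto
  \<comment> \<open>Since \<open>h m\<close> is at least 1, the expected \<open>path_loss\<close>
    can be absorbed into a multiple of the growth weight.\<close>
  also have "\<dots> \<le> ?C + enn2real ?L * h m"
    using mult_left_mono[OF growth_weight_ge_1[OF grid_point_nonneg], of "enn2real ?L" m] by simp
  also have "\<dots> = payoff_const * h m" by (simp add: payoff_const_def algebra_simps)
  finally show "\<bar>\<integral>\<omega>. payoff m s \<omega> \<partial>path_measure M\<bar> \<le> payoff_const * h m" .
qed

lemma net_total_rec:
  assumes "grid_control M \<delta> m s" "\<omega> \<in> paths"
  shows "payoff m s \<omega> = net_reward w \<omega> (s \<omega> 0) 0 m + (case step \<omega> (s \<omega> 0) 0 m of None \<Rightarrow> 0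
    | Some (t, q, d) \<Rightarrow> exp (- discount M * t) * total (net_reward w) q (\<lambda>j. s \<omega> (Suc j)) (drop_path t \<omega>))"
  unfolding payoff_def
  by (rule total_rec[OF homogeneous_net_reward assms(2) grid_control_legal[OF assms]
        net_total(1)[OF assms(2) grid_control_legal[OF assms]]])

text \<open>The continuation of a control after its first action, when that action leads from a
  path \<open>\<phi> \<omega>\<close> to the remaining path \<open>\<omega>\<close>; the elapsed time and the new position do not depend
  on \<open>\<omega>\<close>.\<close>

lemma evaluates_continuation:
  assumes s: "grid_control M \<delta> m s" "b \<longrightarrow> greedy m s"
    and \<phi>: "\<And>\<omega>. \<omega> \<in> paths \<Longrightarrow> \<phi> \<omega> \<in> paths" "\<And>\<omega>. \<omega> \<in> paths \<Longrightarrow> drop_path T (\<phi> \<omega>) = \<omega>"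
    and meas: "(\<lambda>\<omega>. payoff m s (\<phi> \<omega>)) \<in> borel_measurable (path_measure M)"
    and step: "\<And>\<omega>. \<omega> \<in> paths \<Longrightarrow> step (\<phi> \<omega>) (s (\<phi> \<omega>) 0) 0 m = Some (T, q, d)"
    and net: "\<And>\<omega>. \<omega> \<in> paths \<Longrightarrow> net_reward w (\<phi> \<omega>) (s (\<phi> \<omega>) 0) 0 m = r"
    and hist: "\<And>r \<omega> \<omega>'. same_history r \<omega> \<omega>' \<Longrightarrow> same_history (T + r) (\<phi> \<omega>) (\<phi> \<omega>')"
    and T: "0 \<le> T"
  shows "evaluates b q (\<lambda>\<omega> k. s (\<phi> \<omega>) (Suc k))"
    and "(\<integral>\<omega>. payoff m s (\<phi> \<omega>) \<partial>path_measure M) =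
      r + exp (- discount M * T) * (\<integral>\<omega>. payoff q (\<lambda>\<omega> k. s (\<phi> \<omega>) (Suc k)) \<omega> \<partial>path_measure M)"
proof -
  interpret P: prob_space "path_measure M" by (rule prob_space_path_measure)
  let ?s = "\<lambda>\<omega> k. s (\<phi> \<omega>) (Suc k)"
  have shift: "run m (s (\<phi> \<omega>)) (\<phi> \<omega>) (Suc k) =
    map_option (\<lambda>(r, q', d'). (T + r, q', if k = 0 then d else d')) (run q (?s \<omega>) \<omega> k)"
    if "\<omega> \<in> paths" for \<omega> k
    using run_shift[where ds = "s (\<phi> \<omega>)", OF \<phi>(1)[OF that] step[OF that], of k] \<phi>(2)[OF that] by simp
  have rec: "payoff m s (\<phi> \<omega>) = r + exp (- discount M * T) * payoff q ?s \<omega>" if "\<omega> \<in> paths" for \<omega>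
    unfolding net_total_rec[OF s(1) \<phi>(1)[OF that]] step[OF that] net[OF that]
    by (simp add: payoff_def \<phi>(2)[OF that])
  have c: "grid_control M \<delta> q ?s"
  proof (rule embedded_grid_control[OF s(1) \<phi>(1) _ hist T])
    fix \<omega> :: "'n path" and k r q' d'
    assume *: "\<omega> \<in> paths" "grid_run M \<delta> q ?s \<omega> k = Some (r, q', d')"
    then show "\<exists>d''. grid_run M \<delta> m s (\<phi> \<omega>) (Suc k) = Some (T + r, q', d'')"
      using shift[OF *(1), of k] unfolding grid_run_eq_run[of m s "\<phi> \<omega>"] grid_run_eq_run[of q ?s \<omega>]
      by (simp del: grid_run.simps)
  qed
  have g: "greedy q ?s" if "greedy m s"
    unfolding greedy_def
  proof (intro ballI allI impI)
    fix \<omega> :: "'n path" and k r q' d'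
    assume *: "\<omega> \<in> paths" "run q (?s \<omega>) \<omega> k = Some (r, q', d')"
    then have "run m (s (\<phi> \<omega>)) (\<phi> \<omega>) (Suc k) = Some (T + r, q', if k = 0 then d else d')"
      using shift[OF *(1), of k] by simp
    then show "action_value (?s \<omega> k) q' = w q'"
      using that \<phi>(1)[OF *(1)] unfolding greedy_def by blast
  qed
  \<comment> \<open>The recursion \<open>rec\<close> solved for the continuation payoff, whose
    measurability is thus inherited from the original payoff along \<open>\<phi>\<close>.\<close>
  have "(\<lambda>\<omega>. exp (discount M * T) * (payoff m s (\<phi> \<omega>) - r)) \<in> borel_measurable (path_measure M)"
    using meas by measurable
  then have m: "payoff q ?s \<in> borel_measurable (path_measure M)"
  proof (rule measurable_cong[THEN iffD1, rotated])
    fix \<omega> assume "\<omega> \<in> space (path_measure M)"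
    then show "exp (discount M * T) * (payoff m s (\<phi> \<omega>) - r) = payoff q ?s \<omega>"
      using rec[of \<omega>] by (simp add: exp_minus field_simps)
  qed
  show e: "evaluates b q ?s" unfolding evaluates_def using c m g s(2) by blast
  have "(\<integral>\<omega>. payoff m s (\<phi> \<omega>) \<partial>path_measure M) = (\<integral>\<omega>. r + exp (- discount M * T) * payoff q ?s \<omega> \<partial>path_measure M)"
    by (intro Bochner_Integration.integral_cong) (simp_all add: rec)
  also have "\<dots> = r + exp (- discount M * T) * (\<integral>\<omega>. payoff q ?s \<omega> \<partial>path_measure M)"
    using payoff_integrable(1)[OF e] P.prob_space by simp
  finally show "(\<integral>\<omega>. payoff m s (\<phi> \<omega>) \<partial>path_measure M) =
      r + exp (- discount M * T) * (\<integral>\<omega>. payoff q ?s \<omega> \<partial>path_measure M)" .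
qed

text \<open>No jump has occurred at time 0, so by nonanticipation the first action is the same on
  all paths.\<close>

lemma same_history_0: "\<omega> \<in> paths \<Longrightarrow> \<omega>' \<in> paths \<Longrightarrow> same_history 0 \<omega> \<omega>'"
  unfolding same_history_def using paths_jump_time_pos by (metis not_le)

lemma next_0: "\<omega> \<in> paths \<Longrightarrow> next_time \<omega> 0 = jump_time \<omega> 0" "\<omega> \<in> paths \<Longrightarrow> next_size \<omega> 0 = jump_size \<omega> 0"
  by (simp_all add: next_time_def next_size_def jump_count_0)

text \<open>The renewal identity by type of the first action. When waiting, \<open>e\<close> is
  integrable as a whole although the continuation value \<open>v2\<close> is chosen separately for
  each jump; this is enough for integrating inequalities that hold for every possible
  \<open>v2\<close>.\<close>

lemma payoffs_cases:
  assumes v: "v \<in> payoffs b m"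
  obtains (switch) "v = w m"
  | (pay) i v' where "0 < m $ i" "v' \<in> payoffs b (m - axis i 1)"
      "v = v' + \<delta> * weight M $ i * premium M $ i" "b \<longrightarrow> pay_operator M \<delta> i w m = w m"
  | (wait) v1 e where "v1 \<in> payoffs b (m + 1)" "integrable step_law (\<lambda>x. indicator {..\<delta>} (fst x) * e x)"
      "v = v1 * exp (- (discount M + intensity M) * \<delta>) + (\<integral>x. indicator {..\<delta>} (fst x) * e x \<partial>step_law)"
      "AE x in step_law. fst x \<le> \<delta> \<longrightarrow> (let z = carried m (fst x); y = z - snd x in
         if 0 \<le> y then \<exists>v2\<in>payoffs b (gi y). e x = exp (- discount M * fst x) * (v2 + weight M \<bullet> (y - gf y))
         else e x = - exp (- discount M * fst x) * loss z (snd x))"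
      "b \<longrightarrow> wait_operator M \<delta> w m = w m"
proof -
  interpret P: prob_space "path_measure M" by (rule prob_space_path_measure)
  obtain s where ev: "evaluates b m s" and vs: "v = (\<integral>\<omega>. payoff m s \<omega> \<partial>path_measure M)"
    using v by (auto simp: payoffs_def)
  have s: "grid_control M \<delta> m s" "b \<longrightarrow> greedy m s" and
    [measurable]: "payoff m s \<in> borel_measurable (path_measure M)" using ev by (auto simp: evaluates_def)
  obtain \<omega>\<^sub>0 :: "'n path" where \<omega>\<^sub>0: "\<omega>\<^sub>0 \<in> paths" using P.not_empty by auto
  define a where "a = s \<omega>\<^sub>0 0"
  have a: "s \<omega> 0 = a" if "\<omega> \<in> paths" for \<omega>
  proof -
    have "grid_run M \<delta> m s \<omega>\<^sub>0 0 = Some (0, m, 0)" by simp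
    then have "s \<omega>\<^sub>0 0 = s \<omega> 0"
      using s(1) \<omega>\<^sub>0 that same_history_0[OF \<omega>\<^sub>0 that] unfolding grid_control_def by blast
    then show ?thesis by (simp add: a_def)
  qed
  have opt: "b \<longrightarrow> action_value a m = w m"
  proof
    assume b
    have "run m (s \<omega>\<^sub>0) \<omega>\<^sub>0 0 = Some (0, m, 0)" by simp
    then show "action_value a m = w m" using s(2) \<open>b\<close> \<omega>\<^sub>0 unfolding greedy_def a_def by blast
  qed
  show thesis
  proof (cases a)
    case Switch
    have "payoff m s \<omega> = w m" if "\<omega> \<in> paths" for \<omega>
      unfolding net_total_rec[OF s(1) that] a[OF that] Switch
      by (simp add: net_reward_def dividend_reward_def switch_reward_def ruin_reward_def)
    then have "v = (\<integral>\<omega>. w m \<partial>path_measure M)" unfolding vs by (intro Bochner_Integration.integral_cong) simp_all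
    then show thesis using P.prob_space by (intro switch) simp
  next
    case (Pay i)
    have i: "0 < m $ i"
      using legalD[OF grid_control_legal[OF s(1) \<omega>\<^sub>0], of 0] Pay by (simp add: a_def)
    have *: "evaluates b (m - axis i 1) (\<lambda>\<omega> k. s \<omega> (Suc k))"
      "(\<integral>\<omega>. payoff m s \<omega> \<partial>path_measure M) = \<delta> * weight M $ i * premium M $ i +
        exp (- discount M * 0) * (\<integral>\<omega>. payoff (m - axis i 1) (\<lambda>\<omega> k. s \<omega> (Suc k)) \<omega> \<partial>path_measure M)"
      by (rule evaluates_continuation[where \<phi> = "\<lambda>\<omega>. \<omega>" and T = 0 and d = "axis i (premium M $ i * \<delta>)", OF s];
        simp add: a Pay drop_path_0 net_reward_def dividend_reward_def switch_reward_def ruin_reward_def inner_axis)+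
    show thesis
      by (rule pay[OF i, of "\<integral>\<omega>. payoff (m - axis i 1) (\<lambda>\<omega> k. s \<omega> (Suc k)) \<omega> \<partial>path_measure M"])
        (use * opt Pay vs in \<open>auto simp: payoffs_def\<close>)
  next
    case Wait
    note int = payoff_integrable(1)[OF ev]
    obtain e where e: "integrable step_law e"
      "AE x in step_law. 0 < fst x \<and> 0 \<le> snd x \<and> integrable (path_measure M) (\<lambda>\<omega>. payoff m s (cons_path x \<omega>)) \<and>
       e x = (\<integral>\<omega>. payoff m s (cons_path x \<omega>) \<partial>path_measure M)"
      "integrable (path_measure M) (\<lambda>\<omega>. payoff m s (delay_path \<delta> \<omega>))"
      "(\<integral>\<omega>. payoff m s \<omega> \<partial>path_measure M) = exp (- intensity M * \<delta>) * (\<integral>\<omega>. payoff m s (delay_path \<delta> \<omega>) \<partial>path_measure M) +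
       (\<integral>x. indicator {..\<delta>} (fst x) * e x \<partial>step_law)"
      by (rule path_measure_renewal[OF int step_pos])
    let ?s = "\<lambda>\<omega> k. s (delay_path \<delta> \<omega>) (Suc k)"
    have dp: "delay_path \<delta> \<omega> \<in> paths" if "\<omega> \<in> paths" for \<omega> :: "'n path"
      using delay_path_in_paths[OF _ that] step_pos by simp
    have st: "step (delay_path \<delta> \<omega>) Wait 0 m = Some (\<delta>, m + 1, 0)" if "\<omega> \<in> paths" for \<omega>
      using paths_jump_time_pos[OF that, of 0]
      by (simp add: grid_step_Wait Let_def next_0[OF dp[OF that]]) (simp add: delay_path_def)
    have *: "evaluates b (m + 1) ?s"
      "(\<integral>\<omega>. payoff m s (delay_path \<delta> \<omega>) \<partial>path_measure M) = 0 +
        exp (- discount M * \<delta>) * (\<integral>\<omega>. payoff (m + 1) ?s \<omega> \<partial>path_measure M)"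
      by (rule evaluates_continuation[where \<phi> = "delay_path \<delta>" and T = \<delta> and d = 0, OF s];
        (use step_pos in \<open>simp add: a dp st Wait drop_delay_path net_reward_def dividend_reward_def
            switch_reward_def ruin_reward_def same_history_delay_path borel_measurable_integrable[OF e(3)]\<close>))+
    show thesis
    proof (rule wait)
      show "(\<integral>\<omega>. payoff (m + 1) ?s \<omega> \<partial>path_measure M) \<in> payoffs b (m + 1)" using *(1) by (auto simp: payoffs_def)
      show "integrable step_law (\<lambda>x. indicator {..\<delta>} (fst x) * e x)"
        by (rule Bochner_Integration.integrable_bound[OF e(1)]) (use e(1) in \<open>auto simp: indicator_def\<close>)
      have "exp (- (discount M + intensity M) * \<delta>) = exp (- intensity M * \<delta>) * exp (- discount M * \<delta>)"
        by (simp add: exp_add[symmetric] algebra_simps)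
      then have comb: "exp (- intensity M * \<delta>) * (exp (- discount M * \<delta>) * r) = r * exp (- (discount M + intensity M) * \<delta>)" for r
        by simp
      show "v = (\<integral>\<omega>. payoff (m + 1) ?s \<omega> \<partial>path_measure M) * exp (- (discount M + intensity M) * \<delta>) +
          (\<integral>x. indicator {..\<delta>} (fst x) * e x \<partial>step_law)"
        unfolding vs e(4) *(2) add_0_left comb ..
      show "b \<longrightarrow> wait_operator M \<delta> w m = w m" using opt Wait by simp
      show "AE x in step_law. fst x \<le> \<delta> \<longrightarrow> (let z = carried m (fst x); y = z - snd x in
         if 0 \<le> y then \<exists>v2\<in>payoffs b (gi y). e x = exp (- discount M * fst x) * (v2 + weight M \<bullet> (y - gf y))
         else e x = - exp (- discount M * fst x) * loss z (snd x))"
        using e(2)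
      proof eventually_elim
        case (elim x)
        define z where "z = carried m (fst x)"
        define y where "y = z - snd x"
        have x: "0 < fst x" "0 \<le> snd x" using elim by auto
        have cp: "cons_path x \<omega> \<in> paths" if "\<omega> \<in> paths" for \<omega> :: "'n path"
          using cons_path_in_paths_iff[OF x] that by simp
        have nx: "next_time (cons_path x \<omega>) 0 = fst x" "next_size (cons_path x \<omega>) 0 = snd x"
          if "\<omega> \<in> paths" for \<omega> :: "'n path"
          using next_0[OF cp[OF that]] by (simp_all add: cons_path_def)
        show ?case
        proof (intro impI)
          assume le: "fst x \<le> \<delta>"
          have "if 0 \<le> y then \<exists>v2\<in>payoffs b (gi y). e x = exp (- discount M * fst x) * (v2 + weight M \<bullet> (y - gf y))
            else e x = - exp (- discount M * fst x) * loss z (snd x)"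
          proof (cases "0 \<le> y")
            case True
            let ?s = "\<lambda>\<omega> k. s (cons_path x \<omega>) (Suc k)"
            have st: "step (cons_path x \<omega>) Wait 0 m = Some (fst x, gi y, y - gf y)" if "\<omega> \<in> paths" for \<omega>
              using le True by (simp add: grid_step_Wait Let_def nx[OF that] y_def z_def)
            have *: "evaluates b (gi y) ?s"
              "(\<integral>\<omega>. payoff m s (cons_path x \<omega>) \<partial>path_measure M) = exp (- discount M * fst x) * (weight M \<bullet> (y - gf y)) +
                exp (- discount M * fst x) * (\<integral>\<omega>. payoff (gi y) ?s \<omega> \<partial>path_measure M)"
              by (rule evaluates_continuation[where \<phi> = "cons_path x" and T = "fst x" and d = "y - gf y", OF s];
                (use elim in \<open>simp add: a cp st Wait drop_cons_path net_reward_def dividend_reward_def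
                    switch_reward_def ruin_reward_def same_history_cons_path borel_measurable_integrable\<close>))+
            have "e x = exp (- discount M * fst x) * ((\<integral>\<omega>. payoff (gi y) ?s \<omega> \<partial>path_measure M) + weight M \<bullet> (y - gf y))"
              using elim *(2) by (simp add: distrib_left)
            moreover have "(\<integral>\<omega>. payoff (gi y) ?s \<omega> \<partial>path_measure M) \<in> payoffs b (gi y)"
              using *(1) by (auto simp: payoffs_def)
            ultimately show ?thesis using True by auto
          next
            case False
            have st: "step (cons_path x \<omega>) Wait 0 m = None" if "\<omega> \<in> paths" for \<omega>
              using le False by (simp add: grid_step_Wait Let_def nx[OF that] y_def z_def)
            have rp: "(z, snd x) \<in> ruin_pairs"
              using ruin_step[OF cp[OF \<omega>\<^sub>0] st[OF \<omega>\<^sub>0]] by (simp add: nx[OF \<omega>\<^sub>0] z_def)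
            have "payoff m s (cons_path x \<omega>) = - exp (- discount M * fst x) * loss z (snd x)" if "\<omega> \<in> paths" for \<omega>
              unfolding net_total_rec[OF s(1) cp[OF that]] a[OF cp[OF that]] Wait st[OF that]
              using rp by (simp add: net_reward_def dividend_reward_def switch_reward_def ruin_reward_def
                  st[OF that] nx[OF that] loss_def z_def)
            then have "(\<integral>\<omega>. payoff m s (cons_path x \<omega>) \<partial>path_measure M) =
                (\<integral>\<omega>. - exp (- discount M * fst x) * loss z (snd x) \<partial>path_measure M)"
              by (intro Bochner_Integration.integral_cong) simp_all
            then show ?thesis using False elim P.prob_space by simp
          qed
          then show "let z = carried m (fst x); y = z - snd x in
            if 0 \<le> y then \<exists>v2\<in>payoffs b (gi y). e x = exp (- discount M * fst x) * (v2 + weight M \<bullet> (y - gf y))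
            else e x = - exp (- discount M * fst x) * loss z (snd x)"
            unfolding Let_def y_def z_def .
        qed
      qed
    qed
  qed
qed

text \<open>Two nested inductions. The outer one, on \<open>n\<close>, gains a factor
  \<open>contraction\<close> whenever the first action is \<open>Wait\<close>. The inner one, on the
  level, deals with payments: they gain no factor, but they lead to a smaller level and a smaller
  growth weight.\<close>

lemma payoffs_estimate:
  "\<forall>v\<in>payoffs b m. v \<le> w m + contraction ^ n * (2 * payoff_const) * h m \<and>
    (b \<longrightarrow> w m - contraction ^ n * (2 * payoff_const) * h m \<le> v)"
proof (induction n arbitrary: m)
  case 0
  \<comment> \<open>Both \<open>v\<close> and \<open>w m\<close> are within
    \<open>payoff_const * h m\<close> of zero, whence the factor 2 in the error term.\<close>
  have "\<bar>w m\<bar> \<le> payoff_const * h m"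
  proof -
    have "(K + \<bar>w 0\<bar>) * h m \<le> payoff_const * h m"
      using K_pos growth_weight_pos unfolding payoff_const_def
      by (intro mult_right_mono) (auto simp: less_imp_le)
    then show ?thesis using abs_w_le[of m] by linarith
  qed
  then show ?case using payoff_integrable(2) by (fastforce simp: payoffs_def)
next
  case (Suc n)
  define \<epsilon> where "\<epsilon> = contraction ^ n * (2 * payoff_const)"
  have \<epsilon>: "0 \<le> \<epsilon>" using contraction_bounds payoff_const_nonneg by (simp add: \<epsilon>_def)
  have \<epsilon>': "contraction ^ Suc n * (2 * payoff_const) = contraction * \<epsilon>" by (simp add: \<epsilon>_def)
  have IH: "v \<le> w q + \<epsilon> * h q" "b \<Longrightarrow> w q + (- \<epsilon>) * h q \<le> v" if "v \<in> payoffs b q" for v q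
    using Suc that unfolding \<epsilon>_def by fastforce+
  have land: "\<epsilon> * landing_weight m \<le> contraction * \<epsilon> * h m" for m
    using mult_left_mono[OF landing_weight_bounds(2)[of m] \<epsilon>] by (simp add: mult_ac)
  show ?case unfolding \<epsilon>'
  proof (induction "level m" arbitrary: m rule: less_induct)
    case less
    have H0: "0 \<le> contraction * \<epsilon> * h q" for q
      using \<epsilon> contraction_bounds growth_weight_pos by (simp add: less_imp_le)
    show ?case
    proof
      fix v assume "v \<in> payoffs b m"
      then show "v \<le> w m + contraction * \<epsilon> * h m \<and> (b \<longrightarrow> w m - contraction * \<epsilon> * h m \<le> v)"
      proof (cases rule: payoffs_cases)
        case switch
        then show ?thesis using H0[of m] by simp
      next
        case (pay i v')
        have "level (m - axis i 1) < level m" using level_diff_axis[OF pay(1)] by simp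
        note IH' = bspec[OF less[OF this] pay(2)]
        have hm: "contraction * \<epsilon> * h (m - axis i 1) \<le> contraction * \<epsilon> * h m"
        proof -
          have "gp (m - axis i 1) \<le> gp m"
            unfolding grid_point_diff_axis[OF pay(1)] using premium_pos[of i] step_pos
            by (simp add: less_eq_vec_def axis_def)
          then show ?thesis using \<epsilon> contraction_bounds
            by (intro mult_left_mono growth_weight_mono grid_point_nonneg) auto
        qed
        show ?thesis
          using IH' hm w_ge_pay[OF pay(1)] pay(3,4) unfolding pay_operator_def by auto
      next
        case (wait v1 e)
        let ?d = "exp (- (discount M + intensity M) * \<delta>)"
        have up: "AE x in step_law. indicator {..\<delta>} (fst x) * e x \<le>
          indicator {..\<delta>} (fst x) * wait_payoff (\<lambda>q. w q + \<epsilon> * h q) m x"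
          using wait(4)
        proof eventually_elim
          case (elim x)
          show ?case
          proof (cases "fst x \<le> \<delta>")
            case True
            then show ?thesis using elim IH(1)
              by (auto simp: wait_payoff_def Let_def intro!: mult_left_mono split: if_splits)
          qed simp
        qed
        have "v \<le> (w (m + 1) + \<epsilon> * h (m + 1)) * ?d +
            (\<integral>x. indicator {..\<delta>} (fst x) * wait_payoff (\<lambda>q. w q + \<epsilon> * h q) m x \<partial>step_law)"
          unfolding wait(3)
          by (intro add_mono mult_right_mono IH(1) wait(1) integral_mono_AE wait(2) integrable_wait_payoff up) simp
        \<comment> \<open>The error enters the waiting operator linearly and comes out multiplied by
          \<open>landing_weight\<close>, where the contraction takes effect.\<close>
        also have "\<dots> = wait_operator M \<delta> w m + \<epsilon> * landing_weight m"
          using wait_operator_perturb[of w \<epsilon> m] wait_operator_eq[of "\<lambda>q. w q + \<epsilon> * h q" m] by linarith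
        also have "\<dots> \<le> w m + contraction * \<epsilon> * h m" using w_ge_wait[of m] land[of m] by linarith
        finally have 1: "v \<le> w m + contraction * \<epsilon> * h m" .
        have "w m - contraction * \<epsilon> * h m \<le> v" if b
        proof -
          have lo: "AE x in step_law. indicator {..\<delta>} (fst x) * wait_payoff (\<lambda>q. w q + (- \<epsilon>) * h q) m x \<le>
            indicator {..\<delta>} (fst x) * e x"
            using wait(4)
          proof eventually_elim
            case (elim x)
            show ?case
            proof (cases "fst x \<le> \<delta>")
              case True
              then show ?thesis using elim IH(2)[OF _ that]
                by (auto simp: wait_payoff_def Let_def intro!: mult_left_mono split: if_splits)
            qed simp
          qed
          have "w m - contraction * \<epsilon> * h m \<le> wait_operator M \<delta> w m + (- \<epsilon>) * landing_weight m"
            using wait(5) that land[of m] by simp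
          also have "\<dots> = (w (m + 1) + (- \<epsilon>) * h (m + 1)) * ?d +
            (\<integral>x. indicator {..\<delta>} (fst x) * wait_payoff (\<lambda>q. w q + (- \<epsilon>) * h q) m x \<partial>step_law)"
            using wait_operator_perturb[of w "- \<epsilon>" m] wait_operator_eq[of "\<lambda>q. w q + (- \<epsilon>) * h q" m] by linarith
          also have "\<dots> \<le> v" unfolding wait(3)
            by (intro add_mono mult_right_mono IH(2) wait(1) integral_mono_AE wait(2) integrable_wait_payoff lo that) simp
          finally show ?thesis .
        qed
        then show ?thesis using 1 by blast
      qed
    qed
  qed
qed

lemma payoffs_limit:
  assumes "v \<in> payoffs b m" shows "v \<le> w m" and "b \<Longrightarrow> v = w m"
proof -
  let ?e = "\<lambda>n. contraction ^ n * (2 * payoff_const) * h m"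
  have lim: "?e \<longlonglongrightarrow> 0 * (2 * payoff_const) * h m"
    using contraction_bounds by (intro tendsto_intros LIMSEQ_power_zero) simp
  have "(\<lambda>n. w m + ?e n) \<longlonglongrightarrow> w m + 0 * (2 * payoff_const) * h m" by (intro tendsto_add tendsto_const lim)
  then show 1: "v \<le> w m"
    using payoffs_estimate assms by (intro LIMSEQ_le_const) auto
  assume b
  have "(\<lambda>n. w m - ?e n) \<longlonglongrightarrow> w m - 0 * (2 * payoff_const) * h m" by (intro tendsto_diff tendsto_const lim)
  then have "w m \<le> v"
    using payoffs_estimate[of b m] assms \<open>b\<close> by (intro LIMSEQ_le_const2) auto
  then show "v = w m" using 1 by simp
qed

end

section \<open>Dividends, switching and ruin along a path\<close>

context grid_model
begin

definition active :: "nat ^ 'n \<Rightarrow> (nat \<Rightarrow> 'n action) \<Rightarrow> 'n path \<Rightarrow> real \<Rightarrow> nat set" where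
  "active m ds \<omega> t = {k. \<exists>r q d. run m ds \<omega> k = Some (r, q, d) \<and> r \<le> t}"

text \<open>State \<open>k\<close> records the dividend of action \<open>k - 1\<close>, paid when
  state \<open>k\<close> is reached; for \<open>k = 0\<close> it is 0.\<close>

definition payment :: "nat ^ 'n \<Rightarrow> (nat \<Rightarrow> 'n action) \<Rightarrow> 'n path \<Rightarrow> nat \<Rightarrow> real ^ 'n" where
  "payment m ds \<omega> k = snd (snd (the (run m ds \<omega> k)))"

definition paid :: "nat ^ 'n \<Rightarrow> (nat \<Rightarrow> 'n action) \<Rightarrow> 'n path \<Rightarrow> real \<Rightarrow> real ^ 'n" where
  "paid m ds \<omega> t = (\<Sum>k\<in>active m ds \<omega> t. payment m ds \<omega> k)"

lemma grid_dividends_eq_paid: "grid_dividends M \<delta> m s t \<omega> = paid m (s \<omega>) \<omega> t"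
  unfolding grid_dividends_def paid_def active_def payment_def grid_run_eq_run[of m s \<omega>] ..

lemma final_stop:
  "(\<forall>k. run m ds \<omega> k \<noteq> None) \<or> (\<exists>k r q d. run m ds \<omega> k = Some (r, q, d) \<and> step \<omega> (ds k) r q = None)"
proof (rule disjCI)
  assume *: "\<not> (\<exists>k r q d. run m ds \<omega> k = Some (r, q, d) \<and> step \<omega> (ds k) r q = None)"
  show "\<forall>k. run m ds \<omega> k \<noteq> None"
  proof
    fix k show "run m ds \<omega> k \<noteq> None"
    proof (induction k)
      case (Suc k)
      then obtain z where "run m ds \<omega> k = Some z" by blast
      then obtain t q d where "run m ds \<omega> k = Some (t, q, d)" by (cases z) auto
      moreover then have "step \<omega> (ds k) t q \<noteq> None" using * by metis
      ultimately show ?case by simp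
    qed simp
  qed
qed

lemma active_iff: "run m ds \<omega> k = Some (r, q, d) \<Longrightarrow> k \<in> active m ds \<omega> t \<longleftrightarrow> r \<le> t"
  by (simp add: active_def)

context
  fixes m :: "nat ^ 'n" and ds :: "nat \<Rightarrow> 'n action" and \<omega> :: "'n path"
  assumes \<omega>: "\<omega> \<in> paths" and legal: "legal m ds \<omega>"
begin

lemma active_down: "k \<in> active m ds \<omega> t \<Longrightarrow> j \<le> k \<Longrightarrow> j \<in> active m ds \<omega> t"
proof -
  assume k: "k \<in> active m ds \<omega> t" and j: "j \<le> k"
  obtain r q d where r: "run m ds \<omega> k = Some (r, q, d)" "r \<le> t" using k by (auto simp: active_def)
  obtain z where "run m ds \<omega> j = Some z"
    using run_None_mono[OF _ j, of m ds \<omega>] r by (cases "run m ds \<omega> j") simp_all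
  then obtain r' q' d' where r': "run m ds \<omega> j = Some (r', q', d')" by (cases z) auto
  then show "j \<in> active m ds \<omega> t"
    using run_time_mono[OF \<omega> legal j r' r(1)] r(2) by (simp add: active_iff[OF r'])
qed

text \<open>The potential estimate \<open>run_SomeD\<close> bounds the number of actions applied by
  time \<open>t\<close>. Finiteness is essential, because a sum over an infinite index set would be
  0 by convention.\<close>

lemma finite_active: "finite (active m ds \<omega> t)"
proof -
  let ?B = "real (level m) + (real CARD('n) + 1) * (t / \<delta> + real (jump_count \<omega> t))"
  have "active m ds \<omega> t \<subseteq> {..nat \<lceil>?B\<rceil>}"
  proof
    fix k assume "k \<in> active m ds \<omega> t"
    then obtain r q d where r: "run m ds \<omega> k = Some (r, q, d)" "r \<le> t" by (auto simp: active_def)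
    have "real k \<le> real (level m) + (real CARD('n) + 1) * (r / \<delta> + real (jump_count \<omega> r))"
      using run_SomeD(3)[OF \<omega> legal r(1)] by linarith
    also have "\<dots> \<le> ?B"
      using r(2) step_pos jump_count_mono[OF \<omega> r(2)]
      by (intro add_mono mult_left_mono divide_right_mono) auto
    finally show "k \<in> {..nat \<lceil>?B\<rceil>}" by simp linarith
  qed
  then show ?thesis by (rule finite_subset) simp
qed

lemma active_mono: "t \<le> t' \<Longrightarrow> active m ds \<omega> t \<subseteq> active m ds \<omega> t'"
  by (auto simp: active_def intro: order_trans)

lemma payment_nonneg: "k \<in> active m ds \<omega> t \<Longrightarrow> 0 \<le> payment m ds \<omega> k"
  using run_SomeD(2)[OF \<omega> legal] by (auto simp: active_def payment_def)

lemma paid_nonneg: "0 \<le> paid m ds \<omega> t"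
  unfolding paid_def by (rule sum_nonneg) (rule payment_nonneg)

lemma paid_mono: "t \<le> t' \<Longrightarrow> paid m ds \<omega> t \<le> paid m ds \<omega> t'"
  unfolding paid_def using active_mono payment_nonneg by (intro sum_mono2 finite_active) auto

text \<open>The one-step balance of \<open>grid_step_SomeD\<close> telescopes. This ties the states
  of a run to the controlled surplus of the resulting strategy.\<close>

lemma run_surplus:
  "run m ds \<omega> k = Some (r, q, d) \<Longrightarrow> surplus M (gp m) r \<omega> - (\<Sum>i\<le>k. payment m ds \<omega> i) = gp q"
proof (induction k arbitrary: r q d)
  case 0
  then show ?case by (auto simp: surplus_def jump_count_0[OF \<omega>] payment_def)
next
  case (Suc k)
  from Suc.prems obtain r' q' d' where *: "run m ds \<omega> k = Some (r', q', d')"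
    "step \<omega> (ds k) r' q' = Some (r, q, d)" by (rule run_Suc_SomeE)
  have "payment m ds \<omega> (Suc k) = d" using Suc.prems by (simp add: payment_def del: grid_run.simps)
  then show ?case
    using Suc.IH[OF *(1)] grid_step_SomeD(3)[OF \<omega> *(2) legalD[OF legal *(1)], of "gp m"]
    by (simp add: algebra_simps)
qed

lemma current:
  assumes "0 \<le> t"
  obtains k r q d where "run m ds \<omega> k = Some (r, q, d)" "r \<le> t" "active m ds \<omega> t = {..k}"
    "\<forall>t' q' d'. run m ds \<omega> (Suc k) = Some (t', q', d') \<longrightarrow> t < t'"
proof -
  have 0: "0 \<in> active m ds \<omega> t" using assms by (simp add: active_def)
  define k where "k = Max (active m ds \<omega> t)"
  have k: "k \<in> active m ds \<omega> t" unfolding k_def using 0 finite_active by (intro Max_in) blast+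
  have eq: "active m ds \<omega> t = {..k}"
    using active_down[OF k] Max_ge[OF finite_active] unfolding k_def by auto
  obtain r q d where r: "run m ds \<omega> k = Some (r, q, d)" "r \<le> t" using k by (auto simp: active_def)
  have "t < t'" if *: "run m ds \<omega> (Suc k) = Some (t', q', d')" for t' q' d'
    using active_iff[OF *, of t] eq by simp
  then show ?thesis using that r eq by blast
qed

text \<open>The counterpart of \<open>current\<close> with strict inequality: a left limit at
  \<open>t\<close> sees only the actions applied before \<open>t\<close>, not payments made exactly
  at \<open>t\<close>.\<close>

lemma previous:
  assumes "0 < t"
  obtains k r q d where "run m ds \<omega> k = Some (r, q, d)" "r < t"
    "\<forall>u. r \<le> u \<and> u < t \<longrightarrow> active m ds \<omega> u = {..k}"
    "\<forall>t' q' d'. run m ds \<omega> (Suc k) = Some (t', q', d') \<longrightarrow> t \<le> t'"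
proof -
  let ?A = "{k. \<exists>r q d. run m ds \<omega> k = Some (r, q, d) \<and> r < t}"
  have 0: "0 \<in> ?A" using assms by simp
  have fin: "finite ?A" by (rule finite_subset[OF _ finite_active[of t]]) (auto simp: active_def)
  define k where "k = Max ?A"
  have k: "k \<in> ?A" unfolding k_def using 0 fin by (intro Max_in) blast+
  obtain r q d where r: "run m ds \<omega> k = Some (r, q, d)" "r < t" using k by auto
  have next1: "t \<le> t'" if *: "run m ds \<omega> (Suc k) = Some (t', q', d')" for t' q' d'
  proof (rule ccontr)
    assume "\<not> t \<le> t'"
    then have "Suc k \<in> ?A" using * by (auto simp del: grid_run.simps)
    then have "Suc k \<le> k" unfolding k_def by (rule Max_ge[OF fin])
    then show False by simp
  qed
  have "active m ds \<omega> u = {..k}" if u: "r \<le> u" "u < t" for u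
  proof -
    have "k \<in> active m ds \<omega> u" using r u by (simp add: active_iff[OF r(1)])
    moreover have "j \<le> k" if "j \<in> active m ds \<omega> u" for j
      unfolding k_def using that u by (intro Max_ge[OF fin]) (auto simp: active_def)
    ultimately show ?thesis using active_down by auto
  qed
  then show ?thesis using that r next1 by blast
qed

lemma paid_at_right:
  assumes "0 \<le> t" shows "eventually (\<lambda>u. paid m ds \<omega> u = paid m ds \<omega> t) (at_right t)"
proof -
  obtain k r q d where k: "run m ds \<omega> k = Some (r, q, d)" "r \<le> t" "active m ds \<omega> t = {..k}"
    "\<forall>t' q' d'. run m ds \<omega> (Suc k) = Some (t', q', d') \<longrightarrow> t < t'"
    by (rule current[OF assms])
  obtain b where b: "t < b" "\<And>t' q' d'. run m ds \<omega> (Suc k) = Some (t', q', d') \<Longrightarrow> b \<le> t'"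
  proof (cases "run m ds \<omega> (Suc k)")
    case None
    then show ?thesis using that[of "t + 1"] by (simp del: grid_run.simps)
  next
    case (Some z)
    then obtain t' q' d' where "run m ds \<omega> (Suc k) = Some (t', q', d')" by (cases z) auto
    then show ?thesis using that[of t'] k(4) by (simp del: grid_run.simps)
  qed
  have "paid m ds \<omega> u = paid m ds \<omega> t" if u: "t < u" "u < b" for u
  proof -
    have "Suc k \<notin> active m ds \<omega> u" using b(2) u by (fastforce simp: active_def simp del: grid_run.simps)
    then have "j \<le> k" if "j \<in> active m ds \<omega> u" for j
      using active_down[OF that, of "Suc k"] by (meson not_less_eq_eq)
    moreover have "{..k} \<subseteq> active m ds \<omega> u" using active_mono[of t u] k(3) u by auto
    ultimately have "active m ds \<omega> u = active m ds \<omega> t" using k(3) by auto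
    then show ?thesis by (simp add: paid_def)
  qed
  then show ?thesis unfolding eventually_at_right_field using b(1) by blast
qed

lemma paid_at_left:
  assumes "\<forall>u. r \<le> u \<and> u < t \<longrightarrow> active m ds \<omega> u = {..k}" "r < t"
  shows "eventually (\<lambda>u. paid m ds \<omega> u = (\<Sum>i\<le>k. payment m ds \<omega> i)) (at_left t)"
  unfolding eventually_at_left_field
  using assms by (intro exI[of _ r]) (auto simp: paid_def)

lemma left_limit_paid:
  assumes "\<forall>u. r \<le> u \<and> u < t \<longrightarrow> active m ds \<omega> u = {..k}" "r < t"
  shows "left_limit (paid m ds \<omega>) t = (\<Sum>i\<le>k. payment m ds \<omega> i)"
  unfolding left_limit_def
  by (rule tendsto_Lim[OF trivial_limit_at_left_real tendsto_eventually[OF paid_at_left[OF assms]]])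

lemma next_time_le: "r < jump_time \<omega> j \<Longrightarrow> next_time \<omega> r \<le> jump_time \<omega> j"
  unfolding next_time_def using jump_time_le_iff_jump_count[OF \<omega>, of j r] paths_jump_time_le_iff[OF \<omega>]
  by simp

text \<open>No action extends beyond the next jump. If the run continues after the jump, the action
  in force was therefore a \<open>Wait\<close> that ended exactly there with nonnegative surplus. So
  ruin can only come after the last action.\<close>

lemma surplus_jump_ok:
  assumes k: "run m ds \<omega> k = Some (r, q, d)" "r < jump_time \<omega> j"
    "\<forall>u. r \<le> u \<and> u < jump_time \<omega> j \<longrightarrow> active m ds \<omega> u = {..k}"
    and n: "run m ds \<omega> (Suc k) = Some (t', q', d')" "jump_time \<omega> j \<le> t'"
  shows "0 \<le> surplus M (gp m) (jump_time \<omega> j) \<omega> - left_limit (paid m ds \<omega>) (jump_time \<omega> j)"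
proof -
  have st: "step \<omega> (ds k) r q = Some (t', q', d')" using n(1) k(1) by simp
  have "t' \<le> next_time \<omega> r" by (rule grid_step_SomeD(4)[OF \<omega> st legalD[OF legal k(1)]])
  then have t': "t' = next_time \<omega> r" "jump_time \<omega> j = next_time \<omega> r" using next_time_le[OF k(2)] n(2) by auto
  have W: "ds k = Wait" using st t' k(2) by (cases "ds k") auto
  have "0 \<le> carried q (next_time \<omega> r - r) - next_size \<omega> r"
    using st W t' by (auto simp: grid_step_Wait Let_def split: if_splits)
  also have "\<dots> = surplus M (gp m) (next_time \<omega> r) \<omega> - (\<Sum>i\<le>k. payment m ds \<omega> i)"
    using surplus_Suc[OF \<omega>, of "gp m" r] run_surplus[OF k(1)] by (simp add: carried_def algebra_simps)
  finally show ?thesis unfolding left_limit_paid[OF k(3,2)] by (simp add: t'(2))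
qed

text \<open>The set may contain jumps long after the run has stopped, since the surplus keeps
  evolving without dividends; only its infimum, the ruin time, is used.\<close>

abbreviation "ruin_set \<equiv> {ennreal (jump_time \<omega> k) | k.
   \<not> 0 \<le> surplus M (gp m) (jump_time \<omega> k) \<omega> - left_limit (paid m ds \<omega>) (jump_time \<omega> k)}"

abbreviation "switch_set \<equiv> {ennreal t | t k q d. run m ds \<omega> k = Some (t, q, d) \<and> ds k = Switch}"

lemma last_unique:
  assumes "run m ds \<omega> k = Some z" "run m ds \<omega> (Suc k) = None"
    "run m ds \<omega> j = Some z'" "run m ds \<omega> (Suc j) = None"
  shows "j = k"
proof (rule ccontr)
  assume "j \<noteq> k"
  then have "Suc j \<le> k \<or> Suc k \<le> j" by linarith
  then show False
    using run_None_mono[OF assms(2), of j] run_None_mono[OF assms(4), of k] assms(1,3) by auto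
qed

lemma ruin_set_jump:
  assumes "x \<in> ruin_set"
  obtains j k r q d where "x = ennreal (jump_time \<omega> j)" "run m ds \<omega> k = Some (r, q, d)" "r < jump_time \<omega> j"
    "run m ds \<omega> (Suc k) = None"
proof -
  obtain j where j: "x = ennreal (jump_time \<omega> j)"
    "\<not> 0 \<le> surplus M (gp m) (jump_time \<omega> j) \<omega> - left_limit (paid m ds \<omega>) (jump_time \<omega> j)"
    using assms by blast
  obtain k r q d where k: "run m ds \<omega> k = Some (r, q, d)" "r < jump_time \<omega> j"
    "\<forall>u. r \<le> u \<and> u < jump_time \<omega> j \<longrightarrow> active m ds \<omega> u = {..k}"
    "\<forall>t' q' d'. run m ds \<omega> (Suc k) = Some (t', q', d') \<longrightarrow> jump_time \<omega> j \<le> t'"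
    by (rule previous[OF paths_jump_time_pos[OF \<omega>, of j]])
  have "run m ds \<omega> (Suc k) = None"
  proof (cases "run m ds \<omega> (Suc k)")
    case (Some z)
    then obtain t' q' d' where z: "run m ds \<omega> (Suc k) = Some (t', q', d')" by (cases z) auto
    from surplus_jump_ok[OF k(1,2,3) z k(4)[rule_format, OF z]] j(2) show ?thesis by blast
  qed
  then show ?thesis using that j(1) k(1,2) by blast
qed

end

text \<open>A run continues forever, ends in ruin or ends in a switch. After a switch the surplus
  may still become negative later, but not before the next jump, so the switch strictly precedes the
  ruin time.\<close>

lemma stopping_cases:
  assumes \<omega>: "\<omega> \<in> paths" and legal: "legal m ds \<omega>"
  obtains (never) "\<And>k. run m ds \<omega> k \<noteq> None" "Inf (switch_set m ds \<omega>) = \<infinity>" "Inf (ruin_set m ds \<omega>) = \<infinity>"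
  | (ruin) k r q d where "run m ds \<omega> k = Some (r, q, d)" "ds k = Wait" "step \<omega> Wait r q = None"
      "Inf (switch_set m ds \<omega>) = \<infinity>" "Inf (ruin_set m ds \<omega>) = ennreal (next_time \<omega> r)"
  | (switch) k r q d where "run m ds \<omega> k = Some (r, q, d)" "ds k = Switch"
      "Inf (switch_set m ds \<omega>) = ennreal r" "ennreal (next_time \<omega> r) \<le> Inf (ruin_set m ds \<omega>)"
proof -
  have switch_last: "run m ds \<omega> (Suc k) = None" if "run m ds \<omega> k = Some (r, q, d)" "ds k = Switch" for k r q d
    using that by simp
  consider "\<forall>k. run m ds \<omega> k \<noteq> None" | k r q d where "run m ds \<omega> k = Some (r, q, d)" "step \<omega> (ds k) r q = None"
    using final_stop[of m ds \<omega>] by blast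
  then show ?thesis
  proof cases
    case 1
    have R: "(ruin_set m ds \<omega>) = {}"
    proof (rule equals0I)
      fix x assume "x \<in> (ruin_set m ds \<omega>)"
      then obtain j k r q d where "run m ds \<omega> (Suc k) = None" by (rule ruin_set_jump[OF \<omega> legal])
      then show False using 1 by blast
    qed
    have S: "(switch_set m ds \<omega>) = {}" using switch_last 1 by blast
    show ?thesis
    proof (rule never)
      show "run m ds \<omega> k \<noteq> None" for k using 1 by blast
      show "Inf (switch_set m ds \<omega>) = \<infinity>" unfolding S by (simp add: infinity_ennreal_def)
      show "Inf (ruin_set m ds \<omega>) = \<infinity>" unfolding R by (simp add: infinity_ennreal_def)
    qed
  next
    case (2 k r q d)
    have nk: "run m ds \<omega> (Suc k) = None" using 2 by simp
    have jumps: "ennreal (next_time \<omega> r) \<le> x" if "x \<in> (ruin_set m ds \<omega>)" for x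
    proof -
      obtain j k' r' q' d' where j: "x = ennreal (jump_time \<omega> j)" "run m ds \<omega> k' = Some (r', q', d')"
        "r' < jump_time \<omega> j" "run m ds \<omega> (Suc k') = None"
        by (rule ruin_set_jump[OF \<omega> legal \<open>x \<in> (ruin_set m ds \<omega>)\<close>])
      have "k' = k" by (rule last_unique[OF \<omega> legal 2(1) nk j(2,4)])
      then have "r < jump_time \<omega> j" using j(2,3) 2(1) by simp
      then show ?thesis unfolding j(1) by (intro ennreal_leI next_time_le[OF \<omega> legal])
    qed
    then have le: "ennreal (next_time \<omega> r) \<le> Inf (ruin_set m ds \<omega>)" by (rule Inf_greatest)
    have only: "k' = k" if "run m ds \<omega> k' = Some (r', q', d')" "ds k' = Switch" for k' r' q' d'
      by (rule last_unique[OF \<omega> legal 2(1) nk that(1) switch_last[OF that]])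
    show ?thesis
    proof (cases "ds k")
      case Wait
      have "(switch_set m ds \<omega>) = {}" using only Wait by force
      then have T: "Inf (switch_set m ds \<omega>) = \<infinity>" by (simp only:) (simp add: infinity_ennreal_def)
      have r0: "r < next_time \<omega> r" by (rule next_time_less[OF \<omega>])
      have jt: "next_time \<omega> r = jump_time \<omega> (jump_count \<omega> r)" by (simp add: next_time_def)
      have act: "active m ds \<omega> u = {..k}" if "r \<le> u \<and> u < next_time \<omega> r" for u
      proof -
        have "k \<in> active m ds \<omega> u" using that by (simp add: active_iff[OF 2(1)])
        moreover have "j \<le> k" if "j \<in> active m ds \<omega> u" for j
        proof (rule ccontr)
          assume "\<not> j \<le> k"
          then have "run m ds \<omega> j = None" by (intro run_None_mono[OF nk]) simp
          then show False using that by (simp add: active_def)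
        qed
        ultimately show ?thesis using active_down[OF \<omega> legal] by auto
      qed
      have ll: "left_limit (paid m ds \<omega>) (next_time \<omega> r) = (\<Sum>i\<le>k. payment m ds \<omega> i)"
        by (rule left_limit_paid[OF \<omega> legal _ r0]) (use act in blast)
      have "surplus M (gp m) (next_time \<omega> r) \<omega> - left_limit (paid m ds \<omega>) (next_time \<omega> r) =
          carried q (next_time \<omega> r - r) - next_size \<omega> r"
        unfolding ll using surplus_Suc[OF \<omega>, of "gp m" r] run_surplus[OF \<omega> legal 2(1)] by (simp add: carried_def algebra_simps)
      moreover have "\<not> 0 \<le> carried q (next_time \<omega> r - r) - next_size \<omega> r"
        using 2(2) Wait by (auto simp: grid_step_Wait Let_def split: if_splits)
      ultimately have "\<not> 0 \<le> surplus M (gp m) (next_time \<omega> r) \<omega> - left_limit (paid m ds \<omega>) (next_time \<omega> r)"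
        by (simp only: not_False_eq_True)
      then have "ennreal (next_time \<omega> r) \<in> (ruin_set m ds \<omega>)"
        unfolding mem_Collect_eq jt by (intro exI[of _ "jump_count \<omega> r"] conjI refl)
      then have I: "Inf (ruin_set m ds \<omega>) = ennreal (next_time \<omega> r)" by (intro antisym Inf_lower le)
      show ?thesis by (rule ruin[OF 2(1) Wait _ T I]) (use 2(2) Wait in simp)
    next
      case (Pay i)
      then show ?thesis using 2(2) by simp
    next
      case Switch
      have "(switch_set m ds \<omega>) = {ennreal r}"
      proof (intro equalityI subsetI)
        fix x assume "x \<in> (switch_set m ds \<omega>)"
        then obtain t k' q' d' where *: "x = ennreal t" "run m ds \<omega> k' = Some (t, q', d')" "ds k' = Switch"
          by blast
        then have "k' = k" using only by blast
        then show "x \<in> {ennreal r}" using * 2(1) by simp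
      qed (use 2(1) Switch in blast)
      then have I: "Inf (switch_set m ds \<omega>) = ennreal r" by (simp only: cInf_singleton)
      show ?thesis by (rule switch[OF 2(1) Switch I le])
    qed
  qed
qed

lemma surplus_step:
  assumes "\<omega> \<in> paths" "s \<le> t" "jump_count \<omega> s = jump_count \<omega> t"
  shows "surplus M x t \<omega> = surplus M x s \<omega> + (t - s) *\<^sub>R premium M"
  using assms by (simp add: surplus_def algebra_simps)

text \<open>Without a jump since the last action, the controlled surplus is a grid point plus
  premiums. Otherwise it was nonnegative at the latest jump by \<open>before\<close>, and premiums
  have only raised it since.\<close>

lemma paid_le_surplus:
  assumes \<omega>: "\<omega> \<in> paths" and legal: "legal m ds \<omega>" and t: "0 \<le> t"
    and before: "\<And>j. jump_time \<omega> j \<le> t \<Longrightarrow>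
      0 \<le> surplus M (gp m) (jump_time \<omega> j) \<omega> - left_limit (paid m ds \<omega>) (jump_time \<omega> j)"
  shows "paid m ds \<omega> t \<le> surplus M (gp m) t \<omega>"
proof -
  obtain k r q d where k: "run m ds \<omega> k = Some (r, q, d)" "r \<le> t" "active m ds \<omega> t = {..k}"
    "\<forall>t' q' d'. run m ds \<omega> (Suc k) = Some (t', q', d') \<longrightarrow> t < t'"
    by (rule current[OF \<omega> legal t])
  have p: "paid m ds \<omega> t = (\<Sum>i\<le>k. payment m ds \<omega> i)" by (simp add: paid_def k(3))
  note s = run_surplus[OF \<omega> legal k(1)]
  show ?thesis
  proof (cases "jump_count \<omega> t = jump_count \<omega> r")
    case True
    have "surplus M (gp m) t \<omega> - paid m ds \<omega> t = carried q (t - r)"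
      using surplus_step[OF \<omega> k(2), of "gp m"] True s by (simp add: p carried_def algebra_simps)
    then show ?thesis using carried_nonneg[of "t - r" q] k(2) by (metis diff_ge_0_iff_ge)
  next
    case False
    then have jc: "jump_count \<omega> r < jump_count \<omega> t" using jump_count_mono[OF \<omega> k(2)] by simp
    define j where "j = jump_count \<omega> t - 1"
    let ?j = "jump_time \<omega> j"
    have j: "?j \<le> t" "r < ?j" using jump_time_le_iff_jump_count[OF \<omega>] jc
      by (auto simp: j_def not_le[symmetric])
    have cj: "jump_count \<omega> ?j = jump_count \<omega> t" using jc by (simp add: jump_count_jump_time[OF \<omega>] j_def)
    have act: "active m ds \<omega> u = {..k}" if "r \<le> u \<and> u < ?j" for u
    proof -
      have "k \<in> active m ds \<omega> u" using that by (simp add: active_iff[OF k(1)])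
      moreover have "active m ds \<omega> u \<subseteq> {..k}" using active_mono[OF \<omega> legal, of u t] that j k(3) by simp
      ultimately show ?thesis using active_down[OF \<omega> legal] by auto
    qed
    have "left_limit (paid m ds \<omega>) ?j = paid m ds \<omega> t"
      unfolding p using left_limit_paid[OF \<omega> legal _ j(2)] act by blast
    then have "paid m ds \<omega> t \<le> surplus M (gp m) ?j \<omega>" using before[OF j(1)] by simp
    also have "\<dots> \<le> surplus M (gp m) t \<omega>"
      using surplus_step[OF \<omega> j(1) cj, of "gp m"] j premium_pos by (simp add: less_eq_vec_def less_imp_le)
    finally show ?thesis .
  qed
qed

lemma ruin_time_grid:
  "ruin_time M x (grid_dividends M \<delta> m s) \<omega> = Inf {ennreal (jump_time \<omega> k) | k.
   \<not> 0 \<le> surplus M x (jump_time \<omega> k) \<omega> - left_limit (paid m (s \<omega>) \<omega>) (jump_time \<omega> k)}"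
  unfolding ruin_time_def grid_dividends_eq_paid ..

lemma grid_switch_time_eq:
  "grid_switch_time M \<delta> m s \<omega> = Inf {ennreal t | t k q d. run m (s \<omega>) \<omega> k = Some (t, q, d) \<and> s \<omega> k = Switch}"
  unfolding grid_switch_time_def grid_run_eq_run[of m s \<omega>] ..

lemma last_active:
  assumes \<omega>: "\<omega> \<in> paths" and legal: "legal m ds \<omega>"
    and k: "run m ds \<omega> k = Some (r, q, d)" "run m ds \<omega> (Suc k) = None" and t: "r \<le> t"
  shows "active m ds \<omega> t = {..k}"
proof -
  have "k \<in> active m ds \<omega> t" using t by (simp add: active_iff[OF k(1)])
  moreover have "j \<le> k" if "j \<in> active m ds \<omega> t" for j
  proof (rule ccontr)
    assume "\<not> j \<le> k"
    then have "run m ds \<omega> j = None" by (intro run_None_mono[OF k(2)]) simp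
    then show False using that by (simp add: active_def)
  qed
  ultimately show ?thesis using active_down[OF \<omega> legal] by auto
qed

text \<open>The pathwise half of admissibility, valid for every control; adaptedness is a separate
  matter.\<close>

lemma admissible_paths:
  assumes s: "grid_control M \<delta> m s" and \<omega>: "\<omega> \<in> paths"
  defines "L \<equiv> grid_dividends M \<delta> m s"
  shows "(\<forall>t\<ge>0. 0 \<le> L t \<omega>) \<and> mono_on {0..} (\<lambda>t. L t \<omega>) \<and>
    (\<forall>t\<ge>0. continuous (at_right t) (\<lambda>s. L s \<omega>)) \<and>
    (\<forall>t>0. \<exists>l. ((\<lambda>s. L s \<omega>) \<longlongrightarrow> l) (at_left t)) \<and>
    (\<forall>t\<ge>0. ennreal t < ruin_time M (gp m) L \<omega> \<longrightarrow> L t \<omega> \<le> surplus M (gp m) t \<omega>) \<and>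
    (\<forall>t\<ge>0. ruin_time M (gp m) L \<omega> \<le> ennreal t \<longrightarrow>
           L t \<omega> = left_limit (\<lambda>s. L s \<omega>) (enn2real (ruin_time M (gp m) L \<omega>)))"
proof -
  let ?d = "s \<omega>" and ?RT = "ruin_time M (gp m) L \<omega>"
  have legal: "legal m ?d \<omega>" using s \<omega> grid_control_legal by blast
  have Lp: "L t \<omega> = paid m ?d \<omega> t" for t unfolding L_def by (rule grid_dividends_eq_paid)
  have RT: "?RT = Inf {ennreal (jump_time \<omega> k) | k.
   \<not> 0 \<le> surplus M (gp m) (jump_time \<omega> k) \<omega> - left_limit (paid m ?d \<omega>) (jump_time \<omega> k)}"
    unfolding L_def by (rule ruin_time_grid)
  have 1: "paid m ?d \<omega> t \<le> surplus M (gp m) t \<omega>" if "0 \<le> t" "ennreal t < ?RT" for t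
  proof (rule paid_le_surplus[OF \<omega> legal that(1)])
    fix j assume j: "jump_time \<omega> j \<le> t"
    show "0 \<le> surplus M (gp m) (jump_time \<omega> j) \<omega> - left_limit (paid m ?d \<omega>) (jump_time \<omega> j)"
    proof (rule ccontr)
      assume "\<not> ?thesis"
      then have "?RT \<le> ennreal (jump_time \<omega> j)" unfolding RT by (intro Inf_lower) blast
      also have "\<dots> \<le> ennreal t" by (rule ennreal_leI[OF j])
      finally show False using that(2) by simp
    qed
  qed
  have 2: "paid m ?d \<omega> t = left_limit (paid m ?d \<omega>) (enn2real ?RT)" if t: "0 \<le> t" "?RT \<le> ennreal t" for t
  proof -
    \<comment> \<open>Nothing is paid after the last action, so the left limit at any later time
      equals the total paid.\<close>
    have stop: "paid m ?d \<omega> t = left_limit (paid m ?d \<omega>) \<rho>"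
      if k: "run m ?d \<omega> k = Some (r, q, d)" "run m ?d \<omega> (Suc k) = None" and \<rho>: "r < \<rho>" "\<rho> \<le> t" for k r q d \<rho>
    proof -
      have "left_limit (paid m ?d \<omega>) \<rho> = (\<Sum>i\<le>k. payment m ?d \<omega> i)"
        using last_active[OF \<omega> legal k] by (intro left_limit_paid[OF \<omega> legal _ \<rho>(1)]) auto
      moreover have "active m ?d \<omega> t = {..k}" using \<rho> by (intro last_active[OF \<omega> legal k]) simp
      ultimately show ?thesis by (simp add: paid_def)
    qed
    show ?thesis
      using \<omega> legal
    proof (cases rule: stopping_cases)
      case never
      have "?RT = \<infinity>" unfolding RT by (rule never(3))
      then show ?thesis using t(2) by (simp add: top_unique)
    next
      case (ruin k r q d)
      have r: "r < next_time \<omega> r" "0 \<le> r" using next_time_less[OF \<omega>] run_SomeD(1)[OF \<omega> legal ruin(1)] by auto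
      have RTr: "?RT = ennreal (next_time \<omega> r)" unfolding RT by (rule ruin(5))
      have "next_time \<omega> r \<le> t" using t unfolding RTr by simp
      moreover have "run m ?d \<omega> (Suc k) = None" using ruin(1,2,3) by simp
      moreover have "enn2real ?RT = next_time \<omega> r" using r RTr by simp
      ultimately show ?thesis using stop[OF ruin(1) _ r(1)] by simp
    next
      case (switch k r q d)
      have r: "r < next_time \<omega> r" "0 \<le> r" using next_time_less[OF \<omega>] run_SomeD(1)[OF \<omega> legal switch(1)] by auto
      have le: "ennreal (next_time \<omega> r) \<le> ?RT" unfolding RT by (rule switch(4))
      have "?RT < \<infinity>" using t(2) by (rule le_less_trans) simp
      then obtain \<rho> where \<rho>: "?RT = ennreal \<rho>" "0 \<le> \<rho>" by (cases ?RT) auto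
      have "next_time \<omega> r \<le> \<rho>" using le \<rho> by simp
      then have "r < \<rho>" using r by simp
      moreover have "\<rho> \<le> t" using t \<rho> by simp
      moreover have "run m ?d \<omega> (Suc k) = None" using switch(1,2) by simp
      moreover have "enn2real ?RT = \<rho>" using \<rho> by simp
      ultimately show ?thesis using stop[OF switch(1)] by simp
    qed
  qed
  have "continuous (at_right t) (\<lambda>s. L s \<omega>)" if "0 \<le> t" for t
    unfolding Lp continuous_within
    using paid_at_right[OF \<omega> legal that] by (rule tendsto_eventually)
  moreover have "\<exists>l. ((\<lambda>s. L s \<omega>) \<longlongrightarrow> l) (at_left t)" if t: "0 < t" for t
  proof -
    obtain k r q d where "r < t" "\<forall>u. r \<le> u \<and> u < t \<longrightarrow> active m ?d \<omega> u = {..k}"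
      by (rule previous[OF \<omega> legal t]) blast
    from tendsto_eventually[OF paid_at_left[OF \<omega> legal this(2,1)]] show ?thesis unfolding Lp by blast
  qed
  moreover have "mono_on {0..} (\<lambda>t. L t \<omega>)" unfolding Lp by (intro mono_onI paid_mono[OF \<omega> legal])
  moreover have "0 \<le> L t \<omega>" for t unfolding Lp by (rule paid_nonneg[OF \<omega> legal])
  ultimately show ?thesis using 1 2 unfolding Lp by (intro conjI allI impI) auto
qed

end

text \<open>Writing a discount factor as an integral over later times reduces integration by parts
  to an exchange of two nonnegative integrals.\<close>

lemma nn_integral_discount_tail:
  assumes "0 < c"
  shows "(\<integral>\<^sup>+u. ennreal (c * exp (- c * u)) * indicator {r..} u \<partial>lborel) = ennreal (exp (- c * r))"
proof -
  have lim: "((\<lambda>u. - exp (- c * u)) \<longlongrightarrow> - 0) at_top"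
  proof (intro tendsto_minus)
    have "filterlim (\<lambda>u. - c * u) at_bot at_top"
      using assms by (intro filterlim_tendsto_neg_mult_at_bot[OF tendsto_const _ filterlim_ident]) simp
    then show "((\<lambda>u. exp (- c * u)) \<longlongrightarrow> 0) at_top" by (rule filterlim_compose[OF exp_at_bot])
  qed
  have "(\<integral>\<^sup>+u. ennreal (c * exp (- c * u)) * indicator {r..} u \<partial>lborel) = ennreal (- 0 - - exp (- c * r))"
    by (rule nn_integral_FTC_atLeast[OF _ _ _ lim]) (use assms in \<open>auto intro!: derivative_eq_intros\<close>)
  then show ?thesis by simp
qed

text \<open>The discounted integral of a nondecreasing right continuous function that is constant from
  \<open>\<theta>\<close> on, after integration by parts.\<close>

lemma nn_integral_interval_measure_discounted:
  fixes F :: "real \<Rightarrow> real"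
  assumes c: "0 < c" and mono: "\<And>x y. x \<le> y \<Longrightarrow> F x \<le> F y" and cont: "\<And>a. continuous (at_right a) F"
    and const: "\<And>u. 0 \<le> u \<Longrightarrow> \<theta> \<le> ennreal u \<Longrightarrow> F u = F (enn2real \<theta>)"
  shows "(\<integral>\<^sup>+s. indicator {s. 0 < s \<and> ennreal s \<le> \<theta>} s * ennreal (exp (- c * s)) \<partial>interval_measure F) =
    (\<integral>\<^sup>+u. ennreal (c * exp (- c * u)) * (indicator {0..} u * ennreal (F u - F 0)) \<partial>lborel)"
proof -
  let ?\<mu> = "interval_measure F" and ?S = "{s. 0 < s \<and> ennreal s \<le> \<theta>}"
  interpret I: sigma_finite_measure ?\<mu> by (rule sigma_finite_interval_measure) (use mono cont in auto)
  interpret P: pair_sigma_finite ?\<mu> lborel ..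
  have S[measurable]: "?S \<in> sets borel" by measurable
  \<comment> \<open>Since \<open>F\<close> is constant from \<open>\<theta>\<close> on, cutting the
    mass off at \<open>\<theta>\<close> loses nothing: up to time \<open>u\<close> it is the full
    increment of \<open>F\<close>.\<close>
  have meas: "emeasure ?\<mu> (?S \<inter> {..u}) = indicator {0..} u * ennreal (F u - F 0)" for u
  proof (cases "0 \<le> u")
    case False
    then have "?S \<inter> {..u} = {}" by auto
    then show ?thesis using False by simp
  next
    case True
    define b where "b = (if ennreal u \<le> \<theta> then u else enn2real \<theta>)"
    have fin: "\<theta> = ennreal (enn2real \<theta>)" if "\<not> ennreal u \<le> \<theta>"
    proof -
      have "\<theta> < \<infinity>" using that by (metis ennreal_less_top infinity_ennreal_def less_trans not_le)
      then show ?thesis by simp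
    qed
    have "?S \<inter> {..u} = {0<..b}"
    proof (cases "ennreal u \<le> \<theta>")
      case T: True
      have "ennreal s \<le> \<theta>" if "s \<le> u" for s using T ennreal_leI[OF that] by (rule order_trans[rotated])
      then show ?thesis using T by (auto simp: b_def)
    next
      case F: False
      obtain z where z: "\<theta> = ennreal z" "0 \<le> z" using fin[OF F] by (metis enn2real_nonneg)
      have "z < u" using F z True by (simp add: not_le ennreal_less_iff)
      then show ?thesis using F z by (auto simp: b_def ennreal_le_iff)
    qed
    moreover have "0 \<le> b" using True by (simp add: b_def)
    moreover have "F b = F u" using const[OF True] by (simp add: b_def)
    ultimately show ?thesis using True mono cont by (simp add: emeasure_interval_measure_Ioc)
  qed
  have "(\<integral>\<^sup>+s. indicator ?S s * ennreal (exp (- c * s)) \<partial>?\<mu>) =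
    (\<integral>\<^sup>+s. \<integral>\<^sup>+u. indicator ?S s * (ennreal (c * exp (- c * u)) * indicator {s..} u) \<partial>lborel \<partial>?\<mu>)"
    by (simp add: nn_integral_cmult nn_integral_discount_tail[OF c, simplified])
  \<comment> \<open>This exchange of integrals is the integration by parts.\<close>
  also have "\<dots> = (\<integral>\<^sup>+u. \<integral>\<^sup>+s. indicator ?S s * (ennreal (c * exp (- c * u)) * indicator {s..} u) \<partial>?\<mu> \<partial>lborel)"
    by (rule P.Fubini'[symmetric]) (simp add: split_beta' indicator_def cong: measurable_cong_sets)
  also have "\<dots> = (\<integral>\<^sup>+u. \<integral>\<^sup>+s. ennreal (c * exp (- c * u)) * indicator (?S \<inter> {..u}) s \<partial>?\<mu> \<partial>lborel)"
    by (intro nn_integral_cong) (auto simp: indicator_def)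
  also have "\<dots> = (\<integral>\<^sup>+u. ennreal (c * exp (- c * u)) * (indicator {0..} u * ennreal (F u - F 0)) \<partial>lborel)"
    by (subst nn_integral_cmult_indicator) (simp_all add: meas)
  finally show ?thesis .
qed

section \<open>The components of the strategy value as totals along the run\<close>

context grid_model
begin

lemma stopped_value:
  assumes \<omega>: "\<omega> \<in> paths" and legal: "legal m ds \<omega>"
    and k: "run m ds \<omega> k = Some (r, q, d)" "step \<omega> (ds k) r q = None"
    and X: "\<forall>\<omega> a t q. step \<omega> a t q \<noteq> None \<longrightarrow> X \<omega> a t q = 0"
  shows "total X m ds \<omega> = X \<omega> (ds k) r q"
proof -
  have nk: "run m ds \<omega> (Suc k) = None" using k by simp
  have "reward_term X m ds \<omega> j = 0" if "j \<noteq> k" for j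
  proof (cases "run m ds \<omega> j")
    case None
    then show ?thesis by (simp add: reward_term_def)
  next
    case (Some z)
    then obtain r' q' d' where z: "run m ds \<omega> j = Some (r', q', d')" by (cases z) auto
    have "run m ds \<omega> (Suc j) \<noteq> None" using last_unique[OF \<omega> legal k(1) nk z] that by blast
    then have "step \<omega> (ds j) r' q' \<noteq> None" using z by simp
    then have "X \<omega> (ds j) r' q' = 0" using X by blast
    then show ?thesis by (simp add: reward_term_def z)
  qed
  then have "reward_term X m ds \<omega> sums reward_term X m ds \<omega> k"
    by (intro sums_finite[of "{k}", simplified]) auto
  moreover have "reward_term X m ds \<omega> k = X \<omega> (ds k) r q" by (simp add: reward_term_def k(1))
  ultimately show ?thesis by (simp add: total_def sums_iff)
qed

lemma never_stopped_value:
  assumes "\<And>k. run m ds \<omega> k \<noteq> None" "\<forall>\<omega> a t q. step \<omega> a t q \<noteq> None \<longrightarrow> X \<omega> a t q = 0"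
  shows "total X m ds \<omega> = 0"
proof -
  have "reward_term X m ds \<omega> k = 0" for k
  proof -
    obtain z where z: "run m ds \<omega> k = Some z" using assms(1)[of k] by blast
    then obtain r q d where r: "run m ds \<omega> k = Some (r, q, d)" by (cases z) auto
    have "step \<omega> (ds k) r q \<noteq> None" using assms(1)[of "Suc k"] r by auto
    then have "X \<omega> (ds k) r q = 0" using assms(2) by blast
    then show ?thesis by (simp add: reward_term_def r)
  qed
  then show ?thesis by (simp add: total_def)
qed

lemma switch_reward_vanishes: "\<forall>\<omega> a t q. step \<omega> a t q \<noteq> None \<longrightarrow> switch_reward \<kappa> \<omega> a t q = 0"
  by (auto simp: switch_reward_def)

lemma ruin_reward_vanishes: "\<forall>\<omega> a t q. step \<omega> a t q \<noteq> None \<longrightarrow> ruin_reward \<omega> a t q = 0"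
  by (auto simp: ruin_reward_def)

text \<open>Stated for an arbitrary function \<open>\<phi>\<close> of the surplus: the switch value
  gives the strategy value, and \<open>w\<close> composed with the grid index gives
  measurability.\<close>

lemma switch_part:
  assumes s: "grid_control M \<delta> m s" and \<omega>: "\<omega> \<in> paths"
  defines "L \<equiv> grid_dividends M \<delta> m s" and "T \<equiv> grid_switch_time M \<delta> m s"
  shows "(if T \<omega> < ruin_time M (gp m) L \<omega>
        then exp (- discount M * enn2real (T \<omega>)) * \<phi> (controlled_surplus M (gp m) L (enn2real (T \<omega>)) \<omega>)
        else 0) = total (switch_reward (\<lambda>q. \<phi> (gp q))) m (s \<omega>) \<omega>"
    and "T \<omega> < ruin_time M (gp m) L \<omega> \<longleftrightarrow> T \<omega> < \<infinity>"
proof -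
  have legal: "legal m (s \<omega>) \<omega>" using s \<omega> by (rule grid_control_legal)
  have T: "T \<omega> = Inf (switch_set m (s \<omega>) \<omega>)" unfolding T_def by (rule grid_switch_time_eq)
  have R: "ruin_time M (gp m) L \<omega> = Inf (ruin_set m (s \<omega>) \<omega>)" unfolding L_def by (rule ruin_time_grid)
  have "(if T \<omega> < ruin_time M (gp m) L \<omega>
        then exp (- discount M * enn2real (T \<omega>)) * \<phi> (controlled_surplus M (gp m) L (enn2real (T \<omega>)) \<omega>)
        else 0) = total (switch_reward (\<lambda>q. \<phi> (gp q))) m (s \<omega>) \<omega> \<and>
      (T \<omega> < ruin_time M (gp m) L \<omega> \<longleftrightarrow> T \<omega> < \<infinity>)"
    using \<omega> legal
  proof (cases rule: stopping_cases)
    case never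
    have "T \<omega> = \<infinity>" unfolding T by (rule never(2))
    then show ?thesis using never_stopped_value[where X = "switch_reward (\<lambda>q. \<phi> (gp q))", OF never(1) switch_reward_vanishes] by simp
  next
    case (ruin k r q d)
    have "T \<omega> = \<infinity>" unfolding T by (rule ruin(4))
    moreover have "step \<omega> (s \<omega> k) r q = None" using ruin(2,3) by simp
    ultimately show ?thesis
      using stopped_value[where X = "switch_reward (\<lambda>q. \<phi> (gp q))", OF \<omega> legal ruin(1) _ switch_reward_vanishes] ruin(2)
      by (simp add: switch_reward_def)
  next
    case (switch k r q d)
    have r: "0 \<le> r" using run_SomeD(1)[OF \<omega> legal switch(1)] .
    have Tr: "T \<omega> = ennreal r" unfolding T by (rule switch(3))
    have "ennreal r < ennreal (next_time \<omega> r)" using next_time_less[OF \<omega>, of r] r by (simp add: ennreal_less_iff)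
    also have "\<dots> \<le> ruin_time M (gp m) L \<omega>" unfolding R by (rule switch(4))
    finally have lt: "T \<omega> < ruin_time M (gp m) L \<omega>" unfolding Tr .
    have nk: "run m (s \<omega>) \<omega> (Suc k) = None" using switch(1,2) by simp
    have "paid m (s \<omega>) \<omega> r = (\<Sum>i\<le>k. payment m (s \<omega>) \<omega> i)"
      unfolding paid_def last_active[OF \<omega> legal switch(1) nk order_refl] ..
    then have "controlled_surplus M (gp m) L r \<omega> = gp q"
      using run_surplus[OF \<omega> legal switch(1)]
      by (simp add: controlled_surplus_def L_def grid_dividends_eq_paid)
    moreover have "step \<omega> (s \<omega> k) r q = None" using switch(2) by simp
    ultimately show ?thesis
      using stopped_value[where X = "switch_reward (\<lambda>q. \<phi> (gp q))", OF \<omega> legal switch(1) _ switch_reward_vanishes] switch(2) lt Tr r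
      by (simp add: switch_reward_def)
  qed
  then show "(if T \<omega> < ruin_time M (gp m) L \<omega>
        then exp (- discount M * enn2real (T \<omega>)) * \<phi> (controlled_surplus M (gp m) L (enn2real (T \<omega>)) \<omega>)
        else 0) = total (switch_reward (\<lambda>q. \<phi> (gp q))) m (s \<omega>) \<omega>"
    and "T \<omega> < ruin_time M (gp m) L \<omega> \<longleftrightarrow> T \<omega> < \<infinity>" by blast+
qed

lemma controlled_left_limit:
  assumes s: "grid_control M \<delta> m s" and \<omega>: "\<omega> \<in> paths"
    and k: "run m (s \<omega>) \<omega> k = Some (r, q, d)" "run m (s \<omega>) \<omega> (Suc k) = None"
  defines "L \<equiv> grid_dividends M \<delta> m s" and "\<rho> \<equiv> next_time \<omega> r"
  shows "((\<lambda>u. controlled_surplus M (gp m) L u \<omega>) \<longlongrightarrow> carried q (\<rho> - r)) (at_left \<rho>)"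
    and "carried q (\<rho> - r) - controlled_surplus M (gp m) L \<rho> \<omega> = next_size \<omega> r"
proof -
  have legal: "legal m (s \<omega>) \<omega>" using s \<omega> by (rule grid_control_legal)
  have r: "r < \<rho>" unfolding \<rho>_def by (rule next_time_less[OF \<omega>])
  have act: "active m (s \<omega>) \<omega> u = {..k}" if "r \<le> u" for u by (rule last_active[OF \<omega> legal k that])
  note rs = run_surplus[OF \<omega> legal k(1)]
  have "controlled_surplus M (gp m) L u \<omega> = carried q (u - r)" if "r \<le> u" "u < \<rho>" for u
    using surplus_before_next[OF \<omega> that(1), of "gp m"] that(2) rs act[OF that(1)]
    by (simp add: controlled_surplus_def L_def grid_dividends_eq_paid \<rho>_def paid_def carried_def algebra_simps)
  then have ev: "eventually (\<lambda>u. carried q (u - r) = controlled_surplus M (gp m) L u \<omega>) (at_left \<rho>)"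
    unfolding eventually_at_left_field using r by (intro exI[of _ r]) auto
  have "((\<lambda>u. carried q (u - r)) \<longlongrightarrow> carried q (\<rho> - r)) (at_left \<rho>)"
    unfolding carried_def by (intro tendsto_intros)
  then show "((\<lambda>u. controlled_surplus M (gp m) L u \<omega>) \<longlongrightarrow> carried q (\<rho> - r)) (at_left \<rho>)"
    by (rule Lim_transform_eventually[OF _ ev])
  show "carried q (\<rho> - r) - controlled_surplus M (gp m) L \<rho> \<omega> = next_size \<omega> r"
    using surplus_Suc[OF \<omega>, of "gp m" r] rs act[of \<rho>] r
    by (simp add: controlled_surplus_def L_def grid_dividends_eq_paid \<rho>_def[symmetric] paid_def carried_def algebra_simps)
qed

text \<open>Two readings of the same quantity: the first is the form used in
  \<open>strategy_value\<close>, the second uses a limit along a sequence and the Borel function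
  \<open>loss\<close>, so that its measurability in \<open>\<omega>\<close> can be checked.\<close>

lemma ruin_part:
  assumes s: "grid_control M \<delta> m s" and \<omega>: "\<omega> \<in> paths"
  defines "L \<equiv> grid_dividends M \<delta> m s" and "T \<equiv> grid_switch_time M \<delta> m s"
  shows "(if ruin_time M (gp m) L \<omega> \<le> T \<omega> \<and> ruin_time M (gp m) L \<omega> < \<infinity>
        then let r = enn2real (ruin_time M (gp m) L \<omega>);
                 z = left_limit (\<lambda>s. controlled_surplus M (gp m) L s \<omega>) r
             in exp (- discount M * r) * penalty M z (z - controlled_surplus M (gp m) L r \<omega>)
        else 0) = total ruin_reward m (s \<omega>) \<omega>" (is ?A)
    and "(if ruin_time M (gp m) L \<omega> \<le> T \<omega> \<and> ruin_time M (gp m) L \<omega> < \<infinity>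
        then let r = enn2real (ruin_time M (gp m) L \<omega>);
                 z = lim (\<lambda>n. controlled_surplus M (gp m) L (r - 1 / real (Suc n)) \<omega>)
             in exp (- discount M * r) * loss z (z - controlled_surplus M (gp m) L r \<omega>)
        else 0) = total ruin_reward m (s \<omega>) \<omega>" (is ?B)
proof -
  have legal: "legal m (s \<omega>) \<omega>" using s \<omega> by (rule grid_control_legal)
  have T: "T \<omega> = Inf (switch_set m (s \<omega>) \<omega>)" unfolding T_def by (rule grid_switch_time_eq)
  have R: "ruin_time M (gp m) L \<omega> = Inf (ruin_set m (s \<omega>) \<omega>)" unfolding L_def by (rule ruin_time_grid)
  have "?A \<and> ?B"
    using \<omega> legal
  proof (cases rule: stopping_cases)
    case never
    have "ruin_time M (gp m) L \<omega> = \<infinity>" unfolding R by (rule never(3))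
    then show ?thesis using never_stopped_value[where X = ruin_reward, OF never(1) ruin_reward_vanishes] by simp
  next
    case (ruin k r q d)
    let ?\<rho> = "next_time \<omega> r"
    have \<rho>: "r < ?\<rho>" "0 < ?\<rho>"
      using next_time_less[OF \<omega>, of r] run_SomeD(1)[OF \<omega> legal ruin(1)] by auto
    have Ti: "T \<omega> = \<infinity>" unfolding T by (rule ruin(4))
    have Ri: "ruin_time M (gp m) L \<omega> = ennreal ?\<rho>" unfolding R by (rule ruin(5))
    have st: "step \<omega> (s \<omega> k) r q = None" using ruin(2,3) by simp
    have nk: "run m (s \<omega>) \<omega> (Suc k) = None" using ruin(1) st by simp
    note cl = controlled_left_limit[OF s \<omega> ruin(1) nk, folded L_def]
    have ll: "left_limit (\<lambda>s. controlled_surplus M (gp m) L s \<omega>) ?\<rho> = carried q (?\<rho> - r)"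
      unfolding left_limit_def by (rule tendsto_Lim[OF trivial_limit_at_left_real cl(1)])
    have "filterlim (\<lambda>n. ?\<rho> - 1 / real (Suc n)) (at_left ?\<rho>) sequentially"
      unfolding filterlim_at
    proof
      have "(\<lambda>n. ?\<rho> - 1 / real (Suc n)) \<longlonglongrightarrow> ?\<rho> - 0"
        by (intro tendsto_diff tendsto_const LIMSEQ_Suc[OF lim_1_over_n])
      then show "(\<lambda>n. ?\<rho> - 1 / real (Suc n)) \<longlonglongrightarrow> ?\<rho>" by simp
    qed simp
    then have "(\<lambda>n. controlled_surplus M (gp m) L (?\<rho> - 1 / real (Suc n)) \<omega>) \<longlonglongrightarrow> carried q (?\<rho> - r)"
      by (rule filterlim_compose[OF cl(1)])
    then have li: "lim (\<lambda>n. controlled_surplus M (gp m) L (?\<rho> - 1 / real (Suc n)) \<omega>) = carried q (?\<rho> - r)"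
      by (rule limI)
    have rp: "(carried q (?\<rho> - r), next_size \<omega> r) \<in> ruin_pairs"
    proof -
      have "\<not> 0 \<le> carried q (?\<rho> - r) - next_size \<omega> r"
        using ruin(3) by (auto simp: grid_step_Wait Let_def split: if_splits)
      then show ?thesis using carried_nonneg[of "?\<rho> - r" q] \<rho> next_size_nonneg[OF \<omega>] by (auto simp: ruin_pairs_def)
    qed
    have "total ruin_reward m (s \<omega>) \<omega> = exp (- discount M * ?\<rho>) * penalty M (carried q (?\<rho> - r)) (next_size \<omega> r)"
      using stopped_value[where X = ruin_reward, OF \<omega> legal ruin(1) st ruin_reward_vanishes] ruin(2,3) by (simp add: ruin_reward_def)
    moreover have "enn2real (ruin_time M (gp m) L \<omega>) = ?\<rho>" using \<rho> Ri by simp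
    moreover have "ruin_time M (gp m) L \<omega> \<le> T \<omega> \<and> ruin_time M (gp m) L \<omega> < \<infinity>" by (simp add: Ri Ti)
    ultimately show ?thesis
      unfolding Let_def by (simp only: if_True simp_thms ll li cl(2) loss_def rp)
  next
    case (switch k r q d)
    have r: "0 \<le> r" using run_SomeD(1)[OF \<omega> legal switch(1)] .
    have Tr: "T \<omega> = ennreal r" unfolding T by (rule switch(3))
    have "ennreal r < ennreal (next_time \<omega> r)" using next_time_less[OF \<omega>, of r] r by (simp add: ennreal_less_iff)
    also have "\<dots> \<le> ruin_time M (gp m) L \<omega>" unfolding R by (rule switch(4))
    finally have "\<not> ruin_time M (gp m) L \<omega> \<le> T \<omega>" unfolding Tr by simp
    moreover have "step \<omega> (s \<omega> k) r q = None" using switch(2) by simp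
    ultimately show ?thesis
      using stopped_value[where X = ruin_reward, OF \<omega> legal switch(1) _ ruin_reward_vanishes] switch(2) by (simp add: ruin_reward_def)
  qed
  then show ?A ?B by blast+
qed

text \<open>Supplies the constancy from the stopping time on that the integration by parts requires
  of its integrator.\<close>

lemma paid_const_after:
  assumes s: "grid_control M \<delta> m s" and \<omega>: "\<omega> \<in> paths"
  defines "\<theta> \<equiv> min (grid_switch_time M \<delta> m s \<omega>) (ruin_time M (gp m) (grid_dividends M \<delta> m s) \<omega>)"
  assumes u: "0 \<le> u" "\<theta> \<le> ennreal u"
  shows "paid m (s \<omega>) \<omega> u = paid m (s \<omega>) \<omega> (enn2real \<theta>)"
proof -
  have legal: "legal m (s \<omega>) \<omega>" using s \<omega> by (rule grid_control_legal)
  have \<theta>: "\<theta> = min (Inf (switch_set m (s \<omega>) \<omega>)) (Inf (ruin_set m (s \<omega>) \<omega>))"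
    unfolding \<theta>_def grid_switch_time_eq ruin_time_grid ..
  have stop: "paid m (s \<omega>) \<omega> u = paid m (s \<omega>) \<omega> (enn2real \<theta>)"
    if k: "run m (s \<omega>) \<omega> k = Some (r, q, d)" "run m (s \<omega>) \<omega> (Suc k) = None"
      and z: "\<theta> = ennreal z" "r \<le> z" for k r q d z
  proof -
    have "0 \<le> r" using run_SomeD(1)[OF \<omega> legal k(1)] .
    then have "enn2real \<theta> = z" "z \<le> u" using z u by auto
    then show ?thesis unfolding paid_def using last_active[OF \<omega> legal k] z by auto
  qed
  show ?thesis
    using \<omega> legal
  proof (cases rule: stopping_cases)
    case never
    have "\<theta> = \<infinity>" unfolding \<theta> never(2,3) by simp
    then show ?thesis using u(2) by (simp add: top_unique)
  next
    case (ruin k r q d)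
    have "\<theta> = ennreal (next_time \<omega> r)" unfolding \<theta> ruin(4,5) by simp
    then show ?thesis using ruin(1,2,3) next_time_less[OF \<omega>, of r] by (intro stop[OF ruin(1)]) auto
  next
    case (switch k r q d)
    have "0 \<le> r" using run_SomeD(1)[OF \<omega> legal switch(1)] .
    then have "ennreal r \<le> ennreal (next_time \<omega> r)" using next_time_less[OF \<omega>, of r] by (intro ennreal_leI) simp
    then have "\<theta> = ennreal r" unfolding \<theta> switch(3) using switch(4) by (intro min_absorb1) (rule order_trans)
    then show ?thesis using switch(1,2) by (intro stop[OF switch(1)]) auto
  qed
qed

text \<open>The discounted dividends after integration by parts. This form depends on the path only
  through the cumulative dividends, for which admissibility provides measurability.\<close>

definition paid_integral :: "nat ^ 'n \<Rightarrow> (nat \<Rightarrow> 'n action) \<Rightarrow> 'n path \<Rightarrow> ennreal" where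
  "paid_integral m ds \<omega> = (\<integral>\<^sup>+u. ennreal (discount M * exp (- discount M * u)) *
     (indicator {0..} u * ennreal (weight M \<bullet> paid m ds \<omega> u)) \<partial>lborel)"

end

context grid_solution
begin

text \<open>A payment at time r contributes its amount times the integral of c exp (- c u) over u
  \<ge> r. Summing over all payments under the integral sign recovers the cumulative
  dividends.\<close>

lemma dividend_total_eq_paid_integral:
  assumes \<omega>: "\<omega> \<in> paths" and legal: "legal m ds \<omega>"
  shows "ennreal (total dividend_reward m ds \<omega>) = paid_integral m ds \<omega>"
proof -
  let ?c = "discount M"
  let ?k = "\<lambda>u. ennreal (?c * exp (- ?c * u))"
  define p where "p k = ennreal (weight M \<bullet> payment m ds \<omega> k)" for k
  define g where "g k u = (if k \<in> active m ds \<omega> u then p k else 0)" for k u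
  have g_Some: "g k u = p k * indicator {r..} u" if "run m ds \<omega> k = Some (r, q, d)" for k u r q d
    using active_iff[OF that, of u] by (simp add: g_def)
  have g_None: "g k u = 0" if "run m ds \<omega> k = None" for k u
    using that by (simp add: g_def active_def)
  have gm[measurable]: "g k \<in> borel_measurable borel" for k
  proof (cases "run m ds \<omega> k")
    case None
    then have "g k = (\<lambda>u. 0)" using g_None by blast
    then show ?thesis by simp
  next
    case (Some z)
    then obtain r q d where "run m ds \<omega> k = Some (r, q, d)" by (cases z) auto
    then have "g k = (\<lambda>u. p k * indicator {r..} u)" using g_Some by blast
    then show ?thesis by simp
  qed
  have neg: "g k u = 0" if "u < 0" for k u
    using run_SomeD(1)[OF \<omega> legal] that by (force simp: g_def active_def)
  have summand: "ennreal (reward_term dividend_reward m ds \<omega> k) = (\<integral>\<^sup>+u. ?k u * g (Suc k) u \<partial>lborel)" for k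
  proof (cases "run m ds \<omega> (Suc k)")
    case None
    then have "reward_term dividend_reward m ds \<omega> k = 0"
      by (auto simp: reward_term_def dividend_reward_def split: option.splits)
    then show ?thesis using g_None[OF None] by simp
  next
    case (Some z)
    then obtain r q d where r: "run m ds \<omega> (Suc k) = Some (r, q, d)" by (cases z) auto
    then obtain t' q' d' where *: "run m ds \<omega> k = Some (t', q', d')" "step \<omega> (ds k) t' q' = Some (r, q, d)"
      by (rule run_Suc_SomeE)
    have pd: "payment m ds \<omega> (Suc k) = d" using r by (simp add: payment_def del: grid_run.simps)
    have d: "0 \<le> weight M \<bullet> d" by (rule inner_weight_nonneg[OF run_SomeD(2)[OF \<omega> legal r]])
    have "(\<integral>\<^sup>+u. ?k u * g (Suc k) u \<partial>lborel) = (\<integral>\<^sup>+u. p (Suc k) * (?k u * indicator {r..} u) \<partial>lborel)"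
      unfolding g_Some[OF r] by (simp add: mult_ac)
    also have "\<dots> = p (Suc k) * ennreal (exp (- ?c * r))"
      by (subst nn_integral_cmult) (simp, simp only: nn_integral_discount_tail[OF discount_pos])
    also have "\<dots> = ennreal (exp (- ?c * r) * (weight M \<bullet> d))"
      using d by (simp add: p_def pd ennreal_mult' mult.commute)
    finally show ?thesis by (simp add: reward_term_Some[OF *(1)] dividend_reward_def *(2))
  qed
  have sum: "(\<Sum>k. g (Suc k) u) = ennreal (weight M \<bullet> paid m ds \<omega> u)" for u
  proof -
    have fin: "finite (active m ds \<omega> u)" by (rule finite_active[OF \<omega> legal])
    then obtain N where N: "active m ds \<omega> u \<subseteq> {..<N}" using finite_nat_iff_bounded by auto
    \<comment> \<open>Rewards are numbered by the paying action, payments by the state reached; the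
      index shift is harmless because state 0 carries no dividend.\<close>
    have p0: "p 0 = 0" by (simp add: p_def payment_def)
    have "(\<Sum>k. g (Suc k) u) = (\<Sum>k<N. g (Suc k) u)"
      using N by (intro suminf_finite) (auto simp: g_def)
    also have "\<dots> = (\<Sum>k<Suc N. g k u)"
      using p0 by (subst sum.lessThan_Suc_shift) (simp add: g_def)
    also have "\<dots> = (\<Sum>k\<in>active m ds \<omega> u. p k)"
      unfolding g_def using N by (subst sum.If_cases) (auto intro!: sum.cong)
    also have "\<dots> = ennreal (\<Sum>k\<in>active m ds \<omega> u. weight M \<bullet> payment m ds \<omega> k)"
      unfolding p_def by (intro sum_ennreal inner_weight_nonneg payment_nonneg[OF \<omega> legal])
    also have "\<dots> = ennreal (weight M \<bullet> paid m ds \<omega> u)" by (simp add: paid_def inner_sum_right)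
    finally show ?thesis .
  qed
  have "ennreal (total dividend_reward m ds \<omega>) = (\<Sum>k. ennreal (reward_term dividend_reward m ds \<omega> k))"
    unfolding total_def
    by (rule suminf_ennreal2[symmetric, OF dividend_term_nonneg[OF \<omega> legal] dividend_summable(1)[OF \<omega> legal]])
  also have "\<dots> = (\<Sum>k. \<integral>\<^sup>+u. ?k u * g (Suc k) u \<partial>lborel)" unfolding summand ..
  also have "\<dots> = (\<integral>\<^sup>+u. (\<Sum>k. ?k u * g (Suc k) u) \<partial>lborel)" by (rule nn_integral_suminf[symmetric]) simp
  also have "\<dots> = (\<integral>\<^sup>+u. ?k u * (indicator {0..} u * ennreal (weight M \<bullet> paid m ds \<omega> u)) \<partial>lborel)"
  proof (intro nn_integral_cong)
    fix u
    show "(\<Sum>k. ?k u * g (Suc k) u) = ?k u * (indicator {0..} u * ennreal (weight M \<bullet> paid m ds \<omega> u))"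
      using neg[of u] by (cases "u < 0") (simp_all add: ennreal_suminf_cmult sum)
  qed
  finally show ?thesis unfolding paid_integral_def .
qed

text \<open>The Stieltjes integral and the sum of rewards agree because both turn into
  \<open>paid_integral\<close> after integration by parts.\<close>

lemma dividend_part:
  assumes s: "grid_control M \<delta> m s" and \<omega>: "\<omega> \<in> paths"
  defines "L \<equiv> grid_dividends M \<delta> m s"
  shows "discounted_dividends M L (min (grid_switch_time M \<delta> m s \<omega>) (ruin_time M (gp m) L \<omega>)) \<omega> =
    total dividend_reward m (s \<omega>) \<omega>"
proof -
  let ?c = "discount M" and ?\<theta> = "min (grid_switch_time M \<delta> m s \<omega>) (ruin_time M (gp m) L \<omega>)"
  have legal: "legal m (s \<omega>) \<omega>" using s \<omega> by (rule grid_control_legal)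
  define P where "P u = weight M \<bullet> paid m (s \<omega>) \<omega> u" for u
  define F where "F u = P (max 0 u)" for u
  have P_mono: "P x \<le> P y" if "x \<le> y" for x y
  proof -
    have "0 \<le> weight M \<bullet> (paid m (s \<omega>) \<omega> y - paid m (s \<omega>) \<omega> x)"
      using paid_mono[OF \<omega> legal that] by (intro inner_weight_nonneg) simp
    then show ?thesis by (simp add: P_def inner_diff_right)
  qed
  have P0: "0 \<le> P u" for u unfolding P_def by (rule inner_weight_nonneg[OF paid_nonneg[OF \<omega> legal]])
  have mono: "F x \<le> F y" if "x \<le> y" for x y unfolding F_def using that by (intro P_mono) auto
  have cont: "continuous (at_right a) F" for a
  proof -
    have "eventually (\<lambda>u. F u = F a) (at_right a)"
    proof (cases "0 \<le> a")
      case True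
      have "eventually (\<lambda>u. a < u) (at_right a)" by (rule eventually_at_right_less)
      then show ?thesis using paid_at_right[OF \<omega> legal True]
        by eventually_elim (use True in \<open>simp add: F_def P_def\<close>)
    next
      case False
      then show ?thesis unfolding eventually_at_right_field
        by (intro exI[of _ 0]) (auto simp: F_def)
    qed
    then show ?thesis unfolding continuous_within by (rule tendsto_eventually)
  qed
  have const: "F u = F (enn2real ?\<theta>)" if "0 \<le> u" "?\<theta> \<le> ennreal u" for u
    using paid_const_after[OF s \<omega>, folded L_def, OF that] that(1) by (simp add: F_def P_def)
  have F0: "F 0 = P 0" by (simp add: F_def)
  let ?S = "{s. 0 < s \<and> ennreal s \<le> ?\<theta>}"
  let ?X = "\<integral>\<^sup>+s. indicator ?S s * ennreal (exp (- ?c * s)) \<partial>interval_measure F"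
  \<comment> \<open>The density c exp (- c u) has total mass 1, so the initial payment, which the
    Stieltjes integral leaves out, can be moved under the integral.\<close>
  have one: "(\<integral>\<^sup>+u. ennreal (?c * exp (- ?c * u)) * indicator {0..} u \<partial>lborel) = 1"
    using nn_integral_discount_tail[OF discount_pos, of 0] by simp
  have Fm[measurable]: "F \<in> borel_measurable borel" using mono by (intro borel_measurable_mono) (simp add: mono_def)
  have Xeq: "?X = (\<integral>\<^sup>+u. ennreal (?c * exp (- ?c * u)) * (indicator {0..} u * ennreal (F u - F 0)) \<partial>lborel)"
    by (rule nn_integral_interval_measure_discounted[OF discount_pos mono cont const])
  have "?X + ennreal (P 0) = (\<integral>\<^sup>+u. ennreal (?c * exp (- ?c * u)) * (indicator {0..} u * ennreal (F u - F 0)) \<partial>lborel)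
      + ennreal (P 0) * (\<integral>\<^sup>+u. ennreal (?c * exp (- ?c * u)) * indicator {0..} u \<partial>lborel)"
    unfolding Xeq one by (simp only: mult_1_right)
  also have "\<dots> = (\<integral>\<^sup>+u. ennreal (?c * exp (- ?c * u)) * (indicator {0..} u * ennreal (F u - F 0)) +
      ennreal (P 0) * (ennreal (?c * exp (- ?c * u)) * indicator {0..} u) \<partial>lborel)"
    by (simp add: nn_integral_add nn_integral_cmult)
  also have "\<dots> = paid_integral m (s \<omega>) \<omega>"
    unfolding paid_integral_def
  proof (intro nn_integral_cong)
    fix u :: real
    have "ennreal (F u - F 0) + ennreal (P 0) = ennreal (P u)" if "0 \<le> u"
      using P_mono[OF that] P0[of 0] that by (subst ennreal_plus[symmetric]) (simp_all add: F_def)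
    then show "ennreal (?c * exp (- ?c * u)) * (indicator {0..} u * ennreal (F u - F 0)) +
      ennreal (P 0) * (ennreal (?c * exp (- ?c * u)) * indicator {0..} u) =
      ennreal (?c * exp (- ?c * u)) * (indicator {0..} u * ennreal (weight M \<bullet> paid m (s \<omega>) \<omega> u))"
      unfolding P_def[symmetric, of u]
      by (cases "0 \<le> u") (simp_all add: distrib_left[symmetric] mult.commute[of "ennreal (P 0)"])
  qed
  also have "\<dots> = ennreal (total dividend_reward m (s \<omega>) \<omega>)"
    by (rule dividend_total_eq_paid_integral[OF \<omega> legal, symmetric])
  finally have eq: "?X + ennreal (P 0) = ennreal (total dividend_reward m (s \<omega>) \<omega>)" .
  then have "?X \<noteq> \<top>" by auto
  then obtain x where x: "0 \<le> x" "?X = ennreal x" by (cases ?X) auto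
  have "ennreal (x + P 0) = ennreal (total dividend_reward m (s \<omega>) \<omega>)"
    using eq x P0[of 0] by simp
  then have tot: "x + P 0 = total dividend_reward m (s \<omega>) \<omega>"
    using x P0[of 0] dividend_summable(2)[OF \<omega> legal] by (subst (asm) ennreal_inj) auto
  have "(LINT s:?S|interval_measure F. exp (- ?c * s)) = enn2real (\<integral>\<^sup>+s. ennreal (indicator ?S s *\<^sub>R exp (- ?c * s)) \<partial>interval_measure F)"
    unfolding set_lebesgue_integral_def by (rule integral_eq_nn_integral) (auto cong: measurable_cong_sets)
  also have "(\<integral>\<^sup>+s. ennreal (indicator ?S s *\<^sub>R exp (- ?c * s)) \<partial>interval_measure F) = ?X"
    by (intro nn_integral_cong) (auto simp: indicator_def)
  finally have "(LINT s:?S|interval_measure F. exp (- ?c * s)) = x" using x by simp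
  moreover have "(\<lambda>u. weight M \<bullet> L (max 0 u) \<omega>) = F"
    by (simp add: F_def P_def L_def grid_dividends_eq_paid fun_eq_iff)
  moreover have "weight M \<bullet> L 0 \<omega> = P 0" by (simp add: P_def L_def grid_dividends_eq_paid)
  ultimately show ?thesis unfolding discounted_dividends_def using tot by simp
qed

end

section \<open>Measurability\<close>

text \<open>Joint measurability from right continuity: rounding times up to a grid leaves countably
  many time slices, and refining the grid recovers the process.\<close>

lemma borel_measurable_right_continuous_process:
  fixes Y :: "real \<Rightarrow> 'a \<Rightarrow> real ^ 'n::finite"
  assumes Y: "\<And>t. 0 \<le> t \<Longrightarrow> Y t \<in> borel_measurable N"
    and cont: "\<And>\<omega> t. \<omega> \<in> space N \<Longrightarrow> 0 \<le> t \<Longrightarrow> continuous (at_right t) (\<lambda>s. Y s \<omega>)"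
  shows "(\<lambda>y. Y (max 0 (fst y)) (snd y)) \<in> borel_measurable (borel \<Otimes>\<^sub>M N)"
proof -
  \<comment> \<open>The smallest multiple of 1/(n+1) strictly above \<open>t\<close>; strictness is
    what convergence along \<open>at_right\<close> requires.\<close>
  define q where "q n t = (real_of_int \<lfloor>real (Suc n) * t\<rfloor> + 1) / real (Suc n)" for n t
  have q: "t < q n t" "q n t \<le> t + 1 / real (Suc n)" for n t
  proof -
    have "real (Suc n) * t < real_of_int \<lfloor>real (Suc n) * t\<rfloor> + 1"
      "real_of_int \<lfloor>real (Suc n) * t\<rfloor> \<le> real (Suc n) * t" by linarith+
    then show "t < q n t" "q n t \<le> t + 1 / real (Suc n)"
      by (simp_all add: q_def field_simps del: of_nat_Suc)
  qed
  have lim: "filterlim (\<lambda>n. q n t) (at_right t) sequentially" for t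
    unfolding filterlim_at
  proof
    have "(\<lambda>n. t + 1 / real (Suc n)) \<longlonglongrightarrow> t + 0"
      by (intro tendsto_add tendsto_const LIMSEQ_Suc[OF lim_1_over_n])
    then show "(\<lambda>n. q n t) \<longlonglongrightarrow> t"
      using q by (intro real_tendsto_sandwich[of "\<lambda>_. t" "\<lambda>n. q n t" sequentially "\<lambda>n. t + 1 / real (Suc n)"])
        (auto intro!: always_eventually less_imp_le)
    show "eventually (\<lambda>n. q n t \<in> {t<..} \<and> q n t \<noteq> t) sequentially"
      using q(1)[of t] by (auto intro!: always_eventually simp: less_imp_neq[symmetric])
  qed
  show ?thesis
  proof (rule borel_measurable_LIMSEQ_metric)
    fix n
    let ?i = "\<lambda>y :: real \<times> 'a. \<lfloor>real (Suc n) * max 0 (fst y)\<rfloor>"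
    have "(\<lambda>y. Y (max 0 ((real_of_int i + 1) / real (Suc n))) (snd y)) \<in> borel_measurable (borel \<Otimes>\<^sub>M N)" for i
      by (rule measurable_compose[OF measurable_snd Y]) simp
    moreover have "?i \<in> (borel \<Otimes>\<^sub>M N) \<rightarrow>\<^sub>M count_space UNIV" by measurable
    ultimately have "(\<lambda>y. Y (max 0 ((real_of_int (?i y) + 1) / real (Suc n))) (snd y)) \<in> borel_measurable (borel \<Otimes>\<^sub>M N)"
      by (rule measurable_compose_countable)
    moreover have "max 0 ((real_of_int (?i y) + 1) / real (Suc n)) = q n (max 0 (fst y))" for y
      using q(1)[of "max 0 (fst y)" n] by (simp add: q_def max_def split: if_splits)
    ultimately show "(\<lambda>y. Y (q n (max 0 (fst y))) (snd y)) \<in> borel_measurable (borel \<Otimes>\<^sub>M N)" by simp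
  next
    fix y :: "real \<times> 'a" assume "y \<in> space (borel \<Otimes>\<^sub>M N)"
    then have "snd y \<in> space N" by (auto simp: space_pair_measure)
    from cont[OF this, of "max 0 (fst y)"]
    have "((\<lambda>s. Y s (snd y)) \<longlongrightarrow> Y (max 0 (fst y)) (snd y)) (at_right (max 0 (fst y)))"
      by (simp add: continuous_within)
    then show "(\<lambda>n. Y (q n (max 0 (fst y))) (snd y)) \<longlonglongrightarrow> Y (max 0 (fst y)) (snd y)"
      by (rule filterlim_compose[OF _ lim])
  qed
qed

section \<open>Measurability of path functionals\<close>

context dividend_model
begin

lemma measurable_path_component [measurable]: "(\<lambda>\<omega>. \<omega> k) \<in> path_measure M \<rightarrow>\<^sub>M jump_space"
  unfolding path_measure_eq by (rule measurable_restrict_space1) (simp cong: measurable_cong_sets)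

lemma measurable_jump_time [measurable]: "(\<lambda>\<omega>. jump_time \<omega> k) \<in> borel_measurable (path_measure M)"
  and measurable_jump_size [measurable]: "(\<lambda>\<omega>. jump_size \<omega> k) \<in> borel_measurable (path_measure M)"
  using measurable_compose[OF measurable_path_component measurable_fst]
    measurable_compose[OF measurable_path_component measurable_snd] by simp_all

lemma measurable_jump_count [measurable (raw)]:
  assumes [measurable]: "f \<in> N \<rightarrow>\<^sub>M path_measure M" "t \<in> borel_measurable N"
  shows "(\<lambda>y. jump_count (f y) (t y)) \<in> N \<rightarrow>\<^sub>M count_space UNIV"
proof -
  have p: "f y \<in> paths" if "y \<in> space N" for y
    using measurable_space[OF assms(1) that] by simp
  have [measurable]: "(\<lambda>y. jump_time (f y) k) \<in> borel_measurable N" for k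
    by (rule measurable_compose[OF assms(1) measurable_jump_time])
  have "(\<lambda>y. jump_count (f y) (t y)) -` {n} \<inter> space N \<in> sets N" for n
  proof -
    have "(\<lambda>y. jump_count (f y) (t y)) -` {n} \<inter> space N =
      {y \<in> space N. \<forall>k. jump_time (f y) k \<le> t y \<longleftrightarrow> k < n}"
    proof -
      have "jump_count (f y) (t y) = n \<longleftrightarrow> (\<forall>k. jump_time (f y) k \<le> t y \<longleftrightarrow> k < n)" if "y \<in> space N" for y
        using jump_time_le_iff_jump_count[OF p[OF that]] jump_count_eqI[of "f y" "t y" n] by metis
      then show ?thesis by auto
    qed
    also have "\<dots> \<in> sets N" by measurable
    finally show ?thesis .
  qed
  then show ?thesis by (subst measurable_count_space_eq2_countable) auto
qed

lemma measurable_surplus: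
  assumes [measurable]: "f \<in> N \<rightarrow>\<^sub>M path_measure M" "t \<in> borel_measurable N"
  shows "(\<lambda>y. surplus M x (t y) (f y)) \<in> borel_measurable N"
proof -
  have [measurable]: "(\<lambda>y. jump_size (f y) k) \<in> borel_measurable N" for k
    by (rule measurable_compose[OF assms(1) measurable_jump_size])
  have "(\<lambda>y. (\<Sum>k<n. jump_size (f y) k)) \<in> borel_measurable N" for n by measurable
  then have [measurable]: "(\<lambda>y. (\<Sum>k<jump_count (f y) (t y). jump_size (f y) k)) \<in> borel_measurable N"
    by (rule measurable_compose_countable) measurable
  show ?thesis unfolding surplus_def by measurable
qed

lemma space_jump_filtration [simp]: "space (jump_filtration t) = paths"
  unfolding jump_filtration_def by (rule space_measure_of) auto

lemma sets_jump_filtration_le: "sets (jump_filtration t :: 'n path measure) \<subseteq> sets (path_measure M)"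
proof -
  have "{{\<omega> \<in> paths. ennreal (jump_time \<omega> k) \<le> t \<and> \<omega> k \<in> A} | k A. A \<in> sets borel} \<subseteq> sets (path_measure M)"
  proof clarify
    fix k and A :: "(real \<times> (real ^ 'n)) set" assume "A \<in> sets borel"
    then have [measurable]: "A \<in> sets jump_space" unfolding borel_prod .
    have "{\<omega> \<in> space (path_measure M). ennreal (jump_time \<omega> k) \<le> t \<and> \<omega> k \<in> A} \<in> sets (path_measure M)"
      by measurable
    then show "{\<omega> \<in> paths. ennreal (jump_time \<omega> k) \<le> t \<and> \<omega> k \<in> A} \<in> sets (path_measure M)" by simp
  qed
  then show ?thesis unfolding jump_filtration_def
    by (subst sets_measure_of) (auto intro!: sets.sigma_sets_subset[of _ "path_measure M", simplified])
qed

lemma measurable_jump_filtration: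
  "f \<in> borel_measurable (jump_filtration t) \<Longrightarrow> f \<in> borel_measurable (path_measure M)"
  using sets_jump_filtration_le[of t] unfolding measurable_def by auto

end

context grid_solution
begin

text \<open>Each part is rewritten in terms of the cumulative dividends and the switch time, whose
  measurability is contained in membership in \<open>strategies\<close>: the dividends by
  \<open>paid_integral\<close>, the switch by the surplus at the switch time, ruin by a sequential
  left limit.\<close>

lemma payoff_measurable:
  assumes s: "grid_control M \<delta> m s" and str: "grid_strategy M \<delta> m s \<in> strategies M (gp m)"
  shows "(\<lambda>\<omega>. total dividend_reward m (s \<omega>) \<omega>) \<in> borel_measurable (path_measure M)"
    and "(\<lambda>\<omega>. total (switch_reward w) m (s \<omega>) \<omega>) \<in> borel_measurable (path_measure M)"
    and "(\<lambda>\<omega>. total ruin_reward m (s \<omega>) \<omega>) \<in> borel_measurable (path_measure M)"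
proof -
  let ?P = "path_measure M"
  define L where "L = grid_dividends M \<delta> m s"
  define T where "T = grid_switch_time M \<delta> m s"
  have adm: "admissible M (gp m) L" and st: "stopping_time jump_filtration T"
    using str by (auto simp: strategies_def grid_strategy_def L_def T_def)
  have "L t \<in> borel_measurable ?P" if "0 \<le> t" for t
    using adm that by (auto simp: admissible_def intro: measurable_jump_filtration)
  then have J: "(\<lambda>y. L (max 0 (fst y)) (snd y)) \<in> borel_measurable (borel \<Otimes>\<^sub>M ?P)"
    by (rule borel_measurable_right_continuous_process) (use adm in \<open>auto simp: admissible_def\<close>)
  have Lm[measurable]: "(\<lambda>y. L (max 0 (t y)) (f y)) \<in> borel_measurable N"
    if "t \<in> borel_measurable N" "f \<in> N \<rightarrow>\<^sub>M ?P" for t f and N :: "'z measure"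
    using measurable_compose[OF measurable_Pair[OF that] J] by simp
  have Lneg: "L (max 0 t) \<omega> = L t \<omega>" if "0 \<le> t" for t \<omega> using that by simp
  \<comment> \<open>The times \<open>jump_time \<omega> k - 1 / real (Suc n)\<close> may be
    negative. Grid dividends are an empty sum there, so \<open>L\<close> is controlled on the whole
    line.\<close>
  have Lneg0: "L t \<omega> = 0" if "t < 0" "\<omega> \<in> paths" for t \<omega>
  proof -
    have "active m (s \<omega>) \<omega> t = {}"
      using run_SomeD(1)[OF that(2) grid_control_legal[OF s that(2)]] that(1) by (force simp: active_def)
    then show ?thesis by (simp add: L_def grid_dividends_eq_paid paid_def)
  qed
  have Lm2: "(\<lambda>\<omega>. L (t \<omega>) \<omega>) \<in> borel_measurable ?P" if [measurable]: "t \<in> borel_measurable ?P" for t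
  proof -
    have "(\<lambda>\<omega>. if t \<omega> < 0 then 0 else L (max 0 (t \<omega>)) \<omega>) \<in> borel_measurable ?P"
      using Lm[of t ?P "\<lambda>\<omega>. \<omega>"] by measurable
    moreover have "(if t \<omega> < 0 then 0 else L (max 0 (t \<omega>)) \<omega>) = L (t \<omega>) \<omega>" if "\<omega> \<in> space ?P" for \<omega>
      using that Lneg0[of "t \<omega>" \<omega>] by (simp add: max_def)
    ultimately show ?thesis by (rule measurable_cong[THEN iffD1, rotated])
  qed
  have Cm: "(\<lambda>\<omega>. controlled_surplus M (gp m) L (t \<omega>) \<omega>) \<in> borel_measurable ?P"
    if [measurable]: "t \<in> borel_measurable ?P" for t
    unfolding controlled_surplus_def using Lm2[OF that] measurable_surplus[of "\<lambda>\<omega>. \<omega>" ?P t "gp m"]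
    by measurable
  have Tm[measurable]: "T \<in> borel_measurable ?P"
  proof (rule borel_measurableI_le)
    fix y
    have "{\<omega> \<in> space (jump_filtration y). T \<omega> \<le> y} \<in> sets (jump_filtration y)"
      using st unfolding stopping_time_def by (auto simp: Measurable.pred_def)
    then show "{\<omega> \<in> space ?P. T \<omega> \<le> y} \<in> sets ?P" using sets_jump_filtration_le[of y] by auto
  qed
  \<comment> \<open>The left limit exists by admissibility and may thus be computed along one
    sequence, as a countable limit of measurable functions.\<close>
  have ll: "left_limit (\<lambda>u. L u \<omega>) (jump_time \<omega> k) = lim (\<lambda>n. L (jump_time \<omega> k - 1 / real (Suc n)) \<omega>)"
    if \<omega>: "\<omega> \<in> paths" for \<omega> k
  proof -
    let ?t = "jump_time \<omega> k"
    obtain l where l: "((\<lambda>u. L u \<omega>) \<longlongrightarrow> l) (at_left ?t)"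
      using adm \<omega> paths_jump_time_pos[OF \<omega>, of k] unfolding admissible_def by blast
    have "filterlim (\<lambda>n. ?t - 1 / real (Suc n)) (at_left ?t) sequentially"
      unfolding filterlim_at
    proof
      have "(\<lambda>n. ?t - 1 / real (Suc n)) \<longlonglongrightarrow> ?t - 0"
        by (intro tendsto_diff tendsto_const LIMSEQ_Suc[OF lim_1_over_n])
      then show "(\<lambda>n. ?t - 1 / real (Suc n)) \<longlonglongrightarrow> ?t" by simp
    qed simp
    then have "(\<lambda>n. L (?t - 1 / real (Suc n)) \<omega>) \<longlonglongrightarrow> l" by (rule filterlim_compose[OF l])
    then show ?thesis unfolding left_limit_def tendsto_Lim[OF trivial_limit_at_left_real l] by (rule limI[symmetric])
  qed
  define R where "R = ruin_time M (gp m) L"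
  have Rm[measurable]: "R \<in> borel_measurable ?P"
  proof -
    let ?b = "\<lambda>\<omega> k. \<not> 0 \<le> surplus M (gp m) (jump_time \<omega> k) \<omega> - lim (\<lambda>n. L (jump_time \<omega> k - 1 / real (Suc n)) \<omega>)"
    have [measurable]: "(\<lambda>\<omega>. L (jump_time \<omega> k - 1 / real (Suc n)) \<omega>) \<in> borel_measurable ?P" for k n
      by (rule Lm2) measurable
    have [measurable]: "(\<lambda>\<omega>. surplus M (gp m) (jump_time \<omega> k) \<omega>) \<in> borel_measurable ?P" for k
      by (rule measurable_surplus) measurable
    have "(\<lambda>\<omega>. INF k. if ?b \<omega> k then ennreal (jump_time \<omega> k) else \<infinity>) \<in> borel_measurable ?P"
      by measurable
    moreover have "(INF k. if ?b \<omega> k then ennreal (jump_time \<omega> k) else \<infinity>) = R \<omega>" if "\<omega> \<in> space ?P" for \<omega>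
    proof -
      have \<omega>: "\<omega> \<in> paths" using that by simp
      have "R \<omega> = Inf {ennreal (jump_time \<omega> k) | k. ?b \<omega> k}"
        unfolding R_def ruin_time_def ll[OF \<omega>] ..
      also have "\<dots> = (INF k. if ?b \<omega> k then ennreal (jump_time \<omega> k) else \<infinity>)"
      proof (rule antisym)
        show "Inf {ennreal (jump_time \<omega> k) | k. ?b \<omega> k} \<le> (INF k. if ?b \<omega> k then ennreal (jump_time \<omega> k) else \<infinity>)"
          by (rule INF_greatest) (auto intro!: Inf_lower)
        show "(INF k. if ?b \<omega> k then ennreal (jump_time \<omega> k) else \<infinity>) \<le> Inf {ennreal (jump_time \<omega> k) | k. ?b \<omega> k}"
        proof (rule Inf_greatest)
          fix x assume "x \<in> {ennreal (jump_time \<omega> k) | k. ?b \<omega> k}"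
          then obtain k where "x = ennreal (jump_time \<omega> k)" "?b \<omega> k" by blast
          then show "(INF k. if ?b \<omega> k then ennreal (jump_time \<omega> k) else \<infinity>) \<le> x"
            by (intro INF_lower2[of k]) auto
        qed
      qed
      finally show ?thesis ..
    qed
    ultimately show ?thesis by (rule measurable_cong[THEN iffD1, rotated])
  qed
  show "(\<lambda>\<omega>. total dividend_reward m (s \<omega>) \<omega>) \<in> borel_measurable ?P"
  proof -
    have [measurable]: "(\<lambda>y. L (max 0 (snd y)) (fst y)) \<in> borel_measurable (?P \<Otimes>\<^sub>M lborel)"
      by (rule Lm) measurable
    have "(\<lambda>\<omega>. \<integral>\<^sup>+u. ennreal (discount M * exp (- discount M * u)) *
     (indicator {0..} u * ennreal (weight M \<bullet> L (max 0 u) \<omega>)) \<partial>lborel) \<in> borel_measurable ?P"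
      by (rule lborel.borel_measurable_nn_integral) (unfold split_beta', measurable)
    then have "(\<lambda>\<omega>. enn2real (\<integral>\<^sup>+u. ennreal (discount M * exp (- discount M * u)) *
     (indicator {0..} u * ennreal (weight M \<bullet> L (max 0 u) \<omega>)) \<partial>lborel)) \<in> borel_measurable ?P"
      by simp
    moreover have "enn2real (\<integral>\<^sup>+u. ennreal (discount M * exp (- discount M * u)) *
     (indicator {0..} u * ennreal (weight M \<bullet> L (max 0 u) \<omega>)) \<partial>lborel) = total dividend_reward m (s \<omega>) \<omega>"
      if "\<omega> \<in> space ?P" for \<omega>
    proof -
      have \<omega>: "\<omega> \<in> paths" using that by simp
      note legal = grid_control_legal[OF s \<omega>]
      have "(\<integral>\<^sup>+u. ennreal (discount M * exp (- discount M * u)) *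
         (indicator {0..} u * ennreal (weight M \<bullet> L (max 0 u) \<omega>)) \<partial>lborel) = paid_integral m (s \<omega>) \<omega>"
        unfolding paid_integral_def L_def grid_dividends_eq_paid
        by (intro nn_integral_cong) (auto simp: indicator_def max_def)
      then show ?thesis
        using dividend_total_eq_paid_integral[OF \<omega> legal, symmetric] dividend_summable(2)[OF \<omega> legal] by simp
    qed
    ultimately show ?thesis by (rule measurable_cong[THEN iffD1, rotated])
  qed
  show "(\<lambda>\<omega>. total (switch_reward w) m (s \<omega>) \<omega>) \<in> borel_measurable ?P"
  proof -
    have [measurable]: "(\<lambda>\<omega>. controlled_surplus M (gp m) L (enn2real (T \<omega>)) \<omega>) \<in> borel_measurable ?P"
      by (rule Cm) measurable
    \<comment> \<open>At a switch the controlled surplus is a grid point, so the value of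
      \<open>w\<close> there is recovered from the surplus by the Borel map
      \<open>gi\<close>.\<close>
    have "(\<lambda>\<omega>. if T \<omega> < R \<omega>
        then exp (- discount M * enn2real (T \<omega>)) * w (gi (controlled_surplus M (gp m) L (enn2real (T \<omega>)) \<omega>))
        else 0) \<in> borel_measurable ?P"
      by measurable
    moreover have "(if T \<omega> < R \<omega>
        then exp (- discount M * enn2real (T \<omega>)) * w (gi (controlled_surplus M (gp m) L (enn2real (T \<omega>)) \<omega>))
        else 0) = total (switch_reward w) m (s \<omega>) \<omega>" if "\<omega> \<in> space ?P" for \<omega>
      using switch_part(1)[OF s, of \<omega> "\<lambda>x. w (gi x)"] that
      unfolding L_def[symmetric] T_def[symmetric] R_def grid_index_grid_point by simp
    ultimately show ?thesis by (rule measurable_cong[THEN iffD1, rotated])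
  qed
  show "(\<lambda>\<omega>. total ruin_reward m (s \<omega>) \<omega>) \<in> borel_measurable ?P"
  proof -
    define z where "z \<omega> = lim (\<lambda>n. controlled_surplus M (gp m) L (enn2real (R \<omega>) - 1 / real (Suc n)) \<omega>)" for \<omega>
    have [measurable]: "(\<lambda>\<omega>. controlled_surplus M (gp m) L (enn2real (R \<omega>) - 1 / real (Suc n)) \<omega>) \<in> borel_measurable ?P" for n
      by (rule Cm) measurable
    have [measurable]: "(\<lambda>\<omega>. controlled_surplus M (gp m) L (enn2real (R \<omega>)) \<omega>) \<in> borel_measurable ?P"
      by (rule Cm) measurable
    have [measurable]: "z \<in> borel_measurable ?P"
      unfolding z_def by (rule borel_measurable_lim_metric) measurable
    define G where "G \<omega> = loss (z \<omega>) (z \<omega> - controlled_surplus M (gp m) L (enn2real (R \<omega>)) \<omega>)" for \<omega>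
    have [measurable]: "G \<in> borel_measurable ?P"
      unfolding G_def by (intro borel_measurable_loss borel_measurable_diff) fact+
    have [measurable]: "Measurable.pred ?P (\<lambda>\<omega>. R \<omega> \<le> T \<omega> \<and> R \<omega> < \<infinity>)"
      unfolding not_less[symmetric]
      by (intro pred_intros_logic borel_measurable_pred_less Rm Tm borel_measurable_const)
    have "(\<lambda>\<omega>. if R \<omega> \<le> T \<omega> \<and> R \<omega> < \<infinity>
        then exp (- discount M * enn2real (R \<omega>)) * G \<omega>
        else 0) \<in> borel_measurable ?P"
      by (rule measurable_If) measurable
    moreover have "(if R \<omega> \<le> T \<omega> \<and> R \<omega> < \<infinity>
        then exp (- discount M * enn2real (R \<omega>)) * G \<omega>
        else 0) = total ruin_reward m (s \<omega>) \<omega>" if "\<omega> \<in> space ?P" for \<omega>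
    proof -
      have "\<omega> \<in> paths" using that by simp
      from ruin_part(2)[OF s this, folded L_def T_def, folded R_def, unfolded Let_def, folded z_def, folded G_def] show ?thesis .
    qed
    ultimately show ?thesis by (rule measurable_cong[THEN iffD1, rotated])
  qed
qed

end

section \<open>Optimal stationary controls\<close>

lemma extended_expectation_cong:
  "(\<And>\<omega>. \<omega> \<in> space N \<Longrightarrow> Z \<omega> = Z' \<omega>) \<Longrightarrow> extended_expectation N Z = extended_expectation N Z'"
  unfolding extended_expectation_def by (simp cong: nn_integral_cong)

lemma extended_expectation_mono:
  assumes "\<And>\<omega>. \<omega> \<in> space N \<Longrightarrow> Z \<omega> \<le> Z' \<omega>"
  shows "extended_expectation N Z \<le> extended_expectation N Z'"
  unfolding extended_expectation_def
  using assms by (intro ereal_minus_mono less_eq_ennreal.rep_eq[THEN iffD1] nn_integral_mono ennreal_leI) auto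

lemma extended_expectation_integrable:
  assumes "integrable N Z" shows "extended_expectation N Z = ereal (\<integral>\<omega>. Z \<omega> \<partial>N)"
proof -
  have *: "(\<integral>\<^sup>+\<omega>. ennreal (Z \<omega>) \<partial>N) < \<infinity>" "(\<integral>\<^sup>+\<omega>. ennreal (- Z \<omega>) \<partial>N) < \<infinity>"
    using assms by (auto elim!: integrableE simp: less_top)
  obtain a where a: "0 \<le> a" "(\<integral>\<^sup>+\<omega>. ennreal (Z \<omega>) \<partial>N) = ennreal a"
    using *(1) by (cases "\<integral>\<^sup>+\<omega>. ennreal (Z \<omega>) \<partial>N") auto
  obtain b where b: "0 \<le> b" "(\<integral>\<^sup>+\<omega>. ennreal (- Z \<omega>) \<partial>N) = ennreal b"
    using *(2) by (cases "\<integral>\<^sup>+\<omega>. ennreal (- Z \<omega>) \<partial>N") auto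
  show ?thesis
    unfolding extended_expectation_def real_lebesgue_integral_def[OF assms] a(2) b(2)
    using a(1) b(1) by (simp add: enn2ereal_ennreal)
qed

section \<open>Feedback controls and their adaptedness\<close>

context grid_model
begin

text \<open>A step that ends by time \<open>t\<close> uses only information up to \<open>t\<close>.
  If it ends without a jump, a jump of the other path during the step would belong to the common
  history and hence occur on both paths.\<close>

lemma grid_step_same_history:
  assumes h: "same_history t \<omega> \<omega>'" and \<omega>: "\<omega> \<in> paths" "\<omega>' \<in> paths"
    and st: "step \<omega> a r q = Some (r', q', d')" "r \<le> r'" "r' \<le> t"
  shows "step \<omega>' a r q = Some (r', q', d')"
proof (cases a)
  case Wait
  let ?k = "jump_count \<omega> r"
  have jc: "jump_count \<omega>' r = ?k" using same_history_jump_count[OF h, of r] st by simp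
  have nt: "next_time \<omega> r = jump_time \<omega> ?k" "next_time \<omega>' r = jump_time \<omega>' ?k"
    "next_size \<omega> r = jump_size \<omega> ?k" "next_size \<omega>' r = jump_size \<omega>' ?k"
    by (simp_all add: next_time_def next_size_def jc)
  show ?thesis
  proof (cases "\<delta> < next_time \<omega> r - r")
    case True
    then have r': "r' = r + \<delta>" "q' = q + 1" "d' = 0" using st Wait by (auto simp: grid_step_Wait Let_def)
    have "\<delta> < next_time \<omega>' r - r"
    proof (rule ccontr)
      assume n: "\<not> ?thesis"
      then have "jump_time \<omega>' ?k \<le> t" using st(3) r' by (simp add: nt)
      then have "\<omega> ?k = \<omega>' ?k" using same_historyD[OF h] by blast
      then show False using n True by (simp add: nt)
    qed
    then show ?thesis using Wait r' by (simp add: grid_step_Wait Let_def)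
  next
    case False
    then have "r' = next_time \<omega> r" using st Wait by (auto simp: grid_step_Wait Let_def split: if_splits)
    then have "\<omega> ?k = \<omega>' ?k" using same_historyD[OF h, of ?k] st(3) nt(1) by simp
    then have "next_time \<omega>' r = next_time \<omega> r" "next_size \<omega>' r = next_size \<omega> r" by (simp_all add: nt)
    then show ?thesis using st(1) unfolding Wait grid_step_Wait by (simp only:)
  qed
qed (use st in auto)

text \<open>A separate recursion breaks a circle: the actions of a feedback control depend on the
  states of the run that these actions generate.\<close>

primrec feedback_run :: "(nat ^ 'n \<Rightarrow> 'n action) \<Rightarrow> nat ^ 'n \<Rightarrow> 'n path \<Rightarrow> nat \<Rightarrow>
    (real \<times> (nat ^ 'n) \<times> (real ^ 'n)) option" where
  "feedback_run \<sigma> m \<omega> 0 = Some (0, m, 0)"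
| "feedback_run \<sigma> m \<omega> (Suc k) = (case feedback_run \<sigma> m \<omega> k of None \<Rightarrow> None | Some (t, q, d) \<Rightarrow> step \<omega> (\<sigma> q) t q)"

text \<open>After the run has stopped, \<open>Switch\<close> is a mere default value.\<close>

definition feedback_control :: "(nat ^ 'n \<Rightarrow> 'n action) \<Rightarrow> nat ^ 'n \<Rightarrow> 'n control" where
  "feedback_control \<sigma> m \<omega> k = (case feedback_run \<sigma> m \<omega> k of None \<Rightarrow> Switch | Some (t, q, d) \<Rightarrow> \<sigma> q)"

lemma grid_run_feedback_control: "grid_run M \<delta> m (feedback_control \<sigma> m) \<omega> k = feedback_run \<sigma> m \<omega> k"
  by (induction k) (auto simp: feedback_control_def split: option.splits)

text \<open>Future jumps are replaced by arbitrary ones, which makes the stopped path measurable for the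
  filtration; a nonanticipative quantity does not notice the replacement.\<close>

definition stop_path :: "real \<Rightarrow> 'n path \<Rightarrow> 'n path" where
  "stop_path t \<omega> = (\<lambda>k. if jump_time \<omega> k \<le> t then \<omega> k else (t + 1 + real k, 0))"

lemma same_history_stop_path: "same_history t \<omega> (stop_path t \<omega>)"
  by (auto simp: same_history_def stop_path_def)

lemma stop_path_in_paths:
  assumes "\<omega> \<in> paths" "0 \<le> t" shows "stop_path t \<omega> \<in> paths"
proof -
  let ?N = "jump_count \<omega> t"
  have j: "jump_time (stop_path t \<omega>) k = (if k < ?N then jump_time \<omega> k else t + 1 + real k)" for k
    using jump_time_le_iff_jump_count[OF assms(1), of k t] by (simp add: stop_path_def)
  have "strict_mono (jump_time (stop_path t \<omega>))"
  proof (rule strict_monoI)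
    fix i k :: nat assume ik: "i < k"
    have "jump_time \<omega> i \<le> t" if "i < ?N" using jump_time_le_iff_jump_count[OF assms(1)] that by blast
    then show "jump_time (stop_path t \<omega>) i < jump_time (stop_path t \<omega>) k"
      unfolding j using ik paths_jump_time_less_iff[OF assms(1), of i k] by force
  qed
  moreover have "filterlim (jump_time (stop_path t \<omega>)) at_top sequentially"
  proof -
    have "filterlim (\<lambda>k. t + 1 + real k) at_top sequentially"
      unfolding filterlim_add_const_at_top_iff by (rule filterlim_real_sequentially)
    moreover have "eventually (\<lambda>k. t + 1 + real k = jump_time (stop_path t \<omega>) k) sequentially"
      using eventually_ge_at_top[of ?N] by eventually_elim (simp add: j)
    ultimately show ?thesis by (rule filterlim_cong[OF refl refl, THEN iffD1, rotated])
  qed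
  moreover have "0 < jump_time (stop_path t \<omega>) 0"
    using paths_jump_time_pos[OF assms(1), of 0] assms(2) by (simp add: j)
  moreover have "0 \<le> jump_size (stop_path t \<omega>) k" for k
    using paths_jump_size_nonneg[OF assms(1)] by (simp add: stop_path_def)
  ultimately show ?thesis by (simp add: paths_def)
qed

text \<open>Component \<open>k\<close> of the stopped path is the actual jump if that has occurred
  by time \<open>t\<close>, and a constant otherwise; both are observable at time
  \<open>t\<close>.\<close>

lemma measurable_stop_path:
  assumes t: "0 \<le> t" shows "stop_path t \<in> jump_filtration (ennreal t) \<rightarrow>\<^sub>M path_measure M"
proof -
  let ?F = "jump_filtration (ennreal t) :: 'n path measure"
  have gen: "{\<omega> \<in> paths. jump_time \<omega> k \<le> t \<and> \<omega> k \<in> A} \<in> sets ?F" if "A \<in> sets jump_space" for A k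
  proof -
    have "A \<in> sets borel" using that unfolding borel_prod .
    then have "{\<omega> \<in> paths. ennreal (jump_time \<omega> k) \<le> ennreal t \<and> \<omega> k \<in> A} \<in> sets ?F"
      unfolding jump_filtration_def by (subst sets_measure_of) (auto intro!: sigma_sets.Basic)
    then show ?thesis unfolding ennreal_le_iff[OF t] .
  qed
  have c: "(\<lambda>\<omega>. stop_path t \<omega> k) \<in> ?F \<rightarrow>\<^sub>M jump_space" for k
  proof (rule measurableI)
    fix A :: "(real \<times> (real ^ 'n)) set" assume A: "A \<in> sets jump_space"
    have U: "(UNIV :: (real \<times> (real ^ 'n)) set) \<in> sets jump_space" by (metis sets.top space_jump_space)
    note B = sets.compl_sets[OF gen[OF U, of k]]
    have "(\<lambda>\<omega>. stop_path t \<omega> k) -` A \<inter> space ?F = {\<omega> \<in> paths. jump_time \<omega> k \<le> t \<and> \<omega> k \<in> A} \<union>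
      (if (t + 1 + real k, 0) \<in> A then space ?F - {\<omega> \<in> paths. jump_time \<omega> k \<le> t \<and> \<omega> k \<in> UNIV} else {})"
    proof (intro set_eqI)
      fix \<omega>
      show "\<omega> \<in> (\<lambda>\<omega>. stop_path t \<omega> k) -` A \<inter> space ?F \<longleftrightarrow> \<omega> \<in> {\<omega> \<in> paths. jump_time \<omega> k \<le> t \<and> \<omega> k \<in> A} \<union>
        (if (t + 1 + real k, 0) \<in> A then space ?F - {\<omega> \<in> paths. jump_time \<omega> k \<le> t \<and> \<omega> k \<in> UNIV} else {})"
        by (cases "jump_time \<omega> k \<le> t") (simp_all add: stop_path_def conj_commute)
    qed
    also have "\<dots> \<in> sets ?F" 
      by (rule sets.Un[OF gen[OF A]]) (cases "(t + 1 + real k, 0) \<in> A"; simp only: if_True if_False B sets.empty_sets)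
    finally show "(\<lambda>\<omega>. stop_path t \<omega> k) -` A \<inter> space ?F \<in> sets ?F" .
  qed simp
  have "stop_path t \<in> ?F \<rightarrow>\<^sub>M path_space"
    by (rule measurable_PiM_single') (simp_all add: c)
  then have "stop_path t \<in> ?F \<rightarrow>\<^sub>M full_law" by (simp cong: measurable_cong_sets)
  then show ?thesis unfolding path_measure_eq
    by (intro measurable_restrict_space2) (auto intro: stop_path_in_paths t)
qed

context
  fixes \<sigma> :: "nat ^ 'n \<Rightarrow> 'n action"
  assumes \<sigma>_legal: "\<And>q i. \<sigma> q = Pay i \<Longrightarrow> 0 < q $ i"
begin

lemma feedback_run_history:
  assumes h: "same_history t \<omega> \<omega>'" and \<omega>: "\<omega> \<in> paths" "\<omega>' \<in> paths"
  shows "feedback_run \<sigma> m \<omega> k = Some (r, q, d) \<Longrightarrow> r \<le> t \<Longrightarrow> feedback_run \<sigma> m \<omega>' k = Some (r, q, d)"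
proof (induction k arbitrary: r q d)
  case (Suc k)
  then obtain r' q' d' where *: "feedback_run \<sigma> m \<omega> k = Some (r', q', d')" "step \<omega> (\<sigma> q') r' q' = Some (r, q, d)"
    by (auto split: option.splits)
  have "r' \<le> r" by (rule grid_step_SomeD(1)[OF \<omega>(1) *(2)]) (rule \<sigma>_legal)
  moreover then have "feedback_run \<sigma> m \<omega>' k = Some (r', q', d')" using Suc.IH[OF *(1)] Suc.prems(2) by simp
  ultimately show ?case using grid_step_same_history[OF h \<omega> *(2)] Suc.prems(2) by simp
qed simp

lemma grid_control_feedback: "grid_control M \<delta> m (feedback_control \<sigma> m)"
  unfolding grid_control_def grid_run_feedback_control
proof (intro conjI ballI allI impI; elim conjE)
  fix \<omega> :: "'n path" and k t q d i
  assume "feedback_run \<sigma> m \<omega> k = Some (t, q, d)" "feedback_control \<sigma> m \<omega> k = Pay i"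
  then show "0 < q $ i" by (intro \<sigma>_legal) (simp add: feedback_control_def)
next
  fix \<omega> \<omega>' :: "'n path" and t k r q d
  assume "\<omega> \<in> paths" "\<omega>' \<in> paths" "same_history t \<omega> \<omega>'" "feedback_run \<sigma> m \<omega> k = Some (r, q, d)" "r \<le> t"
  then show "feedback_control \<sigma> m \<omega> k = feedback_control \<sigma> m \<omega>' k"
    using feedback_run_history[of t \<omega> \<omega>' m k r q d] by (simp add: feedback_control_def)
qed

lemma stationary_feedback: "stationary M \<delta> m (feedback_control \<sigma> m)"
  unfolding stationary_def grid_run_feedback_control
  by (intro exI[of _ \<sigma>]) (simp add: feedback_control_def)

abbreviation (input) state_space :: "(bool \<times> real \<times> (nat ^ 'n) \<times> (real ^ 'n)) measure" where
  "state_space \<equiv> count_space UNIV \<Otimes>\<^sub>M borel \<Otimes>\<^sub>M count_space UNIV \<Otimes>\<^sub>M borel"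

text \<open>Replaces the option type by a product of standard measurable spaces, in which the flag
  marks whether the run is still alive.\<close>

definition encode :: "(real \<times> (nat ^ 'n) \<times> (real ^ 'n)) option \<Rightarrow> bool \<times> real \<times> (nat ^ 'n) \<times> (real ^ 'n)" where
  "encode z = (case z of None \<Rightarrow> (False, 0, 0, 0) | Some y \<Rightarrow> (True, y))"

lemma measurable_encode_step:
  assumes [measurable]: "t \<in> borel_measurable (path_measure M)"
  shows "(\<lambda>\<omega>. encode (step \<omega> a (t \<omega>) q)) \<in> path_measure M \<rightarrow>\<^sub>M state_space"
proof (cases a)
  case Wait
  have jc: "(\<lambda>\<omega>. jump_count \<omega> (t \<omega>)) \<in> path_measure M \<rightarrow>\<^sub>M count_space UNIV"
    by (rule measurable_jump_count) measurable
  have [measurable]: "(\<lambda>\<omega>. next_time \<omega> (t \<omega>)) \<in> borel_measurable (path_measure M)"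
    unfolding next_time_def by (rule measurable_compose_countable[OF measurable_jump_time jc])
  have [measurable]: "(\<lambda>\<omega>. next_size \<omega> (t \<omega>)) \<in> borel_measurable (path_measure M)"
    unfolding next_size_def by (rule measurable_compose_countable[OF measurable_jump_size jc])
  define y where "y \<omega> = carried q (next_time \<omega> (t \<omega>) - t \<omega>) - next_size \<omega> (t \<omega>)" for \<omega>
  have [measurable]: "y \<in> borel_measurable (path_measure M)" unfolding y_def by measurable
  have [measurable]: "(\<lambda>\<omega>. gi (y \<omega>)) \<in> path_measure M \<rightarrow>\<^sub>M count_space UNIV"
    by (rule measurable_compose[OF _ measurable_grid_index]) measurable
  have "(\<lambda>\<omega>. encode (step \<omega> a (t \<omega>) q)) = (\<lambda>\<omega>. if \<delta> < next_time \<omega> (t \<omega>) - t \<omega> then (True, t \<omega> + \<delta>, q + 1, 0)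
    else if 0 \<le> y \<omega> then (True, next_time \<omega> (t \<omega>), gi (y \<omega>), y \<omega> - gf (y \<omega>)) else (False, 0, 0, 0))"
    by (auto simp: Wait grid_step_Wait Let_def encode_def y_def fun_eq_iff)
  also have "\<dots> \<in> path_measure M \<rightarrow>\<^sub>M state_space"
    by (intro measurable_If measurable_Pair) measurable
  finally show ?thesis .
next
  case (Pay i)
  show ?thesis unfolding Pay grid_step.simps encode_def option.case by measurable
next
  case Switch
  show ?thesis unfolding Switch grid_step.simps encode_def option.case by measurable
qed

text \<open>The current index takes countably many values, so the step can be treated for each fixed
  index and action and then composed.\<close>

lemma measurable_encode_run: "(\<lambda>\<omega>. encode (feedback_run \<sigma> m \<omega> k)) \<in> path_measure M \<rightarrow>\<^sub>M state_space"
proof (induction k)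
  case 0
  show ?case by (simp add: encode_def)
next
  case (Suc k)
  define S where "S \<omega> = encode (feedback_run \<sigma> m \<omega> k)" for \<omega>
  have S[measurable]: "S \<in> path_measure M \<rightarrow>\<^sub>M state_space" unfolding S_def by (rule Suc)
  have f[measurable]: "(\<lambda>\<omega>. fst (S \<omega>)) \<in> path_measure M \<rightarrow>\<^sub>M count_space UNIV" by measurable
  have t: "(\<lambda>\<omega>. fst (snd (S \<omega>))) \<in> borel_measurable (path_measure M)" by measurable
  have q: "(\<lambda>\<omega>. fst (snd (snd (S \<omega>)))) \<in> path_measure M \<rightarrow>\<^sub>M count_space UNIV" by measurable
  have "(\<lambda>\<omega>. encode (step \<omega> (\<sigma> (fst (snd (snd (S \<omega>))))) (fst (snd (S \<omega>))) (fst (snd (snd (S \<omega>)))))) \<in>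
      path_measure M \<rightarrow>\<^sub>M state_space"
    by (rule measurable_compose_countable[OF measurable_encode_step[OF t] q])
  then have "(\<lambda>\<omega>. if fst (S \<omega>) then encode (step \<omega> (\<sigma> (fst (snd (snd (S \<omega>))))) (fst (snd (S \<omega>))) (fst (snd (snd (S \<omega>)))))
      else (False, 0, 0, 0)) \<in> path_measure M \<rightarrow>\<^sub>M state_space"
  proof (rule measurable_If)
    show "{\<omega> \<in> space (path_measure M). fst (S \<omega>)} \<in> sets (path_measure M)" by measurable
  qed (simp add: space_pair_measure)
  also have "(\<lambda>\<omega>. if fst (S \<omega>) then encode (step \<omega> (\<sigma> (fst (snd (snd (S \<omega>))))) (fst (snd (S \<omega>))) (fst (snd (snd (S \<omega>)))))
      else (False, 0, 0, 0)) = (\<lambda>\<omega>. encode (feedback_run \<sigma> m \<omega> (Suc k)))"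
    by (auto simp: S_def encode_def fun_eq_iff split: option.splits)
  finally show ?case .
qed

lemma feedback_dividends_eq:
  "grid_dividends M \<delta> m (feedback_control \<sigma> m) t \<omega> =
     (\<Sum>k\<in>{k. \<exists>r q d. feedback_run \<sigma> m \<omega> k = Some (r, q, d) \<and> r \<le> t}. snd (snd (the (feedback_run \<sigma> m \<omega> k))))"
  unfolding grid_dividends_def grid_run_feedback_control ..

text \<open>The index set of the sum depends on the path. It is finite, so the partial sums over all
  action numbers are eventually constant and the dividends are their pointwise limit.\<close>

lemma feedback_dividends_measurable:
  "(\<lambda>\<omega>. grid_dividends M \<delta> m (feedback_control \<sigma> m) t \<omega>) \<in> borel_measurable (path_measure M)"
proof (rule borel_measurable_LIMSEQ_metric)
  let ?e = "\<lambda>\<omega> k. encode (feedback_run \<sigma> m \<omega> k)"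
  let ?g = "\<lambda>\<omega> k. if fst (?e \<omega> k) \<and> fst (snd (?e \<omega> k)) \<le> t then snd (snd (snd (?e \<omega> k))) else 0"
  fix N
  have [measurable]: "(\<lambda>\<omega>. ?e \<omega> k) \<in> path_measure M \<rightarrow>\<^sub>M state_space" for k by (rule measurable_encode_run)
  show "(\<lambda>\<omega>. \<Sum>k<N. ?g \<omega> k) \<in> borel_measurable (path_measure M)" by measurable
next
  let ?e = "\<lambda>\<omega> k. encode (feedback_run \<sigma> m \<omega> k)"
  let ?g = "\<lambda>\<omega> k. if fst (?e \<omega> k) \<and> fst (snd (?e \<omega> k)) \<le> t then snd (snd (snd (?e \<omega> k))) else 0"
  fix \<omega> assume "\<omega> \<in> space (path_measure M)"
  then have \<omega>: "\<omega> \<in> paths" by simp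
  let ?A = "{k. \<exists>r q d. feedback_run \<sigma> m \<omega> k = Some (r, q, d) \<and> r \<le> t}"
  have "?A = active m (feedback_control \<sigma> m \<omega>) \<omega> t"
    unfolding active_def grid_run_eq_run[symmetric] grid_run_feedback_control ..
  then have "finite ?A"
    using finite_active[OF \<omega> grid_control_legal[OF grid_control_feedback \<omega>]] by simp
  then obtain N where N: "?A \<subseteq> {..<N}" using finite_nat_iff_bounded by auto
  have g: "?g \<omega> k = (if k \<in> ?A then snd (snd (the (feedback_run \<sigma> m \<omega> k))) else 0)" for k
    by (auto simp: encode_def split: option.splits)
  have "(\<Sum>k<n. ?g \<omega> k) = grid_dividends M \<delta> m (feedback_control \<sigma> m) t \<omega>" if "N \<le> n" for n
  proof -
    have "?A \<subseteq> {..<n}" using N that by (meson lessThan_subset_iff subset_trans)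
    then have "{..<n} \<inter> ?A = ?A" by blast
    then show ?thesis unfolding g feedback_dividends_eq
      by (subst sum.inter_restrict[symmetric]) simp_all
  qed
  then have "eventually (\<lambda>n. (\<Sum>k<n. ?g \<omega> k) = grid_dividends M \<delta> m (feedback_control \<sigma> m) t \<omega>) sequentially"
    unfolding eventually_sequentially by blast
  then show "(\<lambda>n. \<Sum>k<n. ?g \<omega> k) \<longlonglongrightarrow> grid_dividends M \<delta> m (feedback_control \<sigma> m) t \<omega>"
    by (rule tendsto_eventually)
qed

text \<open>A run switches at most once, so the infimum defining a finite switch time is
  attained.\<close>

lemma feedback_switch_iff:
  assumes \<omega>: "\<omega> \<in> paths" and t: "0 \<le> t"
  shows "grid_switch_time M \<delta> m (feedback_control \<sigma> m) \<omega> \<le> ennreal t \<longleftrightarrow>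
    (\<exists>k r q d. feedback_run \<sigma> m \<omega> k = Some (r, q, d) \<and> \<sigma> q = Switch \<and> r \<le> t)"
proof -
  let ?s = "feedback_control \<sigma> m"
  have legal: "legal m (?s \<omega>) \<omega>" by (rule grid_control_legal[OF grid_control_feedback \<omega>])
  have run: "run m (?s \<omega>) \<omega> k = feedback_run \<sigma> m \<omega> k" for k
    unfolding grid_run_eq_run[symmetric] by (rule grid_run_feedback_control)
  have sw: "?s \<omega> k = \<sigma> q" if "feedback_run \<sigma> m \<omega> k = Some (r, q, d)" for k r q d
    using that by (simp add: feedback_control_def)
  show ?thesis
  proof
    assume le: "grid_switch_time M \<delta> m ?s \<omega> \<le> ennreal t"
    show "\<exists>k r q d. feedback_run \<sigma> m \<omega> k = Some (r, q, d) \<and> \<sigma> q = Switch \<and> r \<le> t"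
      using \<omega> legal
    proof (cases rule: stopping_cases)
      case never
      then show ?thesis using le unfolding grid_switch_time_eq by (metis ennreal_neq_top infinity_ennreal_def top_unique)
    next
      case (ruin k r q d)
      then show ?thesis using le unfolding grid_switch_time_eq by (metis ennreal_neq_top infinity_ennreal_def top_unique)
    next
      case (switch k r q d)
      have "ennreal r \<le> ennreal t" using le unfolding grid_switch_time_eq switch(3) .
      then have "r \<le> t" using t by (simp add: ennreal_le_iff)
      then show ?thesis using switch(1,2) sw unfolding run by metis
    qed
  next
    assume "\<exists>k r q d. feedback_run \<sigma> m \<omega> k = Some (r, q, d) \<and> \<sigma> q = Switch \<and> r \<le> t"
    then obtain k r q d where *: "feedback_run \<sigma> m \<omega> k = Some (r, q, d)" "\<sigma> q = Switch" "r \<le> t" by blast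
    have "grid_switch_time M \<delta> m ?s \<omega> \<le> ennreal r"
      unfolding grid_switch_time_def grid_run_feedback_control
      using * sw[OF *(1)] by (intro Inf_lower) auto
    then show "grid_switch_time M \<delta> m ?s \<omega> \<le> ennreal t" using ennreal_leI[OF *(3)] by (rule order_trans)
  qed
qed

lemma feedback_switch_measurable:
  assumes "0 \<le> t"
  shows "Measurable.pred (path_measure M) (\<lambda>\<omega>. grid_switch_time M \<delta> m (feedback_control \<sigma> m) \<omega> \<le> ennreal t)"
proof -
  let ?e = "\<lambda>\<omega> k. encode (feedback_run \<sigma> m \<omega> k)"
  have [measurable]: "(\<lambda>\<omega>. ?e \<omega> k) \<in> path_measure M \<rightarrow>\<^sub>M state_space" for k by (rule measurable_encode_run)
  have "Measurable.pred (path_measure M) (\<lambda>\<omega>. \<sigma> (fst (snd (snd (?e \<omega> k)))) = Switch)" for k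
  proof -
    have "(\<lambda>\<omega>. fst (snd (snd (?e \<omega> k)))) \<in> path_measure M \<rightarrow>\<^sub>M count_space UNIV" by measurable
    then show ?thesis by (rule measurable_compose) simp
  qed
  then have "Measurable.pred (path_measure M) (\<lambda>\<omega>. \<exists>k. fst (?e \<omega> k) \<and> \<sigma> (fst (snd (snd (?e \<omega> k)))) = Switch \<and> fst (snd (?e \<omega> k)) \<le> t)"
    by measurable
  moreover have "(\<exists>k. fst (?e \<omega> k) \<and> \<sigma> (fst (snd (snd (?e \<omega> k)))) = Switch \<and> fst (snd (?e \<omega> k)) \<le> t) \<longleftrightarrow>
      grid_switch_time M \<delta> m (feedback_control \<sigma> m) \<omega> \<le> ennreal t" if "\<omega> \<in> space (path_measure M)" for \<omega>
  proof -
    have \<omega>: "\<omega> \<in> paths" using that by simp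
    have "fst (?e \<omega> k) \<and> \<sigma> (fst (snd (snd (?e \<omega> k)))) = Switch \<and> fst (snd (?e \<omega> k)) \<le> t \<longleftrightarrow>
        (\<exists>r q d. feedback_run \<sigma> m \<omega> k = Some (r, q, d) \<and> \<sigma> q = Switch \<and> r \<le> t)" for k
      by (cases "feedback_run \<sigma> m \<omega> k") (auto simp: encode_def)
    then show ?thesis unfolding feedback_switch_iff[OF \<omega> assms] by (simp only:)
  qed
  ultimately show ?thesis by (rule measurable_cong[THEN iffD1, rotated])
qed

text \<open>What a feedback control has done by time \<open>t\<close> is unchanged when the later
  jumps are replaced. Composition with \<open>stop_path\<close> then gives adaptedness, in the
  manner of Galmarino's test.\<close>

lemma feedback_stopped:
  assumes \<omega>: "\<omega> \<in> paths" and t: "0 \<le> t"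
  shows "grid_dividends M \<delta> m (feedback_control \<sigma> m) t (stop_path t \<omega>) = grid_dividends M \<delta> m (feedback_control \<sigma> m) t \<omega>"
    and "grid_switch_time M \<delta> m (feedback_control \<sigma> m) (stop_path t \<omega>) \<le> ennreal t \<longleftrightarrow>
      grid_switch_time M \<delta> m (feedback_control \<sigma> m) \<omega> \<le> ennreal t"
proof -
  have p: "stop_path t \<omega> \<in> paths" by (rule stop_path_in_paths[OF \<omega> t])
  have h: "same_history t \<omega> (stop_path t \<omega>)" by (rule same_history_stop_path)
  have iff: "feedback_run \<sigma> m (stop_path t \<omega>) k = Some (r, q, d) \<and> r \<le> t \<longleftrightarrow>
    feedback_run \<sigma> m \<omega> k = Some (r, q, d) \<and> r \<le> t" for k r q d
    using feedback_run_history[OF h \<omega> p, of m k r q d]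
      feedback_run_history[OF same_history_sym[OF h] p \<omega>, of m k r q d] by blast
  show "grid_dividends M \<delta> m (feedback_control \<sigma> m) t (stop_path t \<omega>) = grid_dividends M \<delta> m (feedback_control \<sigma> m) t \<omega>"
    unfolding feedback_dividends_eq
  proof (rule sum.cong)
    show "{k. \<exists>r q d. feedback_run \<sigma> m (stop_path t \<omega>) k = Some (r, q, d) \<and> r \<le> t} =
      {k. \<exists>r q d. feedback_run \<sigma> m \<omega> k = Some (r, q, d) \<and> r \<le> t}" unfolding iff ..
    fix k assume "k \<in> {k. \<exists>r q d. feedback_run \<sigma> m \<omega> k = Some (r, q, d) \<and> r \<le> t}"
    then obtain r q d where "feedback_run \<sigma> m \<omega> k = Some (r, q, d)" "r \<le> t" by blast
    then show "snd (snd (the (feedback_run \<sigma> m (stop_path t \<omega>) k))) = snd (snd (the (feedback_run \<sigma> m \<omega> k)))"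
      using iff[of k r q d] by simp
  qed
  show "grid_switch_time M \<delta> m (feedback_control \<sigma> m) (stop_path t \<omega>) \<le> ennreal t \<longleftrightarrow>
      grid_switch_time M \<delta> m (feedback_control \<sigma> m) \<omega> \<le> ennreal t"
    unfolding feedback_switch_iff[OF \<omega> t] feedback_switch_iff[OF p t] using iff by blast
qed

lemma feedback_in_strategies: "grid_strategy M \<delta> m (feedback_control \<sigma> m) \<in> strategies M (gp m)"
proof -
  let ?s = "feedback_control \<sigma> m"
  have "grid_dividends M \<delta> m ?s t \<in> borel_measurable (jump_filtration (ennreal t))" if t: "0 \<le> t" for t
  proof -
    have "(\<lambda>\<omega>. grid_dividends M \<delta> m ?s t (stop_path t \<omega>)) \<in> borel_measurable (jump_filtration (ennreal t))"
      by (rule measurable_compose[OF measurable_stop_path[OF t] feedback_dividends_measurable])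
    then show ?thesis
      by (rule measurable_cong[THEN iffD1, rotated]) (simp add: feedback_stopped t)
  qed
  then have "admissible M (gp m) (grid_dividends M \<delta> m ?s)"
    unfolding admissible_def using admissible_paths[OF grid_control_feedback, of _ m] by blast
  moreover have "Measurable.pred (jump_filtration y) (\<lambda>\<omega>. grid_switch_time M \<delta> m ?s \<omega> \<le> y)" for y
  proof (cases y)
    case (real t)
    then have t: "0 \<le> t" by simp
    have "Measurable.pred (jump_filtration (ennreal t)) (\<lambda>\<omega>. grid_switch_time M \<delta> m ?s (stop_path t \<omega>) \<le> ennreal t)"
      by (rule measurable_compose[OF measurable_stop_path[OF t] feedback_switch_measurable[OF t]])
    then show ?thesis unfolding real(2)
      by (rule measurable_cong[THEN iffD1, rotated]) (simp add: feedback_stopped t)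
  qed simp
  ultimately show ?thesis by (simp add: strategies_def grid_strategy_def stopping_time_def)
qed

end
end

section \<open>Values of arbitrary and of greedy controls\<close>

context grid_solution
begin

lemma strategy_value_eq:
  assumes s: "grid_control M \<delta> m s"
  shows "strategy_value M (gp m) (grid_strategy M \<delta> m s) =
    extended_expectation (path_measure M) (\<lambda>\<omega>. total dividend_reward m (s \<omega>) \<omega> +
      total (switch_reward (\<lambda>q. switch_value M (gp q))) m (s \<omega>) \<omega>) -
    extended_expectation (path_measure M) (\<lambda>\<omega>. total ruin_reward m (s \<omega>) \<omega>)"
  unfolding strategy_value_def grid_strategy_def prod.case
proof (intro arg_cong2[where f = "(-)"] extended_expectation_cong)
  fix \<omega> assume "\<omega> \<in> space (path_measure M)"
  then have \<omega>: "\<omega> \<in> paths" by simp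
  show "discounted_dividends M (grid_dividends M \<delta> m s)
      (min (grid_switch_time M \<delta> m s \<omega>) (ruin_time M (gp m) (grid_dividends M \<delta> m s) \<omega>)) \<omega> +
     (if grid_switch_time M \<delta> m s \<omega> < ruin_time M (gp m) (grid_dividends M \<delta> m s) \<omega>
      then exp (- discount M * enn2real (grid_switch_time M \<delta> m s \<omega>)) *
        switch_value M (controlled_surplus M (gp m) (grid_dividends M \<delta> m s) (enn2real (grid_switch_time M \<delta> m s \<omega>)) \<omega>)
      else 0) =
    total dividend_reward m (s \<omega>) \<omega> + total (switch_reward (\<lambda>q. switch_value M (gp q))) m (s \<omega>) \<omega>"
    unfolding dividend_part[OF s \<omega>] switch_part(1)[OF s \<omega>] ..
next
  fix \<omega> assume "\<omega> \<in> space (path_measure M)"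
  then have \<omega>: "\<omega> \<in> paths" by simp
  show "(if ruin_time M (gp m) (grid_dividends M \<delta> m s) \<omega> \<le> grid_switch_time M \<delta> m s \<omega> \<and>
        ruin_time M (gp m) (grid_dividends M \<delta> m s) \<omega> < \<infinity>
     then let r = enn2real (ruin_time M (gp m) (grid_dividends M \<delta> m s) \<omega>);
              z = left_limit (\<lambda>u. controlled_surplus M (gp m) (grid_dividends M \<delta> m s) u \<omega>) r
          in exp (- discount M * r) * penalty M z (z - controlled_surplus M (gp m) (grid_dividends M \<delta> m s) r \<omega>)
     else 0) = total ruin_reward m (s \<omega>) \<omega>"
    by (rule ruin_part(1)[OF s \<omega>])
qed

text \<open>Dividends plus switch value are bounded and the payoff is integrable, so the ruin part
  is integrable as their difference. Both extended expectations are then finite and can be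
  subtracted.\<close>

lemma payoff_expectation:
  assumes s: "grid_control M \<delta> m s" and str: "grid_strategy M \<delta> m s \<in> strategies M (gp m)"
  shows "payoff m s \<in> borel_measurable (path_measure M)"
    and "extended_expectation (path_measure M) (\<lambda>\<omega>. total dividend_reward m (s \<omega>) \<omega> +
      total (switch_reward w) m (s \<omega>) \<omega>) -
    extended_expectation (path_measure M) (\<lambda>\<omega>. total ruin_reward m (s \<omega>) \<omega>) =
    ereal (\<integral>\<omega>. payoff m s \<omega> \<partial>path_measure M)"
proof -
  let ?P = "path_measure M"
  interpret P: prob_space ?P by (rule prob_space_path_measure)
  note [measurable] = payoff_measurable[OF s str]
  have payoff: "payoff m s \<omega> = total dividend_reward m (s \<omega>) \<omega> + total (switch_reward w) m (s \<omega>) \<omega> -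
      total ruin_reward m (s \<omega>) \<omega>" if "\<omega> \<in> space ?P" for \<omega>
    unfolding payoff_def using net_total(2) grid_control_legal[OF s] that by simp
  have "(\<lambda>\<omega>. total dividend_reward m (s \<omega>) \<omega> + total (switch_reward w) m (s \<omega>) \<omega> - total ruin_reward m (s \<omega>) \<omega>)
      \<in> borel_measurable ?P"
    by measurable
  then show meas: "payoff m s \<in> borel_measurable ?P"
    by (rule measurable_cong[THEN iffD1, rotated]) (simp add: payoff)
  have i1: "integrable ?P (\<lambda>\<omega>. total dividend_reward m (s \<omega>) \<omega> + total (switch_reward w) m (s \<omega>) \<omega>)"
  proof (rule P.integrable_const_bound[of _ "K * h m + (K + \<bar>w 0\<bar>) * h m"])
    show "AE \<omega> in ?P. norm (total dividend_reward m (s \<omega>) \<omega> + total (switch_reward w) m (s \<omega>) \<omega>) \<le>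
        K * h m + (K + \<bar>w 0\<bar>) * h m"
    proof (rule AE_I2)
      fix \<omega> assume "\<omega> \<in> space ?P"
      then have \<omega>: "\<omega> \<in> paths" by simp
      note legal = grid_control_legal[OF s \<omega>]
      show "norm (total dividend_reward m (s \<omega>) \<omega> + total (switch_reward w) m (s \<omega>) \<omega>) \<le>
        K * h m + (K + \<bar>w 0\<bar>) * h m"
        using dividend_summable(2,3)[OF \<omega> legal] switch_total(2)[OF \<omega> legal abs_w_le] unfolding real_norm_def by linarith
    qed
  qed measurable
  have "integrable ?P (payoff m s)"
    by (rule payoff_integrable(1)[of False]) (use s meas in \<open>simp add: evaluates_def\<close>)
  from Bochner_Integration.integrable_diff[OF i1 this]
  have i2: "integrable ?P (\<lambda>\<omega>. total ruin_reward m (s \<omega>) \<omega>)"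
    by (rule Bochner_Integration.integrable_cong[THEN iffD1, rotated 2]) (simp_all add: payoff)
  have "(\<integral>\<omega>. payoff m s \<omega> \<partial>?P) = (\<integral>\<omega>. (total dividend_reward m (s \<omega>) \<omega> + total (switch_reward w) m (s \<omega>) \<omega>) -
      total ruin_reward m (s \<omega>) \<omega> \<partial>?P)"
    by (intro Bochner_Integration.integral_cong) (simp_all add: payoff)
  also have "\<dots> = (\<integral>\<omega>. total dividend_reward m (s \<omega>) \<omega> + total (switch_reward w) m (s \<omega>) \<omega> \<partial>?P) -
      (\<integral>\<omega>. total ruin_reward m (s \<omega>) \<omega> \<partial>?P)"
    by (rule Bochner_Integration.integral_diff[OF i1 i2])
  finally show "extended_expectation ?P (\<lambda>\<omega>. total dividend_reward m (s \<omega>) \<omega> + total (switch_reward w) m (s \<omega>) \<omega>) -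
    extended_expectation ?P (\<lambda>\<omega>. total ruin_reward m (s \<omega>) \<omega>) = ereal (\<integral>\<omega>. payoff m s \<omega> \<partial>?P)"
    unfolding extended_expectation_integrable[OF i1] extended_expectation_integrable[OF i2] by simp
qed

text \<open>Replacing the switch value by the larger \<open>w\<close> happens inside
  \<open>extended_expectation\<close>, where monotonicity holds even if the original value is
  -\<infinity>; only afterwards does integrability enter.\<close>

lemma strategy_value_le:
  assumes s: "grid_control M \<delta> m s" and str: "grid_strategy M \<delta> m s \<in> strategies M (gp m)"
  shows "strategy_value M (gp m) (grid_strategy M \<delta> m s) \<le> ereal (w m)"
proof -
  have "strategy_value M (gp m) (grid_strategy M \<delta> m s) \<le>
    extended_expectation (path_measure M) (\<lambda>\<omega>. total dividend_reward m (s \<omega>) \<omega> + total (switch_reward w) m (s \<omega>) \<omega>) -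
    extended_expectation (path_measure M) (\<lambda>\<omega>. total ruin_reward m (s \<omega>) \<omega>)"
    unfolding strategy_value_eq[OF s]
  proof (intro ereal_minus_mono extended_expectation_mono order_refl add_left_mono)
    fix \<omega> assume "\<omega> \<in> space (path_measure M)"
    then have \<omega>: "\<omega> \<in> paths" by simp
    note sm = switch_total(1)[OF \<omega> grid_control_legal[OF s \<omega>]]
    show "total (switch_reward (\<lambda>q. switch_value M (gp q))) m (s \<omega>) \<omega> \<le> total (switch_reward w) m (s \<omega>) \<omega>"
      unfolding total_def
      by (intro suminf_le sm) (auto simp: reward_term_def switch_reward_def w_ge_switch split: option.splits)
  qed
  also have "\<dots> = ereal (\<integral>\<omega>. payoff m s \<omega> \<partial>path_measure M)" by (rule payoff_expectation(2)[OF s str])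
  also have "\<dots> \<le> ereal (w m)"
  proof -
    have "(\<integral>\<omega>. payoff m s \<omega> \<partial>path_measure M) \<in> payoffs False m"
      using s payoff_expectation(1)[OF s str] by (auto simp: payoffs_def evaluates_def)
    then show ?thesis using payoffs_limit(1) by simp
  qed
  finally show ?thesis .
qed

text \<open>A greedy control switches only at indices where the switch value equals
  \<open>w\<close>, so the replacement changes nothing on any path.\<close>

lemma strategy_value_greedy:
  assumes s: "grid_control M \<delta> m s" and str: "grid_strategy M \<delta> m s \<in> strategies M (gp m)"
    and g: "greedy m s"
  shows "strategy_value M (gp m) (grid_strategy M \<delta> m s) = ereal (w m)"
proof -
  have eq: "total (switch_reward (\<lambda>q. switch_value M (gp q))) m (s \<omega>) \<omega> = total (switch_reward w) m (s \<omega>) \<omega>"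
    if "\<omega> \<in> space (path_measure M)" for \<omega>
  proof -
    have "reward_term (switch_reward (\<lambda>q. switch_value M (gp q))) m (s \<omega>) \<omega> k = reward_term (switch_reward w) m (s \<omega>) \<omega> k" for k
    proof (cases "run m (s \<omega>) \<omega> k")
      case (Some z)
      then obtain t q d where z: "run m (s \<omega>) \<omega> k = Some (t, q, d)" by (cases z) auto
      have "action_value (s \<omega> k) q = w q" using g that z unfolding greedy_def by simp
      then show ?thesis by (auto simp: reward_term_Some[OF z] switch_reward_def)
    qed (simp add: reward_term_None)
    then show ?thesis by (simp add: total_def)
  qed
  have "(\<integral>\<omega>. payoff m s \<omega> \<partial>path_measure M) \<in> payoffs True m"
    using s g payoff_expectation(1)[OF s str] by (auto simp: payoffs_def evaluates_def)
  then have "(\<integral>\<omega>. payoff m s \<omega> \<partial>path_measure M) = w m" using payoffs_limit(2) by simp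
  moreover have "strategy_value M (gp m) (grid_strategy M \<delta> m s) = ereal (\<integral>\<omega>. payoff m s \<omega> \<partial>path_measure M)"
    unfolding strategy_value_eq[OF s] payoff_expectation(2)[OF s str, symmetric]
    by (intro arg_cong2[where f = "(-)"] extended_expectation_cong refl) (simp add: eq)
  ultimately show ?thesis by simp
qed

lemma optimal_stationary_control:
  "\<exists>s. grid_control M \<delta> m s \<and> grid_strategy M \<delta> m s \<in> strategies M (gp m) \<and> stationary M \<delta> m s \<and> greedy m s"
proof -
  have "\<exists>a. action_value a q = w q \<and> (\<forall>i. a = Pay i \<longrightarrow> 0 < q $ i)" for q
  proof -
    consider "wait_operator M \<delta> w q = w q" | "switch_value M (gp q) = w q"
      | i where "0 < q $ i" "pay_operator M \<delta> i w q = w q"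
      using hjb_cases[of w q] unfolding w_fixed by metis
    then show ?thesis
    proof cases
      case 1
      then show ?thesis by (intro exI[of _ Wait]) simp
    next
      case 2
      then show ?thesis by (intro exI[of _ Switch]) simp
    next
      case (3 i)
      then show ?thesis by (intro exI[of _ "Pay i"]) simp
    qed
  qed
  then obtain \<sigma> where \<sigma>: "\<And>q. action_value (\<sigma> q) q = w q" "\<And>q i. \<sigma> q = Pay i \<Longrightarrow> 0 < q $ i" by metis
  have "greedy m (feedback_control \<sigma> m)"
    unfolding greedy_def grid_run_eq_run[of m "feedback_control \<sigma> m", symmetric] grid_run_feedback_control
    using \<sigma>(1) by (simp add: feedback_control_def)
  then show ?thesis
    using grid_control_feedback[of \<sigma>] feedback_in_strategies[of \<sigma>] stationary_feedback[of \<sigma>] \<sigma>(2) by blast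
qed

lemma grid_value_eq: "grid_value M \<delta> m = ereal (w m)"
proof (rule antisym)
  show "grid_value M \<delta> m \<le> ereal (w m)"
    unfolding grid_value_def grid_strategies_def
    by (rule SUP_least) (auto intro: strategy_value_le)
  obtain s where s: "grid_control M \<delta> m s" "grid_strategy M \<delta> m s \<in> strategies M (gp m)" "greedy m s"
    using optimal_stationary_control[of m] by blast
  have "ereal (w m) = strategy_value M (gp m) (grid_strategy M \<delta> m s)"
    by (rule strategy_value_greedy[OF s, symmetric])
  also have "\<dots> \<le> grid_value M \<delta> m"
    unfolding grid_value_def grid_strategies_def using s by (intro SUP_upper) auto
  finally show "ereal (w m) \<le> grid_value M \<delta> m" .
qed

end

theorem proposition4p4:
  fixes M :: "('n :: finite) risk_model" and \<delta> :: real
  assumes "dividend_model M" and "0 < \<delta>"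
  shows "(\<forall>m. \<bar>grid_value M \<delta> m\<bar> \<noteq> \<infinity>) \<and>
    (\<forall>m. hjb_operator M \<delta> (\<lambda>q. real_of_ereal (grid_value M \<delta> q)) m =
       real_of_ereal (grid_value M \<delta> m)) \<and>
    (\<forall>m\<^sub>0. \<exists>s. grid_control M \<delta> m\<^sub>0 s \<and>
       grid_strategy M \<delta> m\<^sub>0 s \<in> grid_strategies M \<delta> m\<^sub>0 \<and>
       grid_value M \<delta> m\<^sub>0 =
         strategy_value M (grid_point M \<delta> m\<^sub>0) (grid_strategy M \<delta> m\<^sub>0 s) \<and>
       stationary M \<delta> m\<^sub>0 s)"
proof -
  interpret dividend_model M by (rule assms(1))
  interpret grid_model M \<delta> by unfold_locales (rule assms(2))
  obtain K where K: "\<forall>i. weight M $ i * premium M $ i \<le> discount M / (2 * real CARD('n)) * K"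
    "\<forall>x\<ge>0. switch_value M x \<le> K * H x"
    "\<forall>x \<alpha>. (x, \<alpha>) \<in> ruin_pairs \<longrightarrow> - penalty M x \<alpha> \<le> K * H x"
    using growth_constant_exists by blast
  interpret grid_bound M \<delta> K by unfold_locales (use K in auto)
  obtain w where w: "\<forall>m. hjb_operator M \<delta> w m = w m" "\<forall>m. w m \<le> K * h m"
    using hjb_solution_exists by blast
  interpret grid_solution M \<delta> K w by unfold_locales (use w in auto)
  show ?thesis
  proof (intro conjI allI)
    fix m
    show "\<bar>grid_value M \<delta> m\<bar> \<noteq> \<infinity>" by (simp add: grid_value_eq)
    show "hjb_operator M \<delta> (\<lambda>q. real_of_ereal (grid_value M \<delta> q)) m = real_of_ereal (grid_value M \<delta> m)"
      by (simp add: grid_value_eq w_fixed)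
    obtain s where s: "grid_control M \<delta> m s" "grid_strategy M \<delta> m s \<in> strategies M (gp m)"
      "stationary M \<delta> m s" "greedy m s"
      using optimal_stationary_control[of m] by blast
    show "\<exists>s. grid_control M \<delta> m s \<and> grid_strategy M \<delta> m s \<in> grid_strategies M \<delta> m \<and>
      grid_value M \<delta> m = strategy_value M (gp m) (grid_strategy M \<delta> m s) \<and> stationary M \<delta> m s"
      using s strategy_value_greedy[OF s(1,2,4)]
      by (intro exI[of _ s]) (auto simp: grid_strategies_def grid_value_eq)
  qed
qed

end
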